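(* Let $1<p<\infty$ and $n\ge1$. (i) There is a constant $c>0$ depending only on $n$ and $p$ such that for every weight $w\in A_p^{+(s)}(\mathbb{R}^n)$ and every $f\in L^p_w(\mathbb{R}^n)$, $$\|M^{+(s)}f\|_{L^{p}_{w}(\mathbb{R}^n)}\le c\Big(\prod_{i=1}^{n}\|w\|_{A_p^{+}(x_{i})}\Big)^{1/(p-1)}\|f\|_{L^{p}_{w}(\mathbb{R}^n)}.$$ Further, the power $1/(p-1)$ is sharp: there is no positive non-decreasing function $\psi$ on $[1,\infty)$ with $\psi(t)/t^{1/(p-1)}\to0$ as $t\to\infty$ such that $\|M^{+(s)}f\|_{L^{p}_{w}(\mathbb{R}^n)}\le\psi\big(\prod_{i=1}^{n}\|w\|_{A_p^+(x_{i})}\big)\|f\|_{L^{p}_{w}(\mathbb{R}^n)}$ for all $w\in A_p^{+(s)}(\mathbb{R}^n)$ and all $f\in L^p_w(\mathbb{R}^n)$. (ii) There is a constant $c>0$ depending only on $n$ and $p$ such that for every weight $w\in A_p^{-(s)}(\mathbb{R}^n)$ and every $f\in L^p_w(\mathbb{R}^n)$, $$\|M^{-(s)}f\|_{L^{p}_{w}(\mathbb{R}^n)}\le c\Big(\prod_{i=1}^{n}\|w\|_{A_p^{-}(x_{i})}\Big)^{1/(p-1)}\|f\|_{L^{p}_{w}(\mathbb{R}^n)}.$$ Further, the power $1/(p-1)$ is sharp in the same sense (with $M^{-(s)}$, $A_p^{-(s)}$, $A_p^-(x_i)$ in place of $M^{+(s)}$, $A_p^{+(s)}$, $A_p^+(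x_i)$).
   Context: A weight is an a.e. positive locally integrable function. $p'=p/(p-1)$; $\|f\|_{L^p_w(\mathbb{R}^n)}=\big(\int_{\mathbb{R}^n}|f|^p w\,dx\big)^{1/p}$. The one-sided strong maximal operators are $$M^{+(s)}f(x)=\sup_{h_1,\dots,h_n>0}\frac{1}{h_1\cdots h_n}\int_{x_1}^{x_1+h_1}\cdots\int_{x_n}^{x_n+h_n}|f(y)|\,dy,$$ $$M^{-(s)}f(x)=\sup_{h_1,\dots,h_n>0}\frac{1}{h_1\cdots h_n}\int_{x_1-h_1}^{x_1}\cdots\int_{x_n-h_n}^{x_n}|f(y)|\,dy.$$ For $x\in\mathbb{R}^n$ and $h=(h_1,\dots,h_n)$ with all $h_i>0$, put $P^+_{x,h}=\prod_i[x_i,x_i+h_i]$ and $P^-_{x,h}=\prod_i[x_i-h_i,x_i]$, each of measure $|h|:=h_1\cdots h_n$. Then $w\in A_p^{+(s)}(\mathbb{R}^n)$ if $$\sup_{x,h}\Big(\frac1{|h|}\int_{P^-_{x,h}}w\Big)\Big(\frac1{|h|}\int_{P^+_{x,h}}w^{1-p'}\Big)^{p-1}<\infty,$$ and $w\in A_p^{-(s)}(\mathbb{R}^n)$ if the same holds with $P^+_{x,h}$ and $P^-_{x,h}$ interchanged. The one-sided characteristics in the variable $x_i$, uniform with respect to the other variables, are as follows: for fixed $x_j$ ($j\ne i$) let $w_i(t)=w(x_1,\dots,x_{i-1},t,x_{i+1},\dots,x_n)$; then $$\|w\|_{A_p^+(x_i)}=\operatorname*{ess\,sup}_{(x_j)_{j\ne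 i}\in\mathbb{R}^{n-1}}\ \sup_{x_i\in\mathbb{R},\,h>0}\Big(\frac1h\int_{x_i-h}^{x_i}w_i(t)dt\Big)\Big(\frac1h\int_{x_i}^{x_i+h}w_i(t)^{1-p'}dt\Big)^{p-1},$$ $$\|w\|_{A_p^-(x_i)}=\operatorname*{ess\,sup}_{(x_j)_{j\ne i}\in\mathbb{R}^{n-1}}\ \sup_{x_i\in\mathbb{R},\,h>0}\Big(\frac1h\int_{x_i}^{x_i+h}w_i(t)dt\Big)\Big(\frac1h\int_{x_i-h}^{x_i}w_i(t)^{1-p'}dt\Big)^{p-1}.$$ It is known that $w\in A_p^{\pm(s)}(\mathbb{R}^n)$ if and only if $\|w\|_{A_p^{\pm}(x_i)}<\infty$ for all $i$. *)

theory Defs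
  imports "HOL-Analysis.Analysis"
begin

text \<open>
  All averages, norms and characteristics take values in the extended nonnegative reals, so none of
  them depends on an a priori finiteness or integrability assumption. The power below is only used
  with exponents \<open>a > 0\<close>, for which \<open>0\<close> is sent to \<open>0\<close> and \<open>\<infinity>\<close> to \<open>\<infinity>\<close>.
\<close>

definition ennpow :: "ennreal \<Rightarrow> real \<Rightarrow> ennreal" where
  "ennpow x a = (if x = \<infinity> then \<infinity> else ennreal (enn2real x powr a))"

definition conj_exp :: "real \<Rightarrow> real" where
  "conj_exp p = p / (p - 1)"

definition weight :: "(real ^ 'n \<Rightarrow> real) \<Rightarrow> bool" where
  "weight w \<longleftrightarrow>
     w \<in> borel_measurable lebesgue \<and>
     (AE x in lebesgue. 0 < w x) \<and>
     (\<forall>K. compact K \<longrightarrow> set_integrable lebesgue K w)"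

text \<open>The weighted norm is defined on extended nonnegative functions, because a maximal function
  may be infinite; the norm of a real function \<open>f\<close> is that of \<open>\<bar>f\<bar>\<close>.\<close>

definition Lp_norm :: "real \<Rightarrow> (real ^ 'n \<Rightarrow> real) \<Rightarrow> (real ^ 'n \<Rightarrow> ennreal) \<Rightarrow> ennreal" where
  "Lp_norm p w g = ennpow (\<integral>\<^sup>+ x. ennpow (g x) p * ennreal (w x) \<partial>lebesgue) (1 / p)"

definition Lp_space :: "real \<Rightarrow> (real ^ 'n \<Rightarrow> real) \<Rightarrow> (real ^ 'n \<Rightarrow> real) set" where
  "Lp_space p w =
     {f. f \<in> borel_measurable lebesgue \<and> Lp_norm p w (\<lambda>x. ennreal \<bar>f x\<bar>) < \<infinity>}"

definition pos_vec :: "real ^ 'n \<Rightarrow> bool" where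
  "pos_vec h \<longleftrightarrow> (\<forall>i. 0 < h $ i)"

definition vol :: "real ^ 'n \<Rightarrow> ennreal" where
  "vol h = ennreal (\<Prod>i\<in>UNIV. h $ i)"

definition box_plus :: "real ^ 'n \<Rightarrow> real ^ 'n \<Rightarrow> (real ^ 'n) set" where
  "box_plus x h = cbox x (x + h)"

definition box_minus :: "real ^ 'n \<Rightarrow> real ^ 'n \<Rightarrow> (real ^ 'n) set" where
  "box_minus x h = cbox (x - h) x"

definition strong_max_plus :: "(real ^ 'n \<Rightarrow> real) \<Rightarrow> real ^ 'n \<Rightarrow> ennreal" where
  "strong_max_plus f x =
     (SUP h\<in>{h. pos_vec h}. (\<integral>\<^sup>+ y\<in>box_plus x h. ennreal \<bar>f y\<bar> \<partial>lebesgue) / vol h)"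

definition strong_max_minus :: "(real ^ 'n \<Rightarrow> real) \<Rightarrow> real ^ 'n \<Rightarrow> ennreal" where
  "strong_max_minus f x =
     (SUP h\<in>{h. pos_vec h}. (\<integral>\<^sup>+ y\<in>box_minus x h. ennreal \<bar>f y\<bar> \<partial>lebesgue) / vol h)"

definition Ap_strong_plus :: "real \<Rightarrow> (real ^ 'n \<Rightarrow> real) set" where
  "Ap_strong_plus p =
     {w. weight w \<and>
       (SUP (x, h)\<in>{(x, h). pos_vec h}.
          ((\<integral>\<^sup>+ y\<in>box_minus x h. ennreal (w y) \<partial>lebesgue) / vol h) *
          ennpow ((\<integral>\<^sup>+ y\<in>box_plus x h. ennreal (w y powr (1 - conj_exp p)) \<partial>lebesgue) / vol h)
            (p - 1)) < \<infinity>}"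

definition Ap_strong_minus :: "real \<Rightarrow> (real ^ 'n \<Rightarrow> real) set" where
  "Ap_strong_minus p =
     {w. weight w \<and>
       (SUP (x, h)\<in>{(x, h). pos_vec h}.
          ((\<integral>\<^sup>+ y\<in>box_plus x h. ennreal (w y) \<partial>lebesgue) / vol h) *
          ennpow ((\<integral>\<^sup>+ y\<in>box_minus x h. ennreal (w y powr (1 - conj_exp p)) \<partial>lebesgue) / vol h)
            (p - 1)) < \<infinity>}"

text \<open>Essential supremum. The library's \<open>esssup\<close> is this Limsup for Borel functions, but
  is \<open>\<infinity>\<close> by convention for all others. A slice quantity of a Lebesgue measurable weight
  need only agree a.e. with a Borel function, so the measurability test is dropped.\<close>

definition ess_sup :: "'a measure \<Rightarrow> ('a \<Rightarrow> ennreal) \<Rightarrow> ennreal" where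
  "ess_sup M f = Limsup (ae_filter M) f"

text \<open>The points \<open>(x\<^sub>j)\<close>, \<open>j \<noteq> i\<close>, of \<open>(n - 1)\<close>-dimensional space with Lebesgue measure on the Borel
  sets (a.e. statements are unaffected by completion). If \<open>n = 1\<close>, this is the unit mass on a
  one-point space.\<close>

definition other_coords :: "'n::finite \<Rightarrow> ('n \<Rightarrow> real) measure" where
  "other_coords i = Pi\<^sub>M (UNIV - {i}) (\<lambda>_. lborel)"

definition slice :: "'n::finite \<Rightarrow> ('n \<Rightarrow> real) \<Rightarrow> (real ^ 'n \<Rightarrow> real) \<Rightarrow> real \<Rightarrow> real" where
  "slice i z w t = w (\<chi> j. if j = i then t else z j)"

definition Ap1_plus :: "real \<Rightarrow> (real \<Rightarrow> real) \<Rightarrow> ennreal" where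
  "Ap1_plus p v =
     (SUP (t, h)\<in>UNIV \<times> {0<..}.
        ((\<integral>\<^sup>+ s\<in>{t - h..t}. ennreal (v s) \<partial>lebesgue) / ennreal h) *
        ennpow ((\<integral>\<^sup>+ s\<in>{t..t + h}. ennreal (v s powr (1 - conj_exp p)) \<partial>lebesgue) / ennreal h)
          (p - 1))"

definition Ap1_minus :: "real \<Rightarrow> (real \<Rightarrow> real) \<Rightarrow> ennreal" where
  "Ap1_minus p v =
     (SUP (t, h)\<in>UNIV \<times> {0<..}.
        ((\<integral>\<^sup>+ s\<in>{t..t + h}. ennreal (v s) \<partial>lebesgue) / ennreal h) *
        ennpow ((\<integral>\<^sup>+ s\<in>{t - h..t}. ennreal (v s powr (1 - conj_exp p)) \<partial>lebesgue) / ennreal h)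
          (p - 1))"

definition Ap_char_plus :: "real \<Rightarrow> 'n::finite \<Rightarrow> (real ^ 'n \<Rightarrow> real) \<Rightarrow> ennreal" where
  "Ap_char_plus p i w = ess_sup (other_coords i) (\<lambda>z. Ap1_plus p (slice i z w))"

definition Ap_char_minus :: "real \<Rightarrow> 'n::finite \<Rightarrow> (real ^ 'n \<Rightarrow> real) \<Rightarrow> ennreal" where
  "Ap_char_minus p i w = ess_sup (other_coords i) (\<lambda>z. Ap1_minus p (slice i z w))"

end

theory Submission
  imports Defs
begin

text \<open>
  The strong maximal operator is dominated by the composition of the one-sided maximal operators in
  the coordinate directions, so by Fubini the upper bound reduces to
  \<open>\<integral> (M\<^sup>+ f)\<^sup>p v \<le> C K\<^bsup>p/(p-1)\<^esup> \<integral> f\<^sup>p v\<close> on the line, where \<open>K\<close> is the characteristic of \<open>v\<close>.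

  On the line let \<open>s = v\<^bsup>1-p'\<^esup>\<close>. Split a component \<open>(\<alpha>, \<beta>)\<close> of \<open>{M\<^sup>+ f > \<kappa>}\<close> by the points
  \<open>x\<^sub>k = \<beta> - 2\<^bsup>-k\<^esup> (\<beta> - \<alpha>)\<close>, let \<open>J = (x\<^sub>k, x\<^bsub>k+1\<^esub>)\<close> and \<open>m\<close> the
  integral of \<open>f\<close> over \<open>(x\<^bsub>k+1\<^esub>, \<beta>)\<close>. The \<open>v\<close>-mass of \<open>{\<kappa> < M\<^sup>+ f \<le> 2\<kappa>}\<close> in \<open>(x\<^bsub>k-1\<^esub>, x\<^sub>k]\<close> is at
  most \<open>C K m\<^sup>p \<kappa>\<^bsup>-p\<^esup> s(x\<^sub>k, \<beta>)\<^bsup>1-p\<^esup>\<close>, and a second application of the \<open>A\<^sub>p\<close> condition gives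
  \<open>s(x\<^sub>k, \<beta>)\<^bsup>1-p\<^esup> \<le> C K\<^bsup>1/(p-1)\<^esup> \<integral>\<^sub>F s(x) s(x, \<beta>)\<^bsup>-p\<^esup> dx\<close> for every \<open>F \<subseteq> J\<close> of proportional length.
  Choose \<open>F\<close> as the part of \<open>J\<close> outside \<open>{M\<^sup>+ f > 16\<kappa>}\<close>: these sets overlap at most four times
  when \<open>\<kappa>\<close> runs over the powers of \<open>2\<close>, and on \<open>F\<close> the maximal function of \<open>f/s\<close> with respect to
  \<open>s dx\<close> is at least \<open>m / s(x, \<beta>)\<close>. That maximal function is bounded on \<open>L\<^sup>p(s)\<close> with a constant
  independent of \<open>s\<close>.

  Sharpness is tested on products of the power weights \<open>\<bar>t\<bar>\<^bsup>(1-\<delta>)(p-1)\<^esup>\<close> and of the functions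
  \<open>\<bar>t\<bar>\<^bsup>\<delta>-1\<^esup>\<close> on \<open>(-1, 0)\<close>, for which \<open>M\<^sup>+ f \<ge> \<delta>\<^bsup>-n\<^esup> f\<close> while the characteristics are at most
  \<open>(6/\<delta>)\<^bsup>p-1\<^esup>\<close>. Part (ii) follows from part (i) by the reflection \<open>x \<mapsto> -x\<close>.
\<close>

section \<open>Powers of extended nonnegative reals\<close>

lemma ennpow_ennreal: "0 \<le> x \<Longrightarrow> ennpow (ennreal x) a = ennreal (x powr a)"
  by (simp add: ennpow_def)

lemma ennpow_top [simp]: "ennpow \<infinity> a = \<infinity>" "ennpow top a = top"
  by (simp_all add: ennpow_def)

lemma ennpow_0 [simp]: "ennpow 0 a = 0"
  by (simp add: ennpow_def)

lemma ennpow_1 [simp]: "ennpow 1 a = 1"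
  by (simp add: ennpow_def)

lemma ennpow_one_exponent [simp]: "ennpow x 1 = x"
  by (cases x) (simp_all add: ennpow_def)

lemma ennpow_mono: "x \<le> y \<Longrightarrow> 0 \<le> a \<Longrightarrow> ennpow x a \<le> ennpow y a"
  by (cases x; cases y) (auto simp: ennpow_def ennreal_le_iff top_unique intro!: powr_mono2)

lemma ennpow_mult: "0 < a \<Longrightarrow> ennpow (x * y) a = ennpow x a * ennpow y a"
  by (cases x; cases y)
    (auto simp: ennpow_def ennreal_mult[symmetric] powr_mult ennreal_mult_eq_top_iff ennreal_top_mult ennreal_mult_top)

lemma ennpow_ennpow: "ennpow (ennpow x a) b = ennpow x (a * b)"
  by (cases x) (auto simp: ennpow_def powr_powr)

lemma ennpow_prod: "0 < a \<Longrightarrow> ennpow (\<Prod>i\<in>I. f i) a = (\<Prod>i\<in>I. ennpow (f i) a)"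
  by (induction I rule: infinite_finite_induct) (auto simp: ennpow_mult)

lemma ennpow_add_exponent: "0 < a \<Longrightarrow> 0 < b \<Longrightarrow> ennpow x (a + b) = ennpow x a * ennpow x b"
  by (cases x) (auto simp: ennpow_def powr_add ennreal_mult)

lemma ennpow_eq_0_iff [simp]: "ennpow x a = 0 \<longleftrightarrow> x = 0"
  by (cases x) (auto simp: ennpow_def)

lemma ennpow_eq_top_iff [simp]: "ennpow x a = top \<longleftrightarrow> x = top"
  by (cases x) (auto simp: ennpow_def)

lemma ennpow_less_top_iff [simp]: "ennpow x a < top \<longleftrightarrow> x < top"
  by (simp add: less_top[symmetric])

lemma measurable_ennpow [measurable]:
  assumes [measurable]: "f \<in> borel_measurable M"
  shows "(\<lambda>x. ennpow (f x) a) \<in> borel_measurable M"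
proof -
  have [measurable]: "{x \<in> space M. f x = \<infinity>} \<in> sets M" by measurable
  show ?thesis unfolding ennpow_def
    by (intro measurable_If measurable_compose[OF _ measurable_ennreal] powr_real_measurable) measurable
qed

lemma ennpow_le_imp_le: "ennpow x a \<le> y \<Longrightarrow> 0 < a \<Longrightarrow> x \<le> ennpow y (1 / a)"
  using ennpow_mono[of "ennpow x a" y "1 / a"] by (simp add: ennpow_ennpow)

text \<open>Both inequalities come from monotonicity: the power \<open>1 / a\<close> undoes the
  power \<open>a\<close>, so an upper bound can be moved through the power in either
  direction.\<close>

lemma ennpow_SUP:
  assumes "0 < a" shows "ennpow (SUP i\<in>I. f i) a = (SUP i\<in>I. ennpow (f i) a)"
proof (rule antisym)
  have "(SUP i\<in>I. f i) \<le> ennpow (SUP i\<in>I. ennpow (f i) a) (1 / a)"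
    using assms by (intro SUP_least ennpow_le_imp_le SUP_upper)
  from ennpow_mono[OF this, of a] show "ennpow (SUP i\<in>I. f i) a \<le> (SUP i\<in>I. ennpow (f i) a)"
    using assms by (simp add: ennpow_ennpow)
  show "(SUP i\<in>I. ennpow (f i) a) \<le> ennpow (SUP i\<in>I. f i) a"
    using assms by (intro SUP_least ennpow_mono SUP_upper) auto
qed

section \<open>Masses of intervals on the line\<close>

definition mass :: "(real \<Rightarrow> ennreal) \<Rightarrow> real \<Rightarrow> real \<Rightarrow> ennreal" where
  "mass \<phi> a b = (\<integral>\<^sup>+ x\<in>{a<..<b}. \<phi> x \<partial>lborel)"

lemma mass_mono: "a' \<le> a \<Longrightarrow> b \<le> b' \<Longrightarrow> mass \<phi> a b \<le> mass \<phi> a' b'"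
  unfolding mass_def by (intro nn_integral_mono mult_left_mono) (auto simp: indicator_def)

lemma mass_empty [simp]: "b \<le> a \<Longrightarrow> mass \<phi> a b = 0"
  by (simp add: mass_def)

lemma mass_one: "a \<le> b \<Longrightarrow> mass (\<lambda>_. 1) a b = ennreal (b - a)"
  by (simp add: mass_def)

lemma mass_closed: "mass \<phi> a b = (\<integral>\<^sup>+ x\<in>{a..b}. \<phi> x \<partial>lborel)"
  unfolding mass_def
proof (rule nn_integral_cong_AE)
  show "AE x in lborel. \<phi> x * indicator {a<..<b} x = \<phi> x * indicator {a..b} x"
    using AE_lborel_singleton[of a] AE_lborel_singleton[of b] by eventually_elim (auto simp: indicator_def)
qed

lemma mass_add:
  assumes [measurable]: "\<phi> \<in> borel_measurable borel" and "a \<le> b" "b \<le> c"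
  shows "mass \<phi> a c = mass \<phi> a b + mass \<phi> b c"
proof -
  have "mass \<phi> a c = (\<integral>\<^sup>+ x. \<phi> x * indicator {a<..<b} x + \<phi> x * indicator {b<..<c} x \<partial>lborel)"
    unfolding mass_def
  proof (rule nn_integral_cong_AE)
    show "AE x in lborel. \<phi> x * indicator {a<..<c} x =
        \<phi> x * indicator {a<..<b} x + \<phi> x * indicator {b<..<c} x"
      using AE_lborel_singleton[of b] by eventually_elim (use assms in \<open>auto simp: indicator_def\<close>)
  qed
  then show ?thesis by (simp add: mass_def nn_integral_add)
qed

text \<open>Finite mass makes \<open>\<phi>\<close> finite almost everywhere on the window, so a
  real-valued version of it has an indefinite integral, which is continuous. The rising sun argument
  and the level sets of masses rely on this.\<close>

lemma continuous_on_mass: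
  assumes [measurable]: "\<phi> \<in> borel_measurable borel" and fin: "mass \<phi> l r < \<infinity>"
  shows "continuous_on {l..r} (\<lambda>x. enn2real (mass \<phi> l x))"
proof -
  define g where "g x = enn2real (\<phi> x * indicator {l<..<r} x)" for x
  have [measurable]: "g \<in> borel_measurable borel" unfolding g_def by measurable
  have "AE x in lborel. \<phi> x * indicator {l<..<r} x \<noteq> \<infinity>"
    using fin unfolding mass_def by (intro nn_integral_PInf_AE) auto
  then have ae: "AE x in lborel. ennreal (g x) = \<phi> x * indicator {l<..<r} x"
    by eventually_elim (simp add: g_def less_top)
  have g0: "0 \<le> g x" for x by (simp add: g_def)
  have "(\<integral>\<^sup>+x. ennreal (g x) \<partial>lborel) = mass \<phi> l r"
    unfolding mass_def by (rule nn_integral_cong_AE[OF ae])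
  then have "g integrable_on UNIV"
    using fin g0 by (intro nn_integral_integrable_on) auto
  then have int: "g integrable_on {a..b}" for a b
    by (rule integrable_on_subinterval) auto
  have eq: "enn2real (mass \<phi> l x) = integral {l..x} g" if "x \<in> {l..r}" for x
  proof -
    have 1: "mass \<phi> l x = (\<integral>\<^sup>+x'. ennreal (indicator {l..x} x' * g x') \<partial>lborel)"
      unfolding mass_def
    proof (rule nn_integral_cong_AE)
      show "AE x' in lborel. \<phi> x' * indicator {l<..<x} x' = ennreal (indicator {l..x} x' * g x')"
        using ae AE_lborel_singleton[of l] AE_lborel_singleton[of x]
        by eventually_elim (use that in \<open>auto simp: indicator_def\<close>)
    qed
    have ind: "(\<lambda>x'. indicator {l..x} x' * g x') = (\<lambda>x'. if x' \<in> {l..x} then g x' else 0)"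
      by (auto simp: fun_eq_iff)
    have 2: "(\<integral>\<^sup>+x'. ennreal (indicator {l..x} x' * g x') \<partial>lborel) = ennreal (integral {l..x} g)"
    proof (rule nn_integral_has_integral_lborel)
      show "((\<lambda>x'. indicator {l..x} x' * g x') has_integral integral {l..x} g) UNIV"
        using iffD2[OF has_integral_restrict_UNIV integrable_integral[OF int[of l x]]]
        by (simp only: ind)
    qed (auto simp: g0)
    show ?thesis unfolding 1 2 using g0 by (simp add: integral_nonneg int)
  qed
  have "continuous_on {l..r} (\<lambda>x. integral {l..x} g)"
    by (rule indefinite_integral_continuous_1[OF int])
  then show ?thesis using eq by (subst continuous_on_cong[OF refl eq]) auto
qed

section \<open>The rising sun lemma\<close>

text \<open>A component is open and connected, hence the open interval between its infimum and
  supremum. An endpoint lying in \<open>U\<close> could be adjoined without losing connectedness,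
  against the maximality of the component.\<close>

lemma bounded_component_real:
  fixes U :: "real set"
  assumes "open U" "U \<subseteq> {l<..<r}" "C \<in> components U"
  obtains a b where "C = {a<..<b}" "a < b" "l \<le> a" "b \<le> r" "a \<notin> U" "b \<notin> U"
proof -
  have C: "open C" "connected C" "C \<noteq> {}" "C \<subseteq> U"
    using assms in_components_nonempty in_components_connected in_components_subset open_components by blast+
  have bdd: "bdd_below C" "bdd_above C"
    using C assms(2) by (auto intro!: bdd_belowI[of _ l] bdd_aboveI[of _ r] simp: subset_iff less_imp_le)
  have nI: "Inf C \<notin> C"
  proof
    assume "Inf C \<in> C"
    then obtain e where e: "e > 0" "ball (Inf C) e \<subseteq> C" using C(1) openE by blast
    then have "Inf C - e/2 \<in> C" by (auto simp: subset_iff dist_real_def)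
    from cInf_lower[OF this bdd(1)] e show False by simp
  qed
  have nS: "Sup C \<notin> C"
  proof
    assume "Sup C \<in> C"
    then obtain e where e: "e > 0" "ball (Sup C) e \<subseteq> C" using C(1) openE by blast
    then have "Sup C + e/2 \<in> C" by (auto simp: subset_iff dist_real_def)
    from cSup_upper[OF this bdd(2)] e show False by simp
  qed
  have eq: "C = {Inf C<..<Sup C}"
  proof (rule set_eqI, rule iffI)
    fix x assume "x \<in> C"
    then show "x \<in> {Inf C<..<Sup C}"
      using cInf_lower[OF _ bdd(1)] cSup_upper[OF _ bdd(2)] nI nS
      by (auto simp: less_le)
  next
    fix x assume "x \<in> {Inf C<..<Sup C}"
    then obtain c d where "c \<in> C" "c < x" "d \<in> C" "x < d"
      using cInf_lessD[OF C(3), of x] less_cSupD[OF C(3), of x] by auto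
    then show "x \<in> C" using connected_contains_Icc[OF C(2), of c d] by auto
  qed
  have lt: "Inf C < Sup C" using C(3) eq by force
  have max: "x \<notin> U" if x: "x \<in> {Inf C..Sup C}" "x \<notin> C" for x
  proof
    assume "x \<in> U"
    have "connected (insert x C)"
    proof (rule connected_intermediate_closure[OF C(2)])
      have "closure C = {Inf C..Sup C}" using eq lt closure_greaterThanLessThan by metis
      then show "insert x C \<subseteq> closure C" using x closure_subset by blast
    qed auto
    then have "insert x C \<subseteq> C"
      using components_maximal[OF assms(3), of "insert x C"] \<open>x \<in> U\<close> C by blast
    with x show False by auto
  qed
  have "l \<le> Inf C" using C assms(2) by (intro cInf_greatest) (auto simp: subset_iff less_imp_le)
  moreover have "Sup C \<le> r" using C assms(2) by (intro cSup_least) (auto simp: subset_iff less_imp_le)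
  ultimately show ?thesis using that[OF eq lt] max[of "Inf C"] max[of "Sup C"] nI nS lt by auto
qed

text \<open>An open set is the disjoint union of countably many components, so by countable
  additivity two measures need only be compared on these intervals.\<close>

lemma emeasure_open_le_by_components:
  fixes U :: "real set"
  assumes "open U" "U \<subseteq> {l<..<r}" and [simp]: "sets M = sets borel" "sets N = sets borel"
    and le: "\<And>a b. l \<le> a \<Longrightarrow> a < b \<Longrightarrow> b \<le> r \<Longrightarrow> {a<..<b} \<subseteq> U \<Longrightarrow> a \<notin> U \<Longrightarrow> b \<notin> U \<Longrightarrow>
      emeasure M {a<..<b} \<le> emeasure N {a<..<b}"
  shows "emeasure M U \<le> emeasure N U"
proof -
  have op: "open C" if "C \<in> components U" for C using open_components assms(1) that by blast
  have disj: "disjoint_family_on (\<lambda>C. C) (components U)"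
    using components_nonoverlap by (auto simp: disjoint_family_on_def)
  have cnt: "countable (components U)"
    using countable_disjoint_open_subsets[of "components U"] op disj
    by (auto simp: disjoint_family_on_def pairwise_def disjnt_def)
  have UU: "U = (\<Union>C\<in>components U. C)" using Union_components[of U] by simp
  have "emeasure M U = (\<integral>\<^sup>+ C. emeasure M C \<partial>count_space (components U))"
    by (subst UU, rule emeasure_UN_countable) (auto simp: op cnt disj)
  also have "\<dots> \<le> (\<integral>\<^sup>+ C. emeasure N C \<partial>count_space (components U))"
  proof (rule nn_integral_mono)
    fix C assume "C \<in> space (count_space (components U))"
    then have "C \<in> components U" by simp
    then obtain a b where "C = {a<..<b}" "a < b" "l \<le> a" "b \<le> r" "a \<notin> U" "b \<notin> U"
      using bounded_component_real[OF assms(1,2)] by metis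
    moreover have "C \<subseteq> U" using \<open>C \<in> components U\<close> in_components_subset by blast
    ultimately show "emeasure M C \<le> emeasure N C" using le by auto
  qed
  also have "\<dots> = emeasure N U"
    by (subst (2) UU, rule emeasure_UN_countable[symmetric]) (auto simp: op cnt disj)
  finally show ?thesis .
qed

lemma rising_sun_open:
  fixes G :: "real \<Rightarrow> real"
  assumes "continuous_on {l..r} G"
  shows "open {z. l < z \<and> z < r \<and> (\<exists>e\<in>{z<..r}. G z < G e)}"
proof -
  have "{z. l < z \<and> z < r \<and> (\<exists>e\<in>{z<..r}. G z < G e)} = (\<Union>e\<in>{..r}. {l<..<e} \<inter> G -` {..<G e})"
    by auto
  moreover have "open ({l<..<e} \<inter> G -` {..<G e})" if "e \<in> {..r}" for e
    using that by (intro continuous_open_preimage continuous_on_subset[OF assms]) auto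
  ultimately show ?thesis by auto
qed

text \<open>Riesz's rising sun argument. A maximum of \<open>G\<close> over [z, b] at a point m < b
  would lie in \<open>U\<close>, so a larger value would occur later. It cannot occur up to b by the
  choice of m, nor beyond b, where all values are at most \<open>G b\<close> because b is not in
  \<open>U\<close>. The left end a follows by continuity.\<close>

lemma rising_sun_max:
  fixes G :: "real \<Rightarrow> real"
  assumes cont: "continuous_on {l..r} G" and U: "U = {z. l < z \<and> z < r \<and> (\<exists>e\<in>{z<..r}. G z < G e)}"
    and ab: "l \<le> a" "a < b" "b \<le> r" "{a<..<b} \<subseteq> U" "b \<notin> U"
  shows "\<And>e. e \<in> {b..r} \<Longrightarrow> G e \<le> G b" "\<And>z. z \<in> {a..b} \<Longrightarrow> G z \<le> G b"
proof -
  show right: "G e \<le> G b" if "e \<in> {b..r}" for e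
    using ab that unfolding U by (cases "e = b") (auto simp: not_less)
  have inner: "G z \<le> G b" if z: "z \<in> {a<..b}" for z
  proof -
    have "continuous_on {z..b} G" using z ab by (intro continuous_on_subset[OF cont]) auto
    then obtain m where m: "m \<in> {z..b}" "\<And>y. y \<in> {z..b} \<Longrightarrow> G y \<le> G m"
      using continuous_attains_sup[of "{z..b}" G] z by auto
    show ?thesis
    proof (cases "m = b")
      case False
      then have "m \<in> U" using m z ab by auto
      then obtain e where e: "e \<in> {m<..r}" "G m < G e" unfolding U by auto
      then have "e > b" using m(2)[of e] m(1) by force
      with right[of e] e m(2)[of b] z show ?thesis by auto
    qed (use m z in auto)
  qed
  show "G z \<le> G b" if z: "z \<in> {a..b}" for z
  proof -
    have "continuous_on {a..b} G" using ab by (intro continuous_on_subset[OF cont]) auto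
    have cl: "closure {a<..b} = {a..b}" using ab by simp
    have "\<forall>x\<in>{a..b}. G x \<le> G b"
      using continuous_le_on_closure[of "{a<..b}" G _ "G b"] \<open>continuous_on {a..b} G\<close> inner
      unfolding cl by blast
    then show ?thesis using z by blast
  qed
qed

text \<open>The set where the one-sided maximal function of \<open>\<phi>\<close> relative to the density \<open>s\<close>, formed with
  intervals inside the window \<open>(l, r)\<close>, exceeds \<open>c\<close>.\<close>

definition rsun :: "(real \<Rightarrow> ennreal) \<Rightarrow> (real \<Rightarrow> ennreal) \<Rightarrow> real \<Rightarrow> real \<Rightarrow> real \<Rightarrow> real set" where
  "rsun \<phi> s l r c = {z. l < z \<and> z < r \<and> (\<exists>e\<in>{z<..r}. ennreal c * mass s z e < mass \<phi> z e)}"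

text \<open>The rising sun lemma is applied to \<open>G\<close>, the mass of \<open>\<phi>\<close>
  minus c times the mass of \<open>s\<close>, both measured from l. Thus the right end b of a
  component separates ratios: they are at least c on intervals from the component up to b, and at
  most c on intervals starting at b.\<close>

lemma rsun_facts:
  assumes [measurable]: "\<phi> \<in> borel_measurable borel" "s \<in> borel_measurable borel"
    and fin: "mass \<phi> l r < \<infinity>" "mass s l r < \<infinity>" and c: "0 \<le> c"
  shows rsun_open: "open (rsun \<phi> s l r c)"
    and rsun_left: "\<And>a b z. l \<le> a \<Longrightarrow> a < b \<Longrightarrow> b \<le> r \<Longrightarrow> {a<..<b} \<subseteq> rsun \<phi> s l r c \<Longrightarrow>
      b \<notin> rsun \<phi> s l r c \<Longrightarrow> a \<le> z \<Longrightarrow> z \<le> b \<Longrightarrow> ennreal c * mass s z b \<le> mass \<phi> z b"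
    and rsun_right: "\<And>a b e. l \<le> a \<Longrightarrow> a < b \<Longrightarrow> b \<le> r \<Longrightarrow> {a<..<b} \<subseteq> rsun \<phi> s l r c \<Longrightarrow>
      b \<notin> rsun \<phi> s l r c \<Longrightarrow> b \<le> e \<Longrightarrow> e \<le> r \<Longrightarrow> mass \<phi> b e \<le> ennreal c * mass s b e"
proof -
  define G where "G x = enn2real (mass \<phi> l x) - c * enn2real (mass s l x)" for x
  have cont: "continuous_on {l..r} G"
    unfolding G_def by (intro continuous_intros continuous_on_mass fin) auto
  have fin': "mass \<phi> x y < \<infinity>" "mass s x y < \<infinity>" if "l \<le> x" "y \<le> r" for x y
    using mass_mono[of l x y r] that fin by (auto intro: le_less_trans)
  have G: "G y - G x = enn2real (mass \<phi> x y) - c * enn2real (mass s x y)" if "l \<le> x" "x \<le> y" "y \<le> r" for x y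
  proof -
    have "enn2real (mass f l y) = enn2real (mass f l x) + enn2real (mass f x y)"
      if "f \<in> {\<phi>, s}" for f
      using that \<open>l \<le> x\<close> \<open>x \<le> y\<close> \<open>y \<le> r\<close> fin'[of l x] fin'[of x y]
      by (subst mass_add[of f l x y]) (auto simp: enn2real_plus)
    then show ?thesis by (simp add: G_def algebra_simps)
  qed
  have le: "ennreal c * mass s x y \<le> mass \<phi> x y \<longleftrightarrow> G x \<le> G y"
    "mass \<phi> x y \<le> ennreal c * mass s x y \<longleftrightarrow> G y \<le> G x" if "l \<le> x" "x \<le> y" "y \<le> r" for x y
    using fin'[of x y] that G[OF that] c
    by (cases "mass \<phi> x y"; cases "mass s x y"; auto simp: ennreal_mult[symmetric])+
  have lt: "ennreal c * mass s x y < mass \<phi> x y \<longleftrightarrow> G x < G y" if "l \<le> x" "x \<le> y" "y \<le> r" for x y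
    using le(2)[OF that] by (auto simp: not_le[symmetric])
  have U: "rsun \<phi> s l r c = {z. l < z \<and> z < r \<and> (\<exists>e\<in>{z<..r}. G z < G e)}"
    unfolding rsun_def by (intro Collect_cong conj_cong bex_cong refl) (auto simp: lt)
  show "open (rsun \<phi> s l r c)" unfolding U by (rule rising_sun_open[OF cont])
  show "ennreal c * mass s z b \<le> mass \<phi> z b"
    if "l \<le> a" "a < b" "b \<le> r" "{a<..<b} \<subseteq> rsun \<phi> s l r c" "b \<notin> rsun \<phi> s l r c" "a \<le> z" "z \<le> b" for a b z
    using rising_sun_max(2)[OF cont U that(1-5), of z] that by (subst le) auto
  show "mass \<phi> b e \<le> ennreal c * mass s b e"
    if "l \<le> a" "a < b" "b \<le> r" "{a<..<b} \<subseteq> rsun \<phi> s l r c" "b \<notin> rsun \<phi> s l r c" "b \<le> e" "e \<le> r" for a b e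
    using rising_sun_max(1)[OF cont U that(1-5), of e] that by (subst le) auto
qed

lemma rsun_subset: "rsun \<phi> s l r c \<subseteq> {l<..<r}"
  by (auto simp: rsun_def)

text \<open>Each component (a, b) satisfies c s(a, b) \<le> \<phi>(a, b), and the components are
  summed. Nothing is lost to overlaps, so the weak type constant is 1 for every density
  \<open>s\<close>.\<close>

lemma rsun_weak_type:
  assumes [measurable]: "\<phi> \<in> borel_measurable borel" "s \<in> borel_measurable borel"
    and fin: "mass \<phi> l r < \<infinity>" "mass s l r < \<infinity>" and c: "0 \<le> c"
  shows "ennreal c * (\<integral>\<^sup>+ x\<in>rsun \<phi> s l r c. s x \<partial>lborel) \<le> (\<integral>\<^sup>+ x\<in>rsun \<phi> s l r c. \<phi> x \<partial>lborel)"
proof -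
  note facts = rsun_facts[OF assms]
  have [measurable]: "rsun \<phi> s l r c \<in> sets borel" using facts(1) by auto
  have m: "emeasure (density lborel (\<lambda>x. ennreal c * s x)) A = ennreal c * (\<integral>\<^sup>+ x\<in>A. s x \<partial>lborel)"
    if [measurable]: "A \<in> sets borel" for A
    by (simp add: emeasure_density mult.assoc nn_integral_cmult)
  have "emeasure (density lborel (\<lambda>x. ennreal c * s x)) (rsun \<phi> s l r c) \<le> emeasure (density lborel \<phi>) (rsun \<phi> s l r c)"
  proof (rule emeasure_open_le_by_components[OF facts(1) rsun_subset])
    fix a b assume "l \<le> a" "a < b" "b \<le> r" "{a<..<b} \<subseteq> rsun \<phi> s l r c" "a \<notin> rsun \<phi> s l r c" "b \<notin> rsun \<phi> s l r c"
    with facts(2)[of a b a] show "emeasure (density lborel (\<lambda>x. ennreal c * s x)) {a<..<b} \<le> emeasure (density lborel \<phi>) {a<..<b}"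
      by (subst m) (simp_all add: emeasure_density mass_def)
  qed auto
  then show ?thesis by (subst (asm) m) (simp_all add: emeasure_density)
qed

section \<open>Maximal functions relative to an arbitrary density\<close>

lemma nn_integral_count_space_ge: "f (i::'a) \<le> (\<integral>\<^sup>+ i. f i \<partial>count_space UNIV)"
proof -
  have "f i = (\<integral>\<^sup>+ j. f j * indicator {i} j \<partial>count_space UNIV)" by simp
  also have "\<dots> \<le> (\<integral>\<^sup>+ i. f i \<partial>count_space UNIV)"
    by (intro nn_integral_mono) (auto simp: indicator_def)
  finally show ?thesis .
qed

lemma dyadic_level:
  fixes x :: real assumes "0 < x"
  obtains j :: int where "2 powr j < x" "x \<le> 2 powr (j + 1)"
proof -
  define j where "j = \<lceil>log 2 x\<rceil> - 1"
  have "real_of_int j < log 2 x" "log 2 x \<le> real_of_int j + 1"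
    unfolding j_def by linarith+
  then have "2 powr j < x" "x \<le> 2 powr (real_of_int j + 1)"
    using assms by (simp_all add: less_log_iff log_le_iff)
  then show ?thesis using that[of j] by simp
qed

definition geo_const :: "real \<Rightarrow> real" where
  "geo_const a = 1 / (1 - 2 powr (- a))"

lemma geo_const_pos: "0 < a \<Longrightarrow> 0 < geo_const a"
  by (simp add: geo_const_def powr_less_one)

lemma geometric_suminf_powr:
  assumes "0 < a" "0 \<le> c"
  shows "(\<Sum>n. ennreal (c * 2 powr (- (real n * a)))) = ennreal (c * geo_const a)"
proof -
  have lt: "2 powr (- a) < (1::real)" using assms by (simp add: powr_less_one)
  have eq: "2 powr (- (real n * a)) = (2 powr (- a)) ^ n" for n
    by (subst powr_realpow[symmetric]) (auto simp: powr_powr mult.commute)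
  have "(\<lambda>n. c * (2 powr (- a)) ^ n) sums (c * (1 / (1 - 2 powr (- a))))"
    using lt by (intro sums_mult geometric_sums) auto
  then have "(\<lambda>n. c * 2 powr (- (real n * a))) sums (c * geo_const a)"
    by (simp add: eq geo_const_def)
  then show ?thesis
    using assms by (intro suminf_ennreal_eq) auto
qed

text \<open>For finite positive X only indices up to some J with 2^J \<le> X contribute. Going down
  from J the terms form a geometric series whose first term is at most X^a.\<close>

lemma dyadic_sum_below:
  fixes a :: real
  assumes a: "0 < a"
  shows "(\<integral>\<^sup>+ (j::int). ennreal (2 powr (j * a)) * indicator {j::int. ennreal (2 powr j) < X} j \<partial>count_space UNIV)
    \<le> ennreal (geo_const a) * ennpow X a"
proof (cases X)
  case (real x)
  show ?thesis
  proof (cases "x = 0")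
    case False
    with real have x: "0 < x" by simp
    define J where "J = \<lfloor>log 2 x\<rfloor>"
    have J: "2 powr J \<le> x" using x by (simp add: J_def powr_le_iff)
    have sub: "{j::int. ennreal (2 powr j) < X} \<subseteq> {..J}"
    proof
      fix j :: int assume "j \<in> {j. ennreal (2 powr j) < X}"
      then have "2 powr j < x" using real by (simp add: ennreal_less_iff)
      then have "real_of_int j < log 2 x" using x by (simp add: less_log_iff)
      then show "j \<in> {..J}" unfolding J_def by (simp add: le_floor_iff)
    qed
    have bij: "bij_betw (\<lambda>n. J - int n) UNIV {..J}"
      by (rule bij_betwI[where g="\<lambda>j. nat (J - j)"]) auto
    have "(\<integral>\<^sup>+ (j::int). ennreal (2 powr (j * a)) * indicator {j::int. ennreal (2 powr j) < X} j \<partial>count_space UNIV)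
      \<le> (\<integral>\<^sup>+ (j::int). ennreal (2 powr (j * a)) * indicator {..J} j \<partial>count_space UNIV)"
      using sub by (intro nn_integral_mono mult_left_mono) (auto simp: indicator_def)
    also have "\<dots> = (\<integral>\<^sup>+ j. ennreal (2 powr (real_of_int j * a)) \<partial>count_space {..J})"
      by (rule nn_integral_count_space_indicator[symmetric]) simp
    also have "\<dots> = (\<Sum>n. ennreal (2 powr (real_of_int (J - int n) * a)))"
      by (simp add: nn_integral_bij_count_space[symmetric, OF bij] nn_integral_count_space_nat)
    also have "\<dots> = (\<Sum>n. ennreal (2 powr (J * a) * 2 powr (- (real n * a))))"
      by (simp add: powr_add[symmetric] algebra_simps)
    also have "\<dots> = ennreal (2 powr (J * a) * geo_const a)"
      using a by (intro geometric_suminf_powr) auto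
    also have "\<dots> \<le> ennreal (geo_const a * x powr a)"
    proof (rule ennreal_leI)
      have "2 powr (J * a) = (2 powr J) powr a" by (simp add: powr_powr)
      also have "\<dots> \<le> x powr a" using J a by (intro powr_mono2) auto
      finally show "2 powr (J * a) * geo_const a \<le> geo_const a * x powr a"
        using geo_const_pos[OF a] by (simp add: mult.commute)
    qed
    finally show ?thesis using real geo_const_pos[OF a] by (simp add: ennpow_ennreal ennreal_mult)
  qed (use real in simp)
next
  case top
  then show ?thesis using geo_const_pos[OF a] by (simp add: ennreal_mult_top)
qed

text \<open>One term suffices: some j has 2^j < X \<le> 2^(j+1). For infinite X all terms are
  present and they are unbounded.\<close>

lemma ennpow_le_dyadic_sum:
  fixes a :: real
  assumes a: "0 < a"
  shows "ennpow X a \<le> (\<integral>\<^sup>+ (j::int). ennreal (2 powr ((j + 1) * a)) * indicator {j::int. ennreal (2 powr j) < X} j \<partial>count_space UNIV)"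
    (is "_ \<le> ?I")
proof -
  have pt: "ennreal (2 powr (real_of_int (j + 1) * a)) \<le> ?I" if "ennreal (2 powr j) < X" for j :: int
    using nn_integral_count_space_ge[of "\<lambda>j::int. ennreal (2 powr ((j + 1) * a)) * indicator {j::int. ennreal (2 powr j) < X} j" j] that
    by simp
  show ?thesis
  proof (cases X)
    case (real x)
    show ?thesis
    proof (cases "x = 0")
      case False
      with real have x: "0 < x" by simp
      obtain j :: int where j: "2 powr j < x" "x \<le> 2 powr (j + 1)" using dyadic_level[OF x] .
      have "ennpow X a \<le> ennreal (2 powr (real_of_int (j + 1) * a))"
        using real powr_mono2[OF less_imp_le[OF a] _ j(2)] x
        by (auto simp: ennpow_ennreal powr_powr intro!: ennreal_leI)
      also have "\<dots> \<le> ?I" using j real by (intro pt) (simp add: ennreal_less_iff)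
      finally show ?thesis .
    qed (use real in simp)
  next
    case top
    have "?I = \<infinity>"
    proof (rule ccontr)
      assume "?I \<noteq> \<infinity>"
      then obtain y where y: "?I = ennreal y" "0 \<le> y" by (cases ?I) auto
      obtain n :: nat where n: "y < 2 ^ n" using real_arch_pow[of 2 y] by auto
      \<comment> \<open>With this index the term at j is at least 2^n, which exceeds the supposed
        finite value y.\<close>
      define j :: int where "j = \<lceil>real n / a\<rceil>"
      have "real n \<le> real_of_int (j + 1) * a"
        using a le_of_int_ceiling[of "real n / a"] unfolding pos_divide_le_eq[OF a]
        by (simp add: j_def distrib_right add_increasing2)
      then have "2 powr real n \<le> 2 powr (real_of_int (j + 1) * a)" by simp
      then have "y < 2 powr (real_of_int (j + 1) * a)" using n by (simp add: powr_realpow)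
      moreover have "ennreal (2 powr (real_of_int (j + 1) * a)) \<le> ennreal y"
        using pt[of j] top y by simp
      ultimately show False using y by (simp add: ennreal_le_iff)
    qed
    then show ?thesis by simp
  qed
qed

text \<open>For finite positive X the layer containing X supplies the whole bound. Unlike the full
  dyadic sum, this version can be matched with differences of consecutive level sets.\<close>

lemma ennpow_le_dyadic_layer:
  fixes a :: real
  assumes a: "0 < a" and X: "X < \<infinity>"
  shows "ennpow X a \<le> (\<integral>\<^sup>+ (j::int). ennreal (2 powr ((j + 1) * a)) *
    indicator {j::int. ennreal (2 powr j) < X \<and> X \<le> ennreal (2 powr (j + 1))} j \<partial>count_space UNIV)"
    (is "_ \<le> ?I")
proof (cases X)
  case (real x)
  show ?thesis
  proof (cases "x = 0")
    case False
    with real have x: "0 < x" by simp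
    obtain j :: int where j: "2 powr j < x" "x \<le> 2 powr (j + 1)" using dyadic_level[OF x] .
    have "ennpow X a \<le> ennreal (2 powr (real_of_int (j + 1) * a))"
      using real powr_mono2[OF less_imp_le[OF a] _ j(2)] x
      by (auto simp: ennpow_ennreal powr_powr intro!: ennreal_leI)
    also have "\<dots> \<le> ?I"
      using nn_integral_count_space_ge[of "\<lambda>j::int. ennreal (2 powr ((j + 1) * a)) *
         indicator {j::int. ennreal (2 powr j) < X \<and> X \<le> ennreal (2 powr (j + 1))} j" j] j real
      by (simp add: ennreal_less_iff ennreal_leI)
    finally show ?thesis .
  qed (use real in simp)
qed (use X in simp)

text \<open>The value 0 outside the window makes the superlevel sets at levels c \<ge> 0 exactly the
  sets \<open>rsun\<close>.\<close>

definition maxfn :: "(real \<Rightarrow> ennreal) \<Rightarrow> (real \<Rightarrow> ennreal) \<Rightarrow> real \<Rightarrow> real \<Rightarrow> real \<Rightarrow> ennreal" where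
  "maxfn \<phi> s l r z = (if l < z \<and> z < r then SUP e\<in>{z<..r}. mass \<phi> z e / mass s z e else 0)"

lemma mass_pos:
  assumes [measurable]: "s \<in> borel_measurable borel" and pos: "\<And>x. 0 < s x" and "a < b"
  shows "0 < mass s a b"
proof (rule ccontr)
  assume "\<not> 0 < mass s a b"
  then have "mass s a b = 0" by simp
  then have "AE x in lborel. s x * indicator {a<..<b} x = 0"
    unfolding mass_def by (subst (asm) nn_integral_0_iff_AE) auto
  then have "AE x in lborel. x \<notin> {a<..<b}"
    by eventually_elim (use pos in \<open>auto simp: indicator_def split: if_splits\<close>, metis less_irrefl)
  then have "emeasure lborel {a<..<b} = 0"
    by (subst (asm) AE_iff_measurable[of "{a<..<b}"]) auto
  with \<open>a < b\<close> show False by simp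
qed

lemma ennreal_less_divide:
  fixes x y z :: ennreal
  assumes "0 < z" "z < \<infinity>" "x < \<infinity>" shows "x < y / z \<longleftrightarrow> x * z < y"
  using assms
  by (cases x; cases y; cases z)
    (auto simp: divide_ennreal ennreal_mult[symmetric] ennreal_less_iff pos_less_divide_eq ennreal_top_divide)

lemma maxfn_greater:
  assumes [measurable]: "s \<in> borel_measurable borel" and pos: "\<And>x. 0 < s x" and fin: "mass s l r < \<infinity>"
    and c: "0 \<le> c"
  shows "{z. ennreal c < maxfn \<phi> s l r z} = rsun \<phi> s l r c"
proof -
  have "ennreal c < mass \<phi> z e / mass s z e \<longleftrightarrow> ennreal c * mass s z e < mass \<phi> z e"
    if "l < z" "z < e" "e \<le> r" for z e
  proof (rule ennreal_less_divide)
    show "0 < mass s z e" by (rule mass_pos[OF _ pos]) (use that in auto)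
    show "mass s z e < \<infinity>" using mass_mono[of l z e r s] that fin by auto
  qed simp
  then show ?thesis
    unfolding maxfn_def rsun_def by (auto simp: less_SUP_iff)
qed

lemma measurable_maxfn:
  assumes [measurable]: "\<phi> \<in> borel_measurable borel" "s \<in> borel_measurable borel"
    and pos: "\<And>x. 0 < s x" and fin: "mass \<phi> l r < \<infinity>" "mass s l r < \<infinity>"
  shows "maxfn \<phi> s l r \<in> borel_measurable borel"
proof (rule borel_measurableI_greater)
  fix y :: ennreal
  show "{x \<in> space borel. y < maxfn \<phi> s l r x} \<in> sets borel"
  proof (cases y)
    case (real c)
    then show ?thesis
      using maxfn_greater[OF _ pos fin(2), of c] rsun_open[OF _ _ fin, of c] by auto
  qed simp
qed

text \<open>Marcinkiewicz interpolation between the weak type bound with constant 1 and the trivial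
  supremum bound, carried out on dyadic levels. Neither endpoint depends on \<open>s\<close>, so the
  constant depends on \<open>p\<close> only.\<close>

lemma maxfn_strong_type:
  assumes [measurable]: "g \<in> borel_measurable borel" "s \<in> borel_measurable borel"
    and pos: "\<And>x. 0 < s x" and fin: "mass (\<lambda>x. g x * s x) l r < \<infinity>" "mass s l r < \<infinity>" and p: "1 < p"
  shows "(\<integral>\<^sup>+ x. ennpow (maxfn (\<lambda>x. g x * s x) s l r x) p * s x \<partial>lborel)
    \<le> ennreal (2 powr (2 * p) * geo_const (p - 1)) * (\<integral>\<^sup>+ x\<in>{l<..<r}. (ennpow (g x) p * s x) \<partial>lborel)"
proof -
  let ?\<phi> = "\<lambda>x. g x * s x"
  have meas [measurable]: "maxfn ?\<phi> s l r \<in> borel_measurable borel"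
    by (rule measurable_maxfn[OF _ _ pos fin]) auto
  define T where "T j x = (if ennreal (2 powr (real_of_int j - 1)) < g x then g x * s x else 0)" for j :: int and x
  have [measurable]: "T j \<in> borel_measurable borel" for j unfolding T_def by measurable
  have fT: "mass (T j) l r < \<infinity>" for j
  proof -
    have "mass (T j) l r \<le> mass ?\<phi> l r" unfolding mass_def T_def
      by (intro nn_integral_mono mult_right_mono) auto
    then show ?thesis using fin by auto
  qed
  \<comment> \<open>Marcinkiewicz truncation: where \<open>g \<le> 2\<^bsup>j-1\<^esup>\<close> it contributes at most half of the level.\<close>
  have sub: "rsun ?\<phi> s l r (2 powr j) \<subseteq> rsun (T j) s l r (2 powr (real_of_int j - 1))" for j :: int
  proof
    fix z assume "z \<in> rsun ?\<phi> s l r (2 powr j)"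
    then obtain e where z: "l < z" "z < r" and e: "z < e" "e \<le> r" "ennreal (2 powr j) * mass s z e < mass ?\<phi> z e"
      unfolding rsun_def by auto
    let ?c = "2 powr (real_of_int j - 1)"
    have "mass ?\<phi> z e \<le> (\<integral>\<^sup>+ x. T j x * indicator {z<..<e} x + ennreal ?c * (s x * indicator {z<..<e} x) \<partial>lborel)"
      unfolding mass_def
      by (intro nn_integral_mono) (auto simp: T_def indicator_def not_less intro: mult_right_mono)
    also have "\<dots> = mass (T j) z e + ennreal ?c * mass s z e"
      unfolding mass_def by (subst nn_integral_add) (auto simp: nn_integral_cmult)
    finally have le: "mass ?\<phi> z e \<le> mass (T j) z e + ennreal ?c * mass s z e" .
    have two: "2 powr j = ?c + ?c" by (simp add: powr_diff)
    have "ennreal ?c * mass s z e + ennreal ?c * mass s z e < mass (T j) z e + ennreal ?c * mass s z e"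
      using less_le_trans[OF e(3) le] unfolding two by (subst (asm) ennreal_plus) (auto simp: distrib_right)
    then have "ennreal ?c * mass s z e < mass (T j) z e"
      by (metis add_right_mono not_le)
    then show "z \<in> rsun (T j) s l r ?c" using z e unfolding rsun_def by auto
  qed
  have weak: "(\<integral>\<^sup>+ x. indicator {z. ennreal (2 powr j) < maxfn ?\<phi> s l r z} x * s x \<partial>lborel)
      \<le> ennreal (2 powr (1 - real_of_int j)) * (\<integral>\<^sup>+ x\<in>{l<..<r}. T j x \<partial>lborel)" for j :: int
  proof -
    let ?c = "2 powr (real_of_int j - 1)"
    let ?R = "rsun (T j) s l r ?c"
    have "(\<integral>\<^sup>+ x. indicator {z. ennreal (2 powr j) < maxfn ?\<phi> s l r z} x * s x \<partial>lborel) \<le> (\<integral>\<^sup>+ x\<in>?R. s x \<partial>lborel)"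
      using sub[of j] by (subst maxfn_greater[OF _ pos fin(2)]) (auto intro!: nn_integral_mono simp: indicator_def)
    also have "\<dots> = ennreal (2 powr (1 - real_of_int j)) * (ennreal ?c * (\<integral>\<^sup>+ x\<in>?R. s x \<partial>lborel))"
      by (simp add: mult.assoc[symmetric] ennreal_mult[symmetric] powr_add[symmetric])
    also have "\<dots> \<le> ennreal (2 powr (1 - real_of_int j)) * (\<integral>\<^sup>+ x\<in>?R. T j x \<partial>lborel)"
      by (intro mult_left_mono rsun_weak_type fT fin) auto
    also have "\<dots> \<le> ennreal (2 powr (1 - real_of_int j)) * (\<integral>\<^sup>+ x\<in>{l<..<r}. T j x \<partial>lborel)"
      using rsun_subset[of "T j" s l r ?c] by (intro mult_left_mono nn_integral_mono) (auto simp: indicator_def)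
    finally show ?thesis .
  qed
  have "(\<integral>\<^sup>+ x. ennpow (maxfn ?\<phi> s l r x) p * s x \<partial>lborel)
    \<le> (\<integral>\<^sup>+ x. (\<integral>\<^sup>+ (j::int). ennreal (2 powr ((j + 1) * p)) * indicator {j::int. ennreal (2 powr j) < maxfn ?\<phi> s l r x} j \<partial>count_space UNIV) * s x \<partial>lborel)"
    using p ennpow_le_dyadic_sum[of p] by (intro nn_integral_mono mult_right_mono) auto
  also have "\<dots> = (\<integral>\<^sup>+ x. (\<integral>\<^sup>+ (j::int). ennreal (2 powr ((j + 1) * p)) * (indicator {z. ennreal (2 powr j) < maxfn ?\<phi> s l r z} x * s x) \<partial>count_space UNIV) \<partial>lborel)"
    by (intro nn_integral_cong, subst nn_integral_multc[symmetric]) (auto intro!: nn_integral_cong simp: indicator_def)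
  also have "\<dots> = (\<integral>\<^sup>+ (j::int). \<integral>\<^sup>+ x. ennreal (2 powr ((j + 1) * p)) * (indicator {z. ennreal (2 powr j) < maxfn ?\<phi> s l r z} x * s x) \<partial>lborel \<partial>count_space UNIV)"
    by (rule nn_integral_count_space_nn_integral) auto
  also have "\<dots> \<le> (\<integral>\<^sup>+ (j::int). ennreal (2 powr ((j + 1) * p)) * (ennreal (2 powr (1 - real_of_int j)) * (\<integral>\<^sup>+ x\<in>{l<..<r}. T j x \<partial>lborel)) \<partial>count_space UNIV)"
    using weak by (intro nn_integral_mono, subst nn_integral_cmult) (auto intro!: mult_left_mono)
  also have "\<dots> = (\<integral>\<^sup>+ (j::int). \<integral>\<^sup>+ x. ennreal (2 powr ((j + 1) * p)) * (ennreal (2 powr (1 - real_of_int j)) * (T j x * indicator {l<..<r} x)) \<partial>lborel \<partial>count_space UNIV)"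
    by (intro nn_integral_cong) (simp add: nn_integral_cmult)
  also have "\<dots> = (\<integral>\<^sup>+ x. \<integral>\<^sup>+ (j::int). ennreal (2 powr ((j + 1) * p)) * (ennreal (2 powr (1 - real_of_int j)) * (T j x * indicator {l<..<r} x)) \<partial>count_space UNIV \<partial>lborel)"
    by (rule nn_integral_count_space_nn_integral[symmetric]) auto
  also have "\<dots> \<le> (\<integral>\<^sup>+ x. ennreal (2 powr (2 * p) * geo_const (p - 1)) * (ennpow (g x) p * s x * indicator {l<..<r} x) \<partial>lborel)"
  proof (rule nn_integral_mono)
    fix x
    let ?L = "\<integral>\<^sup>+ (j::int). ennreal (2 powr ((j + 1) * p)) * (ennreal (2 powr (1 - real_of_int j)) * (T j x * indicator {l<..<r} x)) \<partial>count_space UNIV"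
    \<comment> \<open>The truncation condition g > 2^(j-1) is rewritten as 2^j < 2g, so that the sum
      over j becomes that of \<open>dyadic_sum_below\<close> with X = 2g and exponent p - 1.\<close>
    let ?S = "{j::int. ennreal (2 powr real_of_int j) < 2 * g x}"
    let ?i = "g x * s x * indicator {l<..<r} x"
    have lt: "ennreal (2 powr (real_of_int j - 1)) < g x \<longleftrightarrow> ennreal (2 powr real_of_int j) < 2 * g x" for j :: int
    proof -
      have "ennreal (2 powr real_of_int j) < 2 * ennreal r \<longleftrightarrow> 2 powr real_of_int j < 2 * r" if "0 \<le> r" for r
        using that ennreal_mult[of 2 r] by (simp add: ennreal_less_iff[symmetric])
      then show ?thesis
        by (cases "g x") (auto simp: ennreal_less_iff powr_diff ennreal_mult_top)
    qed
    have "?L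
      = (\<integral>\<^sup>+ (j::int). (ennreal (2 powr (p + 1)) * ?i) * (ennreal (2 powr (real_of_int j * (p - 1))) * indicator ?S j) \<partial>count_space UNIV)"
    proof (rule nn_integral_cong)
      fix j :: int
      have "ennreal (2 powr ((j + 1) * p)) * ennreal (2 powr (1 - real_of_int j)) = ennreal (2 powr (p + 1)) * ennreal (2 powr (real_of_int j * (p - 1)))"
        by (simp add: ennreal_mult[symmetric] powr_add[symmetric] algebra_simps)
      then show "ennreal (2 powr ((j + 1) * p)) * (ennreal (2 powr (1 - real_of_int j)) * (T j x * indicator {l<..<r} x))
        = (ennreal (2 powr (p + 1)) * ?i) * (ennreal (2 powr (real_of_int j * (p - 1))) * indicator ?S j)"
        unfolding T_def lt by (simp add: indicator_def mult.assoc[symmetric]) (simp add: ac_simps)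
    qed
    also have "\<dots> = (ennreal (2 powr (p + 1)) * ?i) * (\<integral>\<^sup>+ (j::int). (ennreal (2 powr (real_of_int j * (p - 1))) * indicator ?S j) \<partial>count_space UNIV)"
      by (rule nn_integral_cmult) auto
    also have "\<dots> \<le> (ennreal (2 powr (p + 1)) * ?i) * (ennreal (geo_const (p - 1)) * ennpow (2 * g x) (p - 1))"
      using p by (intro mult_left_mono dyadic_sum_below) auto
    also have "ennpow (2 * g x) (p - 1) = ennreal (2 powr (p - 1)) * ennpow (g x) (p - 1)"
      using p ennpow_ennreal[of 2 "p - 1"] by (subst ennpow_mult) auto
    also have "(ennreal (2 powr (p + 1)) * ?i) * (ennreal (geo_const (p - 1)) * \<dots>) =
      (ennreal (2 powr (p + 1)) * ennreal (2 powr (p - 1)) * ennreal (geo_const (p - 1))) * ((ennpow (g x) (p - 1) * ennpow (g x) 1) * s x * indicator {l<..<r} x)"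
      by (simp add: ac_simps)
    also have "ennreal (2 powr (p + 1)) * ennreal (2 powr (p - 1)) = ennreal (2 powr (2 * p))"
      by (simp add: ennreal_mult[symmetric] powr_add[symmetric])
    also have "ennpow (g x) (p - 1) * ennpow (g x) 1 = ennpow (g x) p"
      using p ennpow_add_exponent[of "p - 1" 1 "g x"] by simp
    also have "ennreal (2 powr (2 * p)) * ennreal (geo_const (p - 1)) = ennreal (2 powr (2 * p) * geo_const (p - 1))"
      using geo_const_pos[of "p - 1"] p by (simp add: ennreal_mult)
    finally show "?L
      \<le> ennreal (2 powr (2 * p) * geo_const (p - 1)) * (ennpow (g x) p * s x * indicator {l<..<r} x)" .
  qed
  also have "\<dots> = ennreal (2 powr (2 * p) * geo_const (p - 1)) * (\<integral>\<^sup>+ x\<in>{l<..<r}. (ennpow (g x) p * s x) \<partial>lborel)"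
    by (rule nn_integral_cmult) auto
  finally show ?thesis .
qed

section \<open>The one-sided maximal theorem on the line\<close>

text \<open>One of the two terms is always at least 1: if \<theta>A < 1, then (\<theta>A)^q \<le> 1,
  and the second term is the reciprocal of (\<theta>A)^q because B A^q = 1.\<close>

lemma young_unit:
  fixes A B \<theta> q :: real
  assumes "0 < A" "0 < \<theta>" "0 < q" "B * A powr q = 1"
  shows "1 \<le> \<theta> * A + \<theta> powr (- q) * B"
proof (cases "1 \<le> \<theta> * A")
  case True
  have "0 < B" using assms by (smt (verit) mult_nonpos_nonneg powr_ge_zero)
  then have "0 \<le> \<theta> powr (- q) * B" by simp
  then show ?thesis using True by linarith
next
  case False
  have "(\<theta> * A) powr q \<le> 1" using False assms by (intro powr_le1) auto
  moreover have "(\<theta> powr (- q) * B) * (\<theta> * A) powr q = 1"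
    using assms by (simp add: powr_mult powr_minus field_simps)
  moreover have "0 < (\<theta> * A) powr q" using assms by simp
  ultimately have "1 \<le> \<theta> powr (- q) * B"
    by (smt (verit) mult_left_le mult_nonpos_nonneg)
  then show ?thesis using assms by (smt (verit) mult_pos_pos)
qed

text \<open>Here \<open>s\<close> stands for v^(1-p'), characterised by v s^(p-1) = 1, and
  \<open>ap\<close> is the A_p condition multiplied by h^p. \<open>K\<close> may be any upper bound
  for the characteristic.\<close>

locale one_sided_Ap =
  fixes p K :: real and v s :: "real \<Rightarrow> real"
  assumes p: "1 < p" and K: "0 < K"
    and meas [measurable]: "v \<in> borel_measurable borel" "s \<in> borel_measurable borel"
    and pos: "\<And>x. 0 < v x" "\<And>x. 0 < s x"
    and dual: "\<And>x. v x * s x powr (p - 1) = 1"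
    and ap: "\<And>t h. 0 < h \<Longrightarrow> mass v (t - h) t * ennpow (mass s t (t + h)) (p - 1) \<le> ennreal (K * h powr p)"
begin

abbreviation V :: "real \<Rightarrow> real \<Rightarrow> ennreal" where "V \<equiv> mass (\<lambda>x. ennreal (v x))"
abbreviation S :: "real \<Rightarrow> real \<Rightarrow> ennreal" where "S \<equiv> mass (\<lambda>x. ennreal (s x))"

lemma V_pos: "a < b \<Longrightarrow> 0 < V a b" and S_pos: "a < b \<Longrightarrow> 0 < S a b"
  using pos by (auto intro!: mass_pos)

text \<open>The preceding interval of the same length has positive \<open>v\<close>-mass, so an
  infinite dual mass would violate \<open>ap\<close>.\<close>

lemma S_finite: "S a b < \<infinity>"
proof (cases "a < b")
  case True
  show ?thesis
  proof (rule ccontr)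
    assume "\<not> S a b < \<infinity>"
    then have "S a b = top" by (simp add: less_top[symmetric])
    with ap[of "b - a" a] True V_pos[of "a - (b - a)" a]
    show False by (auto simp: ennreal_mult_top top_unique split: if_splits)
  qed
qed simp

text \<open>Intervals of unequal length on the two sides of t are enlarged to the common length
  h.\<close>

lemma ap_split:
  assumes "t - a \<le> h" "b - t \<le> h" "0 < h"
  shows "V a t * ennpow (S t b) (p - 1) \<le> ennreal (K * h powr p)"
proof -
  have "V a t * ennpow (S t b) (p - 1) \<le> V (t - h) t * ennpow (S t (t + h)) (p - 1)"
    using assms p by (intro mult_mono ennpow_mono mass_mono) auto
  also have "\<dots> \<le> ennreal (K * h powr p)" by (rule ap) fact
  finally show ?thesis .
qed

text \<open>Since S x \<beta> decreases in x, the superlevel set lies to the left of its supremum b,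
  where continuity still gives S b \<beta> \<ge> c. The A_p condition at b then bounds V(t, b)
  c^(p-1).\<close>

lemma V_superlevel:
  assumes ty: "t < y" "y < \<beta>" and H: "\<beta> - t \<le> H" and c: "0 < c"
  shows "(\<integral>\<^sup>+ x. ennreal (v x) * indicator {x\<in>{t<..<y}. ennreal c < S x \<beta>} x \<partial>lborel)
    \<le> ennreal (K * H powr p * c powr (1 - p))"
proof (cases "{x\<in>{t<..<y}. ennreal c < S x \<beta>} = {}")
  case False
  let ?X = "{x\<in>{t<..<y}. ennreal c < S x \<beta>}"
  define b where "b = Sup ?X"
  have bdd: "bdd_above ?X" by (rule bdd_aboveI[of _ y]) auto
  have Xb: "x \<le> b" if "x \<in> ?X" for x unfolding b_def by (rule cSup_upper[OF that bdd])
  define F where "F x = enn2real (S t x)" for x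
  have F: "ennreal (F x) = S t x" for x using S_finite[of t x] by (simp add: F_def less_top)
  have F0: "0 \<le> F x" for x by (simp add: F_def)
  have SF: "S x \<beta> = ennreal (F \<beta> - F x)" if "x \<in> {t..y}" for x
  proof -
    have "S t \<beta> = S t x + S x \<beta>" using that ty by (intro mass_add) auto
    then have "ennreal (F \<beta>) = ennreal (F x) + ennreal (enn2real (S x \<beta>))"
      using S_finite[of x \<beta>] by (simp add: F less_top)
    then have "F \<beta> = F x + enn2real (S x \<beta>)"
      using F0 by (simp add: ennreal_plus[symmetric] del: ennreal_plus)
    then show ?thesis using S_finite[of x \<beta>] by (simp add: less_top)
  qed
  have "closed {x\<in>{t..y}. F x \<le> F \<beta> - c}"
    unfolding F_def using S_finite[of t y]
    by (intro continuous_on_closed_Collect_le continuous_on_mass continuous_intros) auto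
  moreover have sub: "?X \<subseteq> {x\<in>{t..y}. F x \<le> F \<beta> - c}"
    using SF c by (auto simp: ennreal_less_iff)
  ultimately have "b \<in> {x\<in>{t..y}. F x \<le> F \<beta> - c}"
    unfolding b_def using closure_contains_Sup[OF False bdd] closure_minimal[of ?X] by blast
  then have b: "t \<le> b" "b \<le> y" "ennreal c \<le> S b \<beta>" using SF c by (auto intro!: ennreal_leI)
  have "(\<integral>\<^sup>+ x. ennreal (v x) * indicator ?X x \<partial>lborel) \<le> V t b"
    unfolding mass_closed[of _ t b] using Xb by (intro nn_integral_mono) (auto simp: indicator_def)
  also have "\<dots> = ennreal (c powr (1 - p)) * (V t b * ennpow (ennreal c) (p - 1))"
  proof -
    have "ennreal (c powr (1 - p)) * ennpow (ennreal c) (p - 1) = 1"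
      using c by (simp add: ennpow_ennreal ennreal_mult[symmetric] powr_add[symmetric])
    then show ?thesis by (metis (no_types, lifting) mult.assoc mult.commute mult_1)
  qed
  also have "\<dots> \<le> ennreal (c powr (1 - p)) * (V t b * ennpow (S b \<beta>) (p - 1))"
    using b p by (intro mult_left_mono ennpow_mono) auto
  also have "\<dots> \<le> ennreal (c powr (1 - p)) * ennreal (K * H powr p)"
    using b ty H by (intro mult_left_mono ap_split) auto
  finally show ?thesis using K by (simp add: ennreal_mult[symmetric] ac_simps)
next
  case True
  show ?thesis unfolding True by simp
qed

section \<open>A lower bound from the second use of the A_p condition\<close>

definition C1 :: real where "C1 = 2 powr (p * (p - 1)) * geo_const ((p - 1) * (p - 1))"

lemma C1_pos: "0 < C1"
  using p by (simp add: C1_def geo_const_pos)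

lemma measurable_S_left [measurable]: "(\<lambda>x. S x b) \<in> borel_measurable borel"
proof -
  have "S x b = (\<integral>\<^sup>+ z. ennreal (s z) * indicator {w. fst w < snd w \<and> snd w < b} (x, z) \<partial>lborel)" for x
    unfolding mass_def by (intro nn_integral_cong) (auto simp: indicator_def)
  moreover have [measurable]: "{w :: real \<times> real. fst w < snd w \<and> snd w < b} \<in> sets (borel \<Otimes>\<^sub>M borel)"
    unfolding borel_prod by (intro borel_open open_Collect_conj open_Collect_less continuous_intros)
  ultimately show ?thesis by simp
qed

text \<open>Layer cake over the dyadic levels of S x \<beta>. The factor 2^(j p (p-1)) of a level
  meets 2^(j (1-p)) from \<open>V_superlevel\<close>; the remaining 2^(j (p-1)^2) is summable
  downwards from the level of S t \<beta>.\<close>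

lemma V_integral_S_power:
  assumes ty: "t < y" "y < \<beta>" and H: "\<beta> - t \<le> H"
  shows "(\<integral>\<^sup>+ x\<in>{t<..<y}. (ennreal (v x) * ennpow (S x \<beta>) (p * (p - 1))) \<partial>lborel)
    \<le> ennreal (C1 * K * H powr p) * ennpow (S t \<beta>) ((p - 1) * (p - 1))"
proof -
  let ?q = "p * (p - 1)" and ?k = "(p - 1) * (p - 1)"
  let ?X = "\<lambda>j::int. {x\<in>{t<..<y}. ennreal (2 powr j) < S x \<beta>}"
  have q: "0 < ?q" "0 < ?k" using p by auto
  have "(\<integral>\<^sup>+ x\<in>{t<..<y}. (ennreal (v x) * ennpow (S x \<beta>) ?q) \<partial>lborel)
    \<le> (\<integral>\<^sup>+ x\<in>{t<..<y}. (ennreal (v x) * (\<integral>\<^sup>+ (j::int). ennreal (2 powr ((j + 1) * ?q)) *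
         indicator {j::int. ennreal (2 powr j) < S x \<beta>} j \<partial>count_space UNIV)) \<partial>lborel)"
    by (intro nn_integral_mono mult_right_mono mult_left_mono ennpow_le_dyadic_sum q) auto
  also have "\<dots> = (\<integral>\<^sup>+ x. (\<integral>\<^sup>+ (j::int). ennreal (2 powr ((j + 1) * ?q)) *
         (ennreal (v x) * indicator (?X j) x) \<partial>count_space UNIV) \<partial>lborel)"
    by (intro nn_integral_cong, subst nn_integral_cmult[symmetric], simp, subst nn_integral_multc[symmetric])
      (auto intro!: nn_integral_cong simp: indicator_def ac_simps)
  also have "\<dots> = (\<integral>\<^sup>+ (j::int). (\<integral>\<^sup>+ x. ennreal (2 powr ((j + 1) * ?q)) *
         (ennreal (v x) * indicator (?X j) x) \<partial>lborel) \<partial>count_space UNIV)"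
    by (rule nn_integral_count_space_nn_integral) measurable
  also have "\<dots> \<le> (\<integral>\<^sup>+ (j::int). ennreal (2 powr ?q * K * H powr p) * (ennreal (2 powr (j * ?k)) *
     indicator {j::int. ennreal (2 powr j) < S t \<beta>} j) \<partial>count_space UNIV)"
  proof (rule nn_integral_mono)
    fix j :: int
    show "(\<integral>\<^sup>+ x. ennreal (2 powr ((j + 1) * ?q)) * (ennreal (v x) * indicator (?X j) x) \<partial>lborel)
      \<le> ennreal (2 powr ?q * K * H powr p) * (ennreal (2 powr (j * ?k)) * indicator {j::int. ennreal (2 powr j) < S t \<beta>} j)"
    proof (cases "ennreal (2 powr j) < S t \<beta>")
      case True
      have "(\<integral>\<^sup>+ x. ennreal (2 powr ((j + 1) * ?q)) * (ennreal (v x) * indicator (?X j) x) \<partial>lborel)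
        = ennreal (2 powr ((j + 1) * ?q)) * (\<integral>\<^sup>+ x. ennreal (v x) * indicator (?X j) x \<partial>lborel)"
        by (rule nn_integral_cmult) measurable
      also have "\<dots> \<le> ennreal (2 powr ((j + 1) * ?q)) * ennreal (K * H powr p * (2 powr j) powr (1 - p))"
        by (intro mult_left_mono V_superlevel ty H) auto
      also have "\<dots> = ennreal ((2 powr ((j + 1) * ?q) * 2 powr (j * (1 - p))) * (K * H powr p))"
        using K by (simp add: ennreal_mult[symmetric] powr_powr ac_simps)
      also have "2 powr ((j + 1) * ?q) * 2 powr (j * (1 - p)) = 2 powr ?q * 2 powr (j * ?k)"
        by (simp add: powr_add[symmetric] algebra_simps)
      finally show ?thesis using K True by (simp add: ennreal_mult[symmetric] ac_simps)
    next
      case False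
      have "\<not> ennreal (2 powr j) < S x \<beta>" if "t < x" for x
        using False mass_mono[of t x \<beta> \<beta> "\<lambda>x. ennreal (s x)"] that by (meson less_imp_le less_le_trans order_refl)
      then have X: "?X j = {}" by auto
      show ?thesis unfolding X by simp
    qed
  qed
  also have "\<dots> \<le> ennreal (2 powr ?q * K * H powr p) * (ennreal (geo_const ?k) * ennpow (S t \<beta>) ?k)"
    using dyadic_sum_below[OF q(2)] by (subst nn_integral_cmult) (auto intro!: mult_left_mono)
  also have "\<dots> = ennreal (C1 * K * H powr p) * ennpow (S t \<beta>) ?k"
    using K geo_const_pos[OF q(2)] by (simp add: C1_def ennreal_mult ac_simps)
  finally show ?thesis .
qed

text \<open>This is 2/\<rho> times the coefficient of H \<tau>^(p-1) in the \<theta> of the next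
  estimate, where \<rho> H bounds the length of \<open>F\<close> from below. The factor K^(1/(p-1))
  of the final bound originates here.\<close>

definition C2 :: "real \<Rightarrow> real" where
  "C2 \<rho> = 2 / \<rho> * (2 * C1 * K / \<rho>) powr (1 / (p - 1))"

lemma C2_nonneg: "0 < \<rho> \<Longrightarrow> 0 \<le> C2 \<rho>"
  by (simp add: C2_def)

text \<open>Put \<open>\<tau>(x) = S x \<beta>\<close>, \<open>A = s \<tau>\<^bsup>-p\<^esup>\<close> and \<open>B = v \<tau>\<^bsup>p(p-1)\<^esup>\<close>. The exponent in \<open>B\<close> is chosen so
  that \<open>B A\<^bsup>p-1\<^esup> = 1\<close>; integrating \<open>1 \<le> \<theta> A + \<theta>\<^bsup>-(p-1)\<^esup> B\<close> over \<open>F\<close> with the optimal \<open>\<theta>\<close> plays the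
  role of Hoelder's inequality.\<close>

lemma S_power_lower_bound:
  assumes ty: "t < y" "y < \<beta>" and H: "\<beta> - t \<le> H" and [measurable]: "F \<in> sets borel" and F: "F \<subseteq> {t<..<y}"
    and \<rho>: "0 < \<rho>" "ennreal (\<rho> * H) \<le> emeasure lborel F"
  shows "1 \<le> ennreal (C2 \<rho>) * ennpow (S t \<beta>) (p - 1) *
    (\<integral>\<^sup>+ x\<in>F. ennreal (s x * enn2real (S x \<beta>) powr (- p)) \<partial>lborel)"
proof -
  let ?k = "(p - 1) * (p - 1)"
  let ?A = "\<lambda>x. s x * enn2real (S x \<beta>) powr (- p)"
  let ?B = "\<lambda>x. v x * enn2real (S x \<beta>) powr (p * (p - 1))"
  define \<tau> where "\<tau> = enn2real (S t \<beta>)"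
  have H0: "0 < H" using ty H by linarith
  have Sr: "S x \<beta> = ennreal (enn2real (S x \<beta>))" for x using S_finite[of x \<beta>] by (simp add: less_top)
  have Sp: "0 < enn2real (S x \<beta>)" if "x < \<beta>" for x
    using S_pos[OF that] S_finite[of x \<beta>] by (simp add: enn2real_positive_iff less_top)
  have \<tau>: "0 < \<tau>" unfolding \<tau>_def using Sp ty by auto
  \<comment> \<open>With this \<theta> the second term of the Young inequality integrates to at most
    \<rho>H/2, half of the lower bound for the length of \<open>F\<close>. The first term must
    account for the other half.\<close>
  define \<theta> where "\<theta> = (2 * C1 * K / \<rho>) powr (1 / (p - 1)) * H * \<tau> powr (p - 1)"
  have \<theta>: "0 < \<theta>" unfolding \<theta>_def using H0 \<tau> C1_pos K \<rho>(1) by simp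
  have th: "\<theta> powr (- (p - 1)) * (C1 * K * H powr p * \<tau> powr ?k) = \<rho> * H / 2"
  proof -
    have "\<theta> powr (- (p - 1)) = (2 * C1 * K / \<rho>) powr (- 1) * H powr (- (p - 1)) * \<tau> powr (- ?k)"
    proof -
      have e: "1 / (p - 1) * (- (p - 1)) = -1" "(p - 1) * (- (p - 1)) = - ?k" using p by (simp_all add: field_simps)
      show ?thesis unfolding \<theta>_def by (simp only: powr_mult powr_powr e)
    qed
    also have "\<dots> * (C1 * K * H powr p * \<tau> powr ?k) =
      (2 * C1 * K / \<rho>) powr (- 1) * (C1 * K) * (H powr (- (p - 1)) * H powr p) * (\<tau> powr (- ?k) * \<tau> powr ?k)"
      by (simp add: ac_simps)
    also have "H powr (- (p - 1)) * H powr p = H" using H0 by (simp add: powr_add[symmetric])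
    also have "\<tau> powr (- ?k) * \<tau> powr ?k = 1" using \<tau> by (simp add: powr_add[symmetric])
    also have "(2 * C1 * K / \<rho>) powr (- 1) * (C1 * K) = \<rho> / 2"
      using C1_pos K \<rho>(1) by (subst powr_minus, subst powr_one) (auto simp: field_simps)
    finally show ?thesis by simp
  qed
  have [measurable]: "(\<lambda>x. enn2real (S x \<beta>)) \<in> borel_measurable borel" by measurable
  have one: "1 \<le> ennreal \<theta> * ennreal (?A x) + ennreal (\<theta> powr (- (p - 1))) * (ennreal (v x) * ennpow (S x \<beta>) (p * (p - 1)))"
    if "x \<in> F" for x
  proof -
    have x: "x < \<beta>" using that F ty by auto
    have e: "ennpow (S x \<beta>) (p * (p - 1)) = ennreal (enn2real (S x \<beta>) powr (p * (p - 1)))"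
      by (subst Sr) (simp add: ennpow_ennreal)
    have "?B x * ?A x powr (p - 1) = (v x * s x powr (p - 1)) * (enn2real (S x \<beta>) powr (p * (p - 1)) * enn2real (S x \<beta>) powr (- p * (p - 1)))"
      by (simp add: powr_mult powr_powr)
    also have "\<dots> = 1" using Sp[OF x] by (simp add: dual powr_add[symmetric])
    finally have "1 \<le> \<theta> * ?A x + \<theta> powr (- (p - 1)) * ?B x"
      using Sp[OF x] pos[of x] \<theta> p by (intro young_unit) auto
    then show ?thesis
      unfolding e using \<theta> pos[of x] less_imp_le[OF pos(1)[of x]] less_imp_le[OF pos(2)[of x]]
      by (simp add: ennreal_mult[symmetric] ennreal_plus[symmetric] ennreal_1[symmetric] del: ennreal_plus ennreal_1)
  qed
  let ?I = "\<integral>\<^sup>+ x\<in>F. ennreal (?A x) \<partial>lborel"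
  have "ennreal (\<rho> * H) \<le> (\<integral>\<^sup>+ x. 1 * indicator F x \<partial>lborel)" using \<rho> by simp
  also have "\<dots> \<le> (\<integral>\<^sup>+ x. ennreal \<theta> * (ennreal (?A x) * indicator F x) +
    ennreal (\<theta> powr (- (p - 1))) * ((ennreal (v x) * ennpow (S x \<beta>) (p * (p - 1))) * indicator {t<..<y} x) \<partial>lborel)"
    using one F by (intro nn_integral_mono) (auto simp: indicator_def)
  also have "\<dots> = ennreal \<theta> * ?I + ennreal (\<theta> powr (- (p - 1))) *
     (\<integral>\<^sup>+ x\<in>{t<..<y}. (ennreal (v x) * ennpow (S x \<beta>) (p * (p - 1))) \<partial>lborel)"
    by (subst nn_integral_add) (auto simp: nn_integral_cmult)
  also have "\<dots> \<le> ennreal \<theta> * ?I + ennreal (\<theta> powr (- (p - 1))) *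
     (ennreal (C1 * K * H powr p) * ennpow (S t \<beta>) ?k)"
    by (intro add_left_mono mult_left_mono V_integral_S_power ty H) auto
  also have "ennpow (S t \<beta>) ?k = ennreal (\<tau> powr ?k)"
    by (subst Sr) (simp add: ennpow_ennreal \<tau>_def)
  also have "ennreal (\<theta> powr (- (p - 1))) * (ennreal (C1 * K * H powr p) * ennreal (\<tau> powr ?k)) = ennreal (\<rho> * H / 2)"
    unfolding th[symmetric] using C1_pos K by (simp add: ennreal_mult ac_simps)
  finally have le: "ennreal (\<rho> * H) \<le> ennreal \<theta> * ?I + ennreal (\<rho> * H / 2)" .
  have pS: "ennpow (S t \<beta>) (p - 1) = ennreal (\<tau> powr (p - 1))"
    by (subst Sr) (simp add: ennpow_ennreal \<tau>_def)
  show ?thesis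
  proof (cases ?I)
    case (real i)
    then have "\<rho> * H \<le> \<theta> * i + \<rho> * H / 2"
      using le \<theta> \<rho> H0 by (simp add: ennreal_mult[symmetric] ennreal_plus[symmetric] del: ennreal_plus)
    then have "\<rho> * H / 2 \<le> \<theta> * i" by linarith
    then have "1 \<le> 2 / \<rho> * (\<theta> / H) * i" using \<rho> H0 by (simp add: field_simps)
    also have "2 / \<rho> * (\<theta> / H) * i = C2 \<rho> * \<tau> powr (p - 1) * i"
      using H0 by (simp add: \<theta>_def C2_def)
    finally show ?thesis unfolding pS real(2)
      using C2_nonneg[OF \<rho>(1)] real(1) by (simp add: ennreal_mult[symmetric])
  next
    case top
    have "0 < C2 \<rho>" using C1_pos K \<rho> by (simp add: C2_def)
    then show ?thesis unfolding pS top using \<tau> by (simp add: ennreal_mult_top ennreal_mult[symmetric])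
  qed
qed

section \<open>Level set estimates for the one-sided maximal function\<close>

definition C3 :: real where
  "C3 = 2 powr p * K * C2 (1 / 4)"

lemma C3_nonneg: "0 \<le> C3"
  using C2_nonneg[of "1/4"] K by (simp add: C3_def)

text \<open>Write u = \<beta> - h, t = \<beta> - h/2 and y = \<beta> - h/4. The A_p condition at t
  bounds V(u, t) by a multiple of S(t, \<beta>)^(1-p), and \<open>S_power_lower_bound\<close> turns
  this into an integral over the part \<open>F\<close> of (t, y) outside the level set of
  16\<kappa>. The point z, from which averages of f are at most 2\<kappa>, prevents that level set
  from filling (t, y).\<close>

lemma level_interval_estimate:
  fixes f :: "real \<Rightarrow> ennreal"
  assumes [measurable]: "f \<in> borel_measurable borel" and fin: "mass f l r < \<infinity>"
    and h: "0 < h" "l \<le> \<beta> - h" "\<beta> \<le> r" and lam: "0 < \<kappa>"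
    and z: "\<beta> - h \<le> z" "z \<le> \<beta> - h / 2"
    and z_upper: "\<And>e. z \<le> e \<Longrightarrow> e \<le> r \<Longrightarrow> mass f z e \<le> ennreal (2 * \<kappa> * (e - z))"
    and left: "ennreal (\<kappa> * (h / 4)) \<le> mass f (\<beta> - h / 4) \<beta>"
    and right: "\<And>e. \<beta> \<le> e \<Longrightarrow> e \<le> r \<Longrightarrow> mass f \<beta> e \<le> ennreal (\<kappa> * (e - \<beta>))"
  shows "ennreal (\<kappa> powr p) * V (\<beta> - h) (\<beta> - h / 2) \<le> ennreal C3 *
    (\<integral>\<^sup>+ x\<in>{\<beta> - h / 2<..<\<beta> - h / 4} - rsun f (\<lambda>_. 1) l r (16 * \<kappa>).
       (ennpow (maxfn f (\<lambda>x. ennreal (s x)) l r x) p * ennreal (s x)) \<partial>lborel)"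
proof -
  define u t y where "u = \<beta> - h" and "t = \<beta> - h / 2" and "y = \<beta> - h / 4"
  have uty: "u < t" "t < y" "y < \<beta>" "l \<le> u" using h by (auto simp: u_def t_def y_def)
  let ?R = "rsun f (\<lambda>_. 1) l r (16 * \<kappa>)"
  let ?R' = "rsun f (\<lambda>_. 1) t \<beta> (16 * \<kappa>)"
  define F where "F = {t<..<y} - ?R"
  have fin1: "mass (\<lambda>_. 1) a b < \<infinity>" for a b :: real
    by (cases "a \<le> b") (auto simp: mass_one)
  have finf: "mass f a b < \<infinity>" if "l \<le> a" "b \<le> r" for a b
    using mass_mono[OF that, of f] fin by auto
  have [measurable]: "?R \<in> sets borel"
    using rsun_open[OF _ _ fin fin1] lam by auto
  have [measurable]: "?R' \<in> sets borel"
    using rsun_open[OF _ _ finf fin1] lam uty h by auto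
  have [measurable]: "F \<in> sets borel" unfolding F_def by measurable
  \<comment> \<open>An interval leaving the component can be cut at \<open>\<beta>\<close>, since averages of \<open>f\<close> starting at \<open>\<beta>\<close> do not exceed \<open>\<kappa>\<close>.\<close>
  have sub: "{t<..<y} \<inter> ?R \<subseteq> ?R'"
  proof
    fix x assume "x \<in> {t<..<y} \<inter> ?R"
    then obtain e where x: "t < x" "x < y" and e: "x < e" "e \<le> r" "ennreal (16 * \<kappa>) * mass (\<lambda>_. 1) x e < mass f x e"
      unfolding rsun_def by auto
    show "x \<in> ?R'"
    proof (cases "e \<le> \<beta>")
      case True
      then show ?thesis using x e uty unfolding rsun_def by auto
    next
      case False
      have "mass f x e = mass f x \<beta> + mass f \<beta> e"
        using False x uty by (intro mass_add) auto
      also have "\<dots> \<le> mass f x \<beta> + ennreal (\<kappa> * (e - \<beta>))"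
        using right[of e] False e by (intro add_left_mono) auto
      finally have "ennreal (16 * \<kappa>) * mass (\<lambda>_. 1) x e < mass f x \<beta> + ennreal (\<kappa> * (e - \<beta>))"
        using e(3) by order
      then have "ennreal (16 * \<kappa> * (e - x)) < mass f x \<beta> + ennreal (\<kappa> * (e - \<beta>))"
        using e lam by (simp add: mass_one ennreal_mult[symmetric])
      moreover obtain m where m: "mass f x \<beta> = ennreal m" "0 \<le> m"
        using finf[of x \<beta>] x uty h by (cases "mass f x \<beta>") auto
      ultimately have "16 * \<kappa> * (e - x) < m + \<kappa> * (e - \<beta>)"
        using lam False e by (simp add: ennreal_plus[symmetric] ennreal_less_iff del: ennreal_plus)
      moreover have "\<kappa> * (e - \<beta>) \<le> 16 * \<kappa> * (e - \<beta>)" using lam False by simp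
      ultimately have "16 * \<kappa> * (\<beta> - x) < m" by (simp add: algebra_simps)
      then have "ennreal (16 * \<kappa>) * mass (\<lambda>_. 1) x \<beta> < mass f x \<beta>"
        using x uty lam m by (simp add: mass_one ennreal_mult[symmetric] ennreal_less_iff)
      then show ?thesis using x uty unfolding rsun_def by auto
    qed
  qed
  \<comment> \<open>The integral of f over (t, \<beta>) is at most that over (z, \<beta>), hence at
    most 2\<kappa>h. Weak type at level 16\<kappa> leaves h/8, half the length of (t, y).\<close>
  have R': "emeasure lborel ?R' \<le> ennreal (h / 8)"
  proof -
    have "ennreal (16 * \<kappa>) * emeasure lborel ?R' \<le> (\<integral>\<^sup>+ x\<in>?R'. f x \<partial>lborel)"
      using rsun_weak_type[of f "\<lambda>_. 1" t \<beta> "16 * \<kappa>"] finf[of t \<beta>] fin1 lam uty h by simp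
    also have "\<dots> \<le> mass f z \<beta>"
      unfolding mass_def using rsun_subset[of f "\<lambda>_. 1" t \<beta> "16 * \<kappa>"] z
      by (intro nn_integral_mono mult_left_mono) (auto simp: indicator_def t_def)
    also have "\<dots> \<le> ennreal (2 * \<kappa> * (\<beta> - z))" using z h by (intro z_upper) auto
    also have "\<dots> \<le> ennreal (2 * \<kappa> * h)" using z lam by (intro ennreal_leI) auto
    finally have "ennreal (1 / (16 * \<kappa>)) * (ennreal (16 * \<kappa>) * emeasure lborel ?R') \<le> ennreal (1 / (16 * \<kappa>)) * ennreal (2 * \<kappa> * h)"
      by (intro mult_left_mono) auto
    then show ?thesis
      using lam h by (simp add: mult.assoc[symmetric] ennreal_mult[symmetric])
  qed
  have Fm: "ennreal (1 / 4 * (h / 2)) \<le> emeasure lborel F"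
  proof -
    have "ennreal (h / 4) = emeasure lborel {t<..<y}" using h by (simp add: t_def y_def)
    also have "\<dots> \<le> emeasure lborel (F \<union> ?R')"
      using sub by (intro emeasure_mono) (auto simp: F_def)
    also have "\<dots> \<le> emeasure lborel F + emeasure lborel ?R'"
      by (rule emeasure_subadditive) auto
    also have "\<dots> \<le> emeasure lborel F + ennreal (h / 8)"
      using R' by (intro add_left_mono)
    finally have le: "ennreal (h / 4) \<le> emeasure lborel F + ennreal (h / 8)" .
    show ?thesis
      by (cases "emeasure lborel F") (use le h in \<open>auto simp: ennreal_plus[symmetric] simp del: ennreal_plus\<close>)
  qed
  obtain m where m: "mass f y \<beta> = ennreal m" "0 \<le> m"
    using finf[of y \<beta>] uty h by (cases "mass f y \<beta>") auto
  \<comment> \<open>The factor \<kappa>^p is traded for a power of m, the integral of f over (y,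
    \<beta>), which the maximal function relative to \<open>s\<close> can recover on
    \<open>F\<close>.\<close>
  have lm: "\<kappa> \<le> 4 * m / h"
    using left h lam m unfolding y_def by (simp add: field_simps)
  let ?A = "\<lambda>x. s x * enn2real (S x \<beta>) powr (- p)"
  have [measurable]: "(\<lambda>x. enn2real (S x \<beta>)) \<in> borel_measurable borel" by measurable
  \<comment> \<open>The proportion 1/4 is taken relative to H = h/2, the distance from t to
    \<beta>.\<close>
  have one: "1 \<le> ennreal (C2 (1/4)) * ennpow (S t \<beta>) (p - 1) * (\<integral>\<^sup>+ x\<in>F. ennreal (?A x) \<partial>lborel)"
    using uty Fm by (intro S_power_lower_bound[where H="h/2" and y=y]) (auto simp: F_def t_def)
  have "ennreal (\<kappa> powr p) * V u t \<le> ennreal (\<kappa> powr p) * V u t * (ennreal (C2 (1/4)) * ennpow (S t \<beta>) (p - 1) * (\<integral>\<^sup>+ x\<in>F. ennreal (?A x) \<partial>lborel))"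
    using mult_left_mono[OF one, of "ennreal (\<kappa> powr p) * V u t"] by simp
  also have "\<dots> = ennreal (\<kappa> powr p) * ennreal (C2 (1/4)) * (V u t * ennpow (S t \<beta>) (p - 1)) * (\<integral>\<^sup>+ x\<in>F. ennreal (?A x) \<partial>lborel)"
    by (simp add: ac_simps)
  also have "\<dots> \<le> ennreal (\<kappa> powr p) * ennreal (C2 (1/4)) * ennreal (K * (h / 2) powr p) * (\<integral>\<^sup>+ x\<in>F. ennreal (?A x) \<partial>lborel)"
    using h by (intro mult_right_mono mult_left_mono ap_split) (auto simp: u_def t_def)
  also have "\<dots> \<le> ennreal ((4 * m / h) powr p) * ennreal (C2 (1/4)) * ennreal (K * (h / 2) powr p) * (\<integral>\<^sup>+ x\<in>F. ennreal (?A x) \<partial>lborel)"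
    using lm lam p by (intro mult_right_mono ennreal_leI powr_mono2) auto
  also have "\<dots> = ennreal C3 * (ennreal (m powr p) * (\<integral>\<^sup>+ x\<in>F. ennreal (?A x) \<partial>lborel))"
  proof -
    have "(4 * m / h) powr p * (h / 2) powr p = 2 powr p * m powr p"
      using h by (simp add: powr_mult[symmetric])
    then have "(4 * m / h) powr p * C2 (1/4) * (K * (h / 2) powr p) = C3 * m powr p"
      unfolding C3_def by (simp add: algebra_simps)
    then have "ennreal ((4 * m / h) powr p) * ennreal (C2 (1/4)) * ennreal (K * (h / 2) powr p) = ennreal C3 * ennreal (m powr p)"
      using K C2_nonneg[of "1/4"] C3_nonneg by (simp add: ennreal_mult[symmetric])
    then show ?thesis by (simp add: mult.assoc)
  qed
  also have "ennreal (m powr p) * (\<integral>\<^sup>+ x\<in>F. ennreal (?A x) \<partial>lborel) = (\<integral>\<^sup>+ x\<in>F. (ennreal (m powr p) * ennreal (?A x)) \<partial>lborel)"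
    by (simp add: nn_integral_cmult mult.assoc)
  also have "ennreal C3 * \<dots> \<le> ennreal C3 * (\<integral>\<^sup>+ x\<in>F. (ennpow (maxfn f (\<lambda>x. ennreal (s x)) l r x) p * ennreal (s x)) \<partial>lborel)"
  proof (intro mult_left_mono nn_integral_mono)
    fix x
    show "ennreal (m powr p) * ennreal (?A x) * indicator F x \<le>
      ennpow (maxfn f (\<lambda>x. ennreal (s x)) l r x) p * ennreal (s x) * indicator F x"
    proof (cases "x \<in> F")
      case True
      then have x: "t < x" "x < y" by (auto simp: F_def)
      \<comment> \<open>Points of \<open>F\<close> lie to the left of y, so the interval (x,
        \<beta>) captures all of m and the maximal function relative to \<open>s\<close> is at least
        m/\<tau>.\<close>
      define \<tau> where "\<tau> = enn2real (S x \<beta>)"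
      have Sx: "S x \<beta> = ennreal \<tau>" using S_finite[of x \<beta>] by (simp add: \<tau>_def less_top)
      have \<tau>: "0 < \<tau>" using S_pos[of x \<beta>] Sx x uty by simp
      have "ennreal (m / \<tau>) = mass f y \<beta> / S x \<beta>" using m \<tau> Sx by (simp add: divide_ennreal)
      also have "\<dots> \<le> mass f x \<beta> / S x \<beta>" using x by (intro divide_right_mono_ennreal mass_mono) auto
      also have "\<dots> \<le> maxfn f (\<lambda>x. ennreal (s x)) l r x"
        unfolding maxfn_def using x uty h by (auto intro!: SUP_upper)
      finally have "ennpow (ennreal (m / \<tau>)) p \<le> ennpow (maxfn f (\<lambda>x. ennreal (s x)) l r x) p"
        using p by (intro ennpow_mono) auto
      moreover have "ennreal (m powr p) * ennreal (?A x) = ennpow (ennreal (m / \<tau>)) p * ennreal (s x)"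
        using m \<tau> less_imp_le[OF pos(2)[of x]]
        by (simp add: ennpow_ennreal ennreal_mult[symmetric] \<tau>_def[symmetric] powr_divide powr_minus field_simps)
      ultimately show ?thesis using True by (simp add: mult_right_mono)
    qed simp
  qed auto
  finally show ?thesis unfolding F_def u_def t_def y_def .
qed

text \<open>The component is cut at points \<open>x k\<close> that approach its right end
  geometrically. The piece \<open>E k\<close> is charged to \<open>F k\<close> in the next dyadic
  interval; these sets are disjoint, so the estimates add up. Any point of a nonempty
  \<open>E k\<close> serves as the z of \<open>level_interval_estimate\<close>.\<close>

lemma level_component_estimate:
  fixes f :: "real \<Rightarrow> ennreal"
  assumes [measurable]: "f \<in> borel_measurable borel" and fin: "mass f l r < \<infinity>"
    and ab: "l \<le> \<alpha>" "\<alpha> < \<beta>" "\<beta> \<le> r" and lam: "0 < \<kappa>"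
    and comp: "{\<alpha><..<\<beta>} \<subseteq> rsun f (\<lambda>_. 1) l r \<kappa>" "\<beta> \<notin> rsun f (\<lambda>_. 1) l r \<kappa>"
  shows "ennreal (\<kappa> powr p) * (\<integral>\<^sup>+ x\<in>{\<alpha><..<\<beta>} - rsun f (\<lambda>_. 1) l r (2 * \<kappa>). v x \<partial>lborel) \<le> ennreal C3 *
    (\<integral>\<^sup>+ x\<in>{\<alpha><..<\<beta>} - rsun f (\<lambda>_. 1) l r (16 * \<kappa>).
       (ennpow (maxfn f (\<lambda>x. ennreal (s x)) l r x) p * ennreal (s x)) \<partial>lborel)"
proof -
  let ?R2 = "rsun f (\<lambda>_. 1) l r (2 * \<kappa>)" and ?R16 = "rsun f (\<lambda>_. 1) l r (16 * \<kappa>)"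
  let ?N = "\<lambda>x. ennpow (maxfn f (\<lambda>x. ennreal (s x)) l r x) p * ennreal (s x)"
  have fin1: "mass (\<lambda>_. 1) l r < \<infinity>" by (cases "l \<le> r") (auto simp: mass_one)
  note facts = rsun_facts[OF _ _ fin fin1]
  have [measurable]: "?R2 \<in> sets borel" "?R16 \<in> sets borel"
    using facts(1)[of "2 * \<kappa>"] facts(1)[of "16 * \<kappa>"] lam by auto
  have [measurable]: "maxfn f (\<lambda>x. ennreal (s x)) l r \<in> borel_measurable borel"
    using pos by (intro measurable_maxfn fin S_finite) auto
  define x where "x k = \<beta> - (\<beta> - \<alpha>) / 2 ^ k" for k :: nat
  define E where "E k = {x k<..x (Suc k)} - ?R2" for k
  define F where "F k = {x (Suc k)<..<x (Suc (Suc k))} - ?R16" for k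
  have [measurable]: "E k \<in> sets borel" "F k \<in> sets borel" for k unfolding E_def F_def by measurable
  have xmono: "x k < x (Suc k)" "x k < \<beta>" "\<alpha> \<le> x k" for k
  proof -
    have "(\<beta> - \<alpha>) / 2 ^ k \<le> (\<beta> - \<alpha>) / 1" using ab by (intro divide_left_mono) auto
    then show "\<alpha> \<le> x k" by (simp add: x_def)
  qed (use ab in \<open>auto simp: x_def field_simps\<close>)
  have minc: "incseq x" using xmono(1) by (intro incseq_SucI) (simp add: less_imp_le)
  have cover: "{\<alpha><..<\<beta>} \<subseteq> (\<Union>k. {x k<..x (Suc k)})"
  proof
    fix z assume z: "z \<in> {\<alpha><..<\<beta>}"
    have "\<exists>n. (\<beta> - \<alpha>) / (\<beta> - z) < 2 ^ n" using real_arch_pow[of 2] by auto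
    then obtain n where n: "(\<beta> - \<alpha>) / (\<beta> - z) < 2 ^ n" by blast
    then have "z \<le> x n" using z by (simp add: x_def field_simps)
    define k where "k = (LEAST k. z \<le> x k)"
    have k: "z \<le> x k" unfolding k_def by (rule LeastI[of _ n]) fact
    \<comment> \<open>The first cut point is \<alpha> itself, which lies strictly to the left of
      z.\<close>
    have "k \<noteq> 0" using k z by (cases k) (auto simp: x_def)
    then obtain j where j: "k = Suc j" by (cases k) auto
    have "\<not> z \<le> x j" using not_less_Least[of j "\<lambda>k. z \<le> x k"] j unfolding k_def by simp
    then show "z \<in> (\<Union>k. {x k<..x (Suc k)})" using k j by (auto simp: not_le intro!: exI[of _ j])
  qed
  have piece: "ennreal (\<kappa> powr p) * (\<integral>\<^sup>+ x\<in>E k. v x \<partial>lborel) \<le> ennreal C3 * (\<integral>\<^sup>+ x\<in>F k. ?N x \<partial>lborel)" for k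
  proof (cases "E k = {}")
    case False
    then obtain z where "z \<in> E k" by blast
    then have z: "x k < z" "z \<le> x (Suc k)" "z \<notin> ?R2" by (auto simp: E_def)
    define h where "h = (\<beta> - \<alpha>) / 2 ^ k"
    have h: "0 < h" "x k = \<beta> - h" "x (Suc k) = \<beta> - h / 2" "x (Suc (Suc k)) = \<beta> - h / 4"
      using ab by (auto simp: h_def x_def)
    have "(\<integral>\<^sup>+ x\<in>E k. v x \<partial>lborel) \<le> V (\<beta> - h) (\<beta> - h / 2)"
      unfolding mass_closed E_def h(2,3)[symmetric] by (intro nn_integral_mono mult_left_mono) (auto simp: indicator_def)
    then have "ennreal (\<kappa> powr p) * (\<integral>\<^sup>+ x\<in>E k. v x \<partial>lborel) \<le> ennreal (\<kappa> powr p) * V (\<beta> - h) (\<beta> - h / 2)"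
      by (intro mult_left_mono) auto
    also have "\<dots> \<le> ennreal C3 *
      (\<integral>\<^sup>+ x\<in>{\<beta> - h / 2<..<\<beta> - h / 4} - ?R16. ?N x \<partial>lborel)"
    proof (rule level_interval_estimate[where z=z])
      show "f \<in> borel_measurable borel" "mass f l r < \<infinity>" by fact+
      show "l \<le> \<beta> - h" using xmono(3)[of k] ab h by linarith
      show "\<beta> - h \<le> z" "z \<le> \<beta> - h / 2" using z h by auto
      show "mass f z e \<le> ennreal (2 * \<kappa> * (e - z))" if "z \<le> e" "e \<le> r" for e
      proof (cases "z = e")
        case False
        have "l < z" "z < r" using z xmono[of k] xmono[of "Suc k"] ab by linarith+
        then have "\<not> ennreal (2 * \<kappa>) * mass (\<lambda>_. 1) z e < mass f z e"
          using z(3) False that unfolding rsun_def by auto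
        then show ?thesis using that lam by (simp add: not_less mass_one ennreal_mult[symmetric])
      qed simp
      show "ennreal (\<kappa> * (h / 4)) \<le> mass f (\<beta> - h / 4) \<beta>"
        using facts(2)[of \<kappa> \<alpha> \<beta> "\<beta> - h / 4"] ab comp lam h xmono(3)[of "Suc (Suc k)"]
        by (simp add: mass_one ennreal_mult[symmetric])
      show "mass f \<beta> e \<le> ennreal (\<kappa> * (e - \<beta>))" if "\<beta> \<le> e" "e \<le> r" for e
        using facts(3)[of \<kappa> \<alpha> \<beta> e] ab comp lam that by (simp add: mass_one ennreal_mult[symmetric])
    qed (use h lam ab in auto)
    finally show ?thesis unfolding F_def h(3,4) .
  qed simp
  let ?\<mu> = "density lborel (\<lambda>x. ennreal (v x))" and ?\<nu> = "density lborel ?N"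
  have mu: "emeasure ?\<mu> A = (\<integral>\<^sup>+ x\<in>A. v x \<partial>lborel)" "emeasure ?\<nu> A = (\<integral>\<^sup>+ x\<in>A. ?N x \<partial>lborel)" if "A \<in> sets borel" for A
    using that by (simp_all add: emeasure_density)
  have "(\<integral>\<^sup>+ x\<in>{\<alpha><..<\<beta>} - ?R2. v x \<partial>lborel) \<le> emeasure ?\<mu> (\<Union>k. E k)"
    using cover by (subst mu(1)[symmetric]) (auto intro!: emeasure_mono simp: E_def)
  also have "\<dots> \<le> (\<Sum>k. emeasure ?\<mu> (E k))"
    by (rule emeasure_subadditive_countably) auto
  finally have "ennreal (\<kappa> powr p) * (\<integral>\<^sup>+ x\<in>{\<alpha><..<\<beta>} - ?R2. v x \<partial>lborel) \<le> ennreal (\<kappa> powr p) * (\<Sum>k. emeasure ?\<mu> (E k))"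
    by (intro mult_left_mono) auto
  also have "\<dots> = (\<Sum>k. ennreal (\<kappa> powr p) * emeasure ?\<mu> (E k))" by simp
  also have "\<dots> \<le> (\<Sum>k. ennreal C3 * emeasure ?\<nu> (F k))"
    using piece by (intro suminf_le summableI) (auto simp: mu)
  also have "\<dots> = ennreal C3 * (\<Sum>k. emeasure ?\<nu> (F k))" by simp
  also have "(\<Sum>k. emeasure ?\<nu> (F k)) = emeasure ?\<nu> (\<Union>k. F k)"
  proof (rule suminf_emeasure)
    show "disjoint_family F"
      unfolding disjoint_family_on_def
    proof (intro ballI impI)
      fix i j :: nat assume "i \<noteq> j"
      then consider "Suc i \<le> j" | "Suc j \<le> i" by linarith
      then show "F i \<inter> F j = {}"
      proof cases
        case 1 then show ?thesis using incseqD[OF minc, of "Suc (Suc i)" "Suc j"] by (auto simp: F_def)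
      next
        case 2 then show ?thesis using incseqD[OF minc, of "Suc (Suc j)" "Suc i"] by (auto simp: F_def)
      qed
    qed
  qed auto
  also have "\<dots> \<le> emeasure ?\<nu> ({\<alpha><..<\<beta>} - ?R16)"
    by (intro emeasure_mono) (auto simp: F_def intro: le_less_trans[OF xmono(3)] less_trans[OF _ xmono(2)])
  finally show ?thesis by (simp add: mu mult_left_mono)
qed

text \<open>The removed level sets are absorbed into two densities. Both sides then become measures
  of the same open set and can be compared on its components.\<close>

lemma level_estimate:
  fixes f :: "real \<Rightarrow> ennreal"
  assumes [measurable]: "f \<in> borel_measurable borel" and fin: "mass f l r < \<infinity>" and kap: "0 < \<kappa>"
  shows "ennreal (\<kappa> powr p) * (\<integral>\<^sup>+ x\<in>rsun f (\<lambda>_. 1) l r \<kappa> - rsun f (\<lambda>_. 1) l r (2 * \<kappa>). v x \<partial>lborel) \<le> ennreal C3 *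
    (\<integral>\<^sup>+ x\<in>rsun f (\<lambda>_. 1) l r \<kappa> - rsun f (\<lambda>_. 1) l r (16 * \<kappa>).
       (ennpow (maxfn f (\<lambda>x. ennreal (s x)) l r x) p * ennreal (s x)) \<partial>lborel)"
proof -
  let ?R1 = "rsun f (\<lambda>_. 1) l r \<kappa>" and ?R2 = "rsun f (\<lambda>_. 1) l r (2 * \<kappa>)" and ?R16 = "rsun f (\<lambda>_. 1) l r (16 * \<kappa>)"
  let ?N = "\<lambda>x. ennpow (maxfn f (\<lambda>x. ennreal (s x)) l r x) p * ennreal (s x)"
  have fin1: "mass (\<lambda>_. 1) l r < \<infinity>" by (cases "l \<le> r") (auto simp: mass_one)
  have op: "open ?R1" "open ?R2" "open ?R16" using rsun_open[OF _ _ fin fin1] kap by auto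
  then have [measurable]: "?R1 \<in> sets borel" "?R2 \<in> sets borel" "?R16 \<in> sets borel" by auto
  have [measurable]: "maxfn f (\<lambda>x. ennreal (s x)) l r \<in> borel_measurable borel"
    using pos by (intro measurable_maxfn fin S_finite) auto
  let ?\<mu> = "density lborel (\<lambda>x. ennreal (\<kappa> powr p) * (ennreal (v x) * indicator (- ?R2) x))"
  let ?\<nu> = "density lborel (\<lambda>x. ennreal C3 * (?N x * indicator (- ?R16) x))"
  have mu: "emeasure ?\<mu> A = ennreal (\<kappa> powr p) * (\<integral>\<^sup>+ x\<in>A - ?R2. v x \<partial>lborel)"
    and nu: "emeasure ?\<nu> A = ennreal C3 * (\<integral>\<^sup>+ x\<in>A - ?R16. ?N x \<partial>lborel)" if [measurable]: "A \<in> sets borel" for A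
    by (simp_all add: emeasure_density nn_integral_cmult[symmetric])
      (auto intro!: nn_integral_cong simp: indicator_def)
  have "emeasure ?\<mu> ?R1 \<le> emeasure ?\<nu> ?R1"
  proof (rule emeasure_open_le_by_components[OF op(1) rsun_subset])
    fix a b assume ab: "l \<le> a" "a < b" "b \<le> r" "{a<..<b} \<subseteq> ?R1" "a \<notin> ?R1" "b \<notin> ?R1"
    show "emeasure ?\<mu> {a<..<b} \<le> emeasure ?\<nu> {a<..<b}"
      using level_component_estimate[OF _ fin ab(1-3) kap ab(4,6)] by (simp add: mu nu)
  qed auto
  then show ?thesis by (simp add: mu nu)
qed

text \<open>The dyadic layers of the maximal function are estimated one by one and summed with
  bounded overlap; the resulting maximal function relative to \<open>s\<close> is controlled by
  \<open>maxfn_strong_type\<close>. Boundedness of f keeps the masses and the maximal function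
  finite, as the layer decomposition requires.\<close>

lemma maxfn_window_bound:
  fixes f :: "real \<Rightarrow> ennreal"
  assumes [measurable]: "f \<in> borel_measurable borel" and B: "\<And>x. f x \<le> ennreal B"
  shows "(\<integral>\<^sup>+ x. ennpow (maxfn f (\<lambda>_. 1) l r x) p * ennreal (v x) \<partial>lborel) \<le>
    ennreal (4 * 2 powr p * C3 * (2 powr (2 * p) * geo_const (p - 1))) *
    (\<integral>\<^sup>+ x\<in>{l<..<r}. (ennpow (f x) p * ennreal (v x)) \<partial>lborel)"
proof -
  let ?R = "\<lambda>c. rsun f (\<lambda>_. 1) l r c"
  let ?M = "maxfn f (\<lambda>_. 1) l r"
  let ?E = "\<lambda>x. {j::int. ennreal (2 powr j) < ?M x \<and> ?M x \<le> ennreal (2 powr real_of_int (j + 1))}"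
  let ?N = "\<lambda>x. ennpow (maxfn f (\<lambda>x. ennreal (s x)) l r x) p * ennreal (s x)"
  have fin1: "mass (\<lambda>_. 1) a b < \<infinity>" for a b :: real by (cases "a \<le> b") (auto simp: mass_one)
  have mB: "mass f a b \<le> ennreal B * mass (\<lambda>_. 1) a b" for a b
    unfolding mass_def by (subst nn_integral_cmult[symmetric]) (auto intro!: nn_integral_mono simp: indicator_def B)
  have fin: "mass f l r < \<infinity>"
    using mB[of l r] fin1[of l r] by (auto simp: ennreal_mult_less_top intro: le_less_trans)
  have [measurable]: "?M \<in> borel_measurable borel"
    by (intro measurable_maxfn fin fin1) auto
  have [measurable]: "maxfn f (\<lambda>x. ennreal (s x)) l r \<in> borel_measurable borel"
    using pos by (intro measurable_maxfn fin S_finite) auto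
  have Mfin: "?M x < \<infinity>" for x
  proof -
    have "?M x \<le> ennreal B"
      unfolding maxfn_def
    proof (auto intro!: SUP_least)
      fix e assume "x < e"
      then have "mass f x e / mass (\<lambda>_. 1) x e \<le> (ennreal B * mass (\<lambda>_. 1) x e) / mass (\<lambda>_. 1) x e"
        by (intro divide_right_mono_ennreal mB)
      also have "\<dots> = ennreal B"
        using \<open>x < e\<close> by (simp add: mass_one ennreal_mult_divide_eq)
      finally show "mass f x e / mass (\<lambda>_. 1) x e \<le> ennreal B" .
    qed
    then show ?thesis using le_less_trans by fastforce
  qed
  have gr: "x \<in> ?R c \<longleftrightarrow> ennreal c < ?M x" if "0 \<le> c" for c x
    using maxfn_greater[of "\<lambda>_. 1" l r c f] fin1 that by auto
  have Rm [measurable]: "?R (2 powr j) \<in> sets borel" "?R (2 * 2 powr j) \<in> sets borel" "?R (16 * 2 powr j) \<in> sets borel" for j :: real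
    using rsun_open[OF _ _ fin fin1] by auto
  \<comment> \<open>Membership means 2^j < M \<le> 2^(j+4) for the value M of the maximal function,
    which leaves at most four integers j.\<close>
  have count: "(\<integral>\<^sup>+ (j::int). indicator (?R (2 powr j) - ?R (16 * 2 powr j)) x \<partial>count_space UNIV) \<le> (4::ennreal)" for x
  proof (cases "?M x = 0")
    case True
    then show ?thesis by (simp add: gr indicator_def)
  next
    case False
    then obtain m where m: "?M x = ennreal m" "0 < m" using Mfin[of x] by (cases "?M x") auto
    obtain J :: int where J: "2 powr J < m" "m \<le> 2 powr (J + 1)" using dyadic_level[OF m(2)] .
    have "j \<in> {J - 3..J}" if "x \<in> ?R (2 powr j) - ?R (16 * 2 powr j)" for j :: int
    proof -
      have j: "2 powr j < m" "m \<le> 16 * 2 powr j" using that m by (auto simp: gr ennreal_less_iff not_less)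
      have "16 * 2 powr j = 2 powr (real_of_int j + 4)" by (simp add: powr_add)
      then have "2 powr real_of_int J < 2 powr (real_of_int j + 4)" "2 powr real_of_int j < 2 powr (real_of_int (J + 1))"
        using j J by linarith+
      then show ?thesis by simp
    qed
    then have "(\<integral>\<^sup>+ (j::int). indicator (?R (2 powr j) - ?R (16 * 2 powr j)) x \<partial>count_space UNIV)
      \<le> (\<integral>\<^sup>+ (j::int). indicator {J - 3..J} j \<partial>count_space UNIV)"
      by (intro nn_integral_mono) (auto simp: indicator_def)
    also have "\<dots> = 4" by (simp add: emeasure_count_space)
    finally show ?thesis .
  qed
  have "(\<integral>\<^sup>+ x. ennpow (?M x) p * ennreal (v x) \<partial>lborel)
    \<le> (\<integral>\<^sup>+ x. (\<integral>\<^sup>+ (j::int). ennreal (2 powr ((j + 1) * p)) *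
    indicator (?E x) j \<partial>count_space UNIV) * ennreal (v x) \<partial>lborel)"
    using p by (intro nn_integral_mono mult_right_mono ennpow_le_dyadic_layer Mfin) auto
  also have "\<dots> = (\<integral>\<^sup>+ x. (\<integral>\<^sup>+ (j::int). ennreal (2 powr p) * (ennreal ((2 powr j) powr p) *
    (ennreal (v x) * indicator (?R (2 powr j) - ?R (2 * 2 powr j)) x)) \<partial>count_space UNIV) \<partial>lborel)"
  proof (intro nn_integral_cong, subst nn_integral_multc[symmetric], simp, rule nn_integral_cong)
    fix x and j :: int
    have "ennreal (2 powr ((j + 1) * p)) = ennreal (2 powr p) * ennreal ((2 powr j) powr p)"
      by (simp add: ennreal_mult[symmetric] powr_powr powr_add[symmetric] algebra_simps)
    moreover have "indicator (?E x) j =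
      (indicator (?R (2 powr j) - ?R (2 * 2 powr j)) x :: ennreal)"
      by (auto simp: indicator_def gr not_less powr_add mult.commute)
    ultimately show "ennreal (2 powr ((j + 1) * p)) * indicator (?E x) j * ennreal (v x)
      = ennreal (2 powr p) * (ennreal ((2 powr j) powr p) * (ennreal (v x) * indicator (?R (2 powr j) - ?R (2 * 2 powr j)) x))"
      by (simp only: ac_simps)
  qed
  also have "\<dots> = (\<integral>\<^sup>+ (j::int). (\<integral>\<^sup>+ x. ennreal (2 powr p) * (ennreal ((2 powr j) powr p) *
    (ennreal (v x) * indicator (?R (2 powr j) - ?R (2 * 2 powr j)) x)) \<partial>lborel) \<partial>count_space UNIV)"
    by (rule nn_integral_count_space_nn_integral) measurable
  also have "\<dots> = (\<integral>\<^sup>+ (j::int). ennreal (2 powr p) * (ennreal ((2 powr j) powr p) *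
    (\<integral>\<^sup>+ x. ennreal (v x) * indicator (?R (2 powr j) - ?R (2 * 2 powr j)) x \<partial>lborel)) \<partial>count_space UNIV)"
    by (intro nn_integral_cong) (simp add: nn_integral_cmult)
  also have "\<dots> \<le> (\<integral>\<^sup>+ (j::int). ennreal (2 powr p) * (ennreal C3 *
    (\<integral>\<^sup>+ x. ?N x * indicator (?R (2 powr j) - ?R (16 * 2 powr j)) x \<partial>lborel)) \<partial>count_space UNIV)"
    by (intro nn_integral_mono mult_left_mono level_estimate fin) auto
  also have "\<dots> = (\<integral>\<^sup>+ (j::int). (\<integral>\<^sup>+ x. ennreal (2 powr p * C3) *
    (?N x * indicator (?R (2 powr j) - ?R (16 * 2 powr j)) x) \<partial>lborel) \<partial>count_space UNIV)"
    using C3_nonneg by (intro nn_integral_cong) (simp add: nn_integral_cmult ennreal_mult mult.assoc)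
  also have "\<dots> = (\<integral>\<^sup>+ x. (\<integral>\<^sup>+ (j::int). ennreal (2 powr p * C3) *
    (?N x * indicator (?R (2 powr j) - ?R (16 * 2 powr j)) x) \<partial>count_space UNIV) \<partial>lborel)"
    by (rule nn_integral_count_space_nn_integral[symmetric]) measurable
  also have "\<dots> = (\<integral>\<^sup>+ x. ennreal (2 powr p * C3) * (?N x *
    (\<integral>\<^sup>+ (j::int). indicator (?R (2 powr j) - ?R (16 * 2 powr j)) x \<partial>count_space UNIV)) \<partial>lborel)"
    by (intro nn_integral_cong) (simp add: nn_integral_cmult)
  also have "\<dots> \<le> (\<integral>\<^sup>+ x. ennreal (2 powr p * C3) * (?N x * 4) \<partial>lborel)"
    using count by (intro nn_integral_mono mult_left_mono) auto
  also have "\<dots> = (\<integral>\<^sup>+ x. ennreal (4 * 2 powr p * C3) * ?N x \<partial>lborel)"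
    using C3_nonneg by (intro nn_integral_cong) (simp add: ennreal_mult ac_simps)
  also have "\<dots> = ennreal (4 * 2 powr p * C3) * (\<integral>\<^sup>+ x. ?N x \<partial>lborel)"
    by (rule nn_integral_cmult) measurable
  also have "(\<integral>\<^sup>+ x. ?N x \<partial>lborel) \<le> ennreal (2 powr (2 * p) * geo_const (p - 1)) *
    (\<integral>\<^sup>+ x\<in>{l<..<r}. (ennpow (f x) p * ennreal (v x)) \<partial>lborel)"
  proof -
    \<comment> \<open>With g = f/s the measure g s dx is f dx, and v s^(p-1) = 1 gives g^p s = f^p
      v. The bound relative to \<open>s\<close> thus returns the original weighted integral.\<close>
    define g where "g x = f x * ennreal (1 / s x)" for x
    have [measurable]: "g \<in> borel_measurable borel" unfolding g_def by measurable
    have gs: "g x * ennreal (s x) = f x" for x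
      using pos(2)[of x] by (simp add: g_def mult.assoc ennreal_mult[symmetric])
    have gp: "ennpow (g x) p * ennreal (s x) = ennpow (f x) p * ennreal (v x)" for x
    proof -
      have "(1 / s x) powr p * s x = v x"
      proof -
        have sp: "s x powr p = s x * s x powr (p - 1)"
          using powr_add[of "s x" 1 "p - 1"] pos(2)[of x] by simp
        have "v x = 1 / s x powr (p - 1)"
          using dual[of x] pos(2)[of x] by (simp add: eq_divide_eq)
        then show ?thesis
          using pos(2)[of x] by (simp add: powr_divide sp)
      qed
      then show ?thesis
        using pos[of x] p less_imp_le[OF pos(2)[of x]]
        by (simp add: g_def ennpow_mult ennpow_ennreal mult.assoc ennreal_mult[symmetric])
    qed
    show ?thesis
      using maxfn_strong_type[of g "\<lambda>x. ennreal (s x)" l r p] fin S_finite p pos(2)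
      by (simp add: gs gp)
  qed
  finally show ?thesis
    using C3_nonneg geo_const_pos[of "p - 1"] p by (simp add: ennreal_mult mult.assoc mult_left_mono)
qed

end

section \<open>From bounded functions on a window to the whole line\<close>

definition max1 :: "(real \<Rightarrow> ennreal) \<Rightarrow> real \<Rightarrow> ennreal" where
  "max1 f x = (SUP e\<in>{x<..}. mass f x e / ennreal (e - x))"

text \<open>The bounds for f truncated at height n in the window (-n, n) are uniform in n. The
  windowed maximal functions increase, and their supremum dominates \<open>max1 f\<close>, so
  monotone convergence applies.\<close>

lemma (in one_sided_Ap) max1_bound:
  fixes f :: "real \<Rightarrow> ennreal"
  assumes [measurable]: "f \<in> borel_measurable borel"
  shows "(\<integral>\<^sup>+ x. ennpow (max1 f x) p * ennreal (v x) \<partial>lborel) \<le>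
    ennreal (4 * 2 powr p * C3 * (2 powr (2 * p) * geo_const (p - 1))) *
    (\<integral>\<^sup>+ x. ennpow (f x) p * ennreal (v x) \<partial>lborel)"
proof -
  let ?C = "ennreal (4 * 2 powr p * C3 * (2 powr (2 * p) * geo_const (p - 1)))"
  define g where "g n x = min (f x) (ennreal (real n))" for n x
  have gm [measurable]: "g n \<in> borel_measurable borel" for n unfolding g_def by measurable
  have g_inc: "g m x \<le> g n x" if "m \<le> n" for m n x
    unfolding g_def using that by (intro min.mono ennreal_leI) simp_all
  have gf: "g n x \<le> f x" for n x by (simp add: g_def)
  define W where "W n = maxfn (g n) (\<lambda>_. 1) (- real n) (real n)" for n
  have mg: "mass (g m) a b \<le> mass (g n) a b" if "m \<le> n" for m n a b
    unfolding mass_def using g_inc[OF that] by (intro nn_integral_mono mult_right_mono) auto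
  have Winc: "incseq W"
  proof (rule incseq_SucI, rule le_funI)
    fix n x
    show "W n x \<le> W (Suc n) x"
    proof (cases "- real n < x \<and> x < real n")
      case True
      have "W n x = (SUP e\<in>{x<..real n}. mass (g n) x e / mass (\<lambda>_. 1) x e)"
        using True by (simp add: W_def maxfn_def)
      also have "\<dots> \<le> (SUP e\<in>{x<..real (Suc n)}. mass (g (Suc n)) x e / mass (\<lambda>_. 1) x e)"
        by (rule SUP_subset_mono) (auto intro!: divide_right_mono_ennreal mg)
      also have "\<dots> = W (Suc n) x" using True by (simp add: W_def maxfn_def)
      finally show ?thesis .
    qed (auto simp: W_def maxfn_def)
  qed
  have Wm [measurable]: "W n \<in> borel_measurable borel" for n
  proof -
    have "mass (g n) (- real n) (real n) \<le> (\<integral>\<^sup>+ x. ennreal n * indicator {- real n<..<real n} x \<partial>lborel)"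
      unfolding mass_def by (intro nn_integral_mono mult_right_mono) (auto simp: g_def)
    also have "\<dots> < \<infinity>" by (simp add: nn_integral_cmult ennreal_mult_less_top)
    finally show ?thesis
      unfolding W_def by (intro measurable_maxfn) (auto simp: mass_one)
  qed
  have Wsup: "max1 f x \<le> (SUP n. W n x)" for x
    unfolding max1_def
  proof (rule SUP_least)
    fix e assume "e \<in> {x<..}"
    then have e: "x < e" by simp
    have "f y = (SUP n. g n y)" for y
    proof (rule antisym)
      show "f y \<le> (SUP n. g n y)"
      proof (cases "f y")
        case (real c)
        obtain n where "c \<le> real n" using real_arch_simple by blast
        then have "f y = g n y" using real by (simp add: g_def min_absorb1 ennreal_leI)
        then show ?thesis by (metis SUP_upper UNIV_I)
      next
        case top
        then have "g n y = ennreal (real n)" for n by (simp add: g_def)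
        then have "(SUP n. g n y) = (SUP n. of_nat n)" by (simp add: ennreal_of_nat_eq_real_of_nat)
        then have "(SUP n. g n y) = top" by (simp only: ennreal_SUP_of_nat_eq_top)
        then show ?thesis by (simp only: top_greatest)
      qed
    qed (auto intro!: SUP_least gf)
    then have "mass f x e = (\<integral>\<^sup>+ y. (SUP n. g n y * indicator {x<..<e} y) \<partial>lborel)"
      unfolding mass_def by (simp add: SUP_mult_right_ennreal)
    also have "\<dots> = (SUP n. mass (g n) x e)"
      unfolding mass_def
      by (intro nn_integral_monotone_convergence_SUP) (auto intro!: incseq_SucI le_funI mult_right_mono g_inc)
    finally have "mass f x e / ennreal (e - x) = (SUP n. mass (g n) x e / ennreal (e - x))"
      by (simp add: SUP_divide_ennreal)
    also have "\<dots> \<le> (SUP n. W n x)"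
    proof (rule SUP_least)
      fix n
      \<comment> \<open>The index \<open>?m\<close> is large enough for the window to admit the
        interval from x to e, and at least n, so the truncation is not lowered.\<close>
      obtain N where N: "max (\<bar>x\<bar> + 1) \<bar>e\<bar> \<le> real N" using real_arch_simple by blast
      let ?m = "max n N"
      have "mass (g n) x e / ennreal (e - x) \<le> mass (g ?m) x e / mass (\<lambda>_. 1) x e"
        using e by (simp add: mass_one divide_right_mono_ennreal mg)
      also have "\<dots> \<le> W ?m x"
        unfolding W_def maxfn_def using N e by (auto intro!: SUP_upper)
      also have "\<dots> \<le> (SUP n. W n x)" by (rule SUP_upper) simp
      finally show "mass (g n) x e / ennreal (e - x) \<le> (SUP n. W n x)" .
    qed
    finally show "mass f x e / ennreal (e - x) \<le> (SUP n. W n x)" .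
  qed
  have "(\<integral>\<^sup>+ x. ennpow (max1 f x) p * ennreal (v x) \<partial>lborel) \<le> (\<integral>\<^sup>+ x. (SUP n. ennpow (W n x) p * ennreal (v x)) \<partial>lborel)"
  proof (rule nn_integral_mono)
    fix x
    have "ennpow (max1 f x) p \<le> (SUP n. ennpow (W n x) p)"
      using ennpow_mono[OF Wsup, of p x] p by (simp add: ennpow_SUP)
    then show "ennpow (max1 f x) p * ennreal (v x) \<le> (SUP n. ennpow (W n x) p * ennreal (v x))"
      by (simp add: SUP_mult_right_ennreal[symmetric] mult_right_mono)
  qed
  also have "\<dots> = (SUP n. \<integral>\<^sup>+ x. ennpow (W n x) p * ennreal (v x) \<partial>lborel)"
    using p Winc
    by (intro nn_integral_monotone_convergence_SUP)
      (auto intro!: incseq_SucI le_funI mult_right_mono ennpow_mono dest: incseq_SucD le_funD)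
  also have "\<dots> \<le> ?C *
    (\<integral>\<^sup>+ x. ennpow (f x) p * ennreal (v x) \<partial>lborel)"
  proof (rule SUP_least)
    fix n
    have "(\<integral>\<^sup>+ x. ennpow (W n x) p * ennreal (v x) \<partial>lborel) \<le>
      ?C *
      (\<integral>\<^sup>+ x\<in>{- real n<..<real n}. (ennpow (g n x) p * ennreal (v x)) \<partial>lborel)"
      unfolding W_def by (rule maxfn_window_bound[where B="real n"]) (auto simp: g_def)
    also have "\<dots> \<le> ?C *
      (\<integral>\<^sup>+ x. ennpow (f x) p * ennreal (v x) \<partial>lborel)"
      using p gf by (intro mult_left_mono nn_integral_mono) (auto simp: indicator_def intro!: mult_right_mono ennpow_mono)
    finally show "(\<integral>\<^sup>+ x. ennpow (W n x) p * ennreal (v x) \<partial>lborel) \<le>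
      ?C *
      (\<integral>\<^sup>+ x. ennpow (f x) p * ennreal (v x) \<partial>lborel)" .
  qed
  finally show ?thesis .
qed

lemma nn_integral_lebesgue: "(\<integral>\<^sup>+ x. f x \<partial>lebesgue) = (\<integral>\<^sup>+ x. f x \<partial>lborel)"
  by (rule nn_integral_completion)

text \<open>The constant of \<open>max1_bound\<close> with the powers of \<open>K\<close> taken
  out.\<close>

definition max_const :: "real \<Rightarrow> real" where
  "max_const p = 4 * 2 powr p * (2 powr p * (8 * (8 * (2 powr (p * (p - 1)) * geo_const ((p - 1) * (p - 1)))) powr (1 / (p - 1)))) *
     (2 powr (2 * p) * geo_const (p - 1))"

lemma max_const_pos: "1 < p \<Longrightarrow> 0 < max_const p"
  using geo_const_pos[of "p - 1"] geo_const_pos[of "(p - 1) * (p - 1)"] by (simp add: max_const_def)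

text \<open>The locale is entered with s = v^(1-p') after clearing the lengths h from the averages.
  The two uses of the A_p condition contribute K and K^(1/(p-1)); their product K^(p/(p-1)) becomes
  K^(1/(p-1)) after the p-th root.\<close>

theorem one_sided_maximal_bound:
  fixes p K :: real and v :: "real \<Rightarrow> real" and f :: "real \<Rightarrow> ennreal"
  assumes p: "1 < p" and [measurable]: "v \<in> borel_measurable borel" "f \<in> borel_measurable borel"
    and pos: "\<And>x. 0 < v x" and K: "0 < K" "Ap1_plus p v \<le> ennreal K"
  shows "(\<integral>\<^sup>+ x. ennpow (max1 f x) p * ennreal (v x) \<partial>lborel) \<le>
    ennreal (max_const p * K powr (p / (p - 1))) * (\<integral>\<^sup>+ x. ennpow (f x) p * ennreal (v x) \<partial>lborel)"
proof -
  define s where "s x = v x powr (1 - conj_exp p)" for x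
  have [measurable]: "s \<in> borel_measurable borel" unfolding s_def by measurable
  have ex: "(1 - conj_exp p) * (p - 1) = - 1" using p by (simp add: conj_exp_def field_simps)
  interpret one_sided_Ap p K v s
  proof
    fix t h :: real assume h: "0 < h"
    let ?V = "mass (\<lambda>x. ennreal (v x)) (t - h) t" and ?S = "mass (\<lambda>x. ennreal (s x)) t (t + h)"
    have "(?V / ennreal h) * ennpow (?S / ennreal h) (p - 1) \<le> Ap1_plus p v"
      unfolding Ap1_plus_def mass_closed s_def nn_integral_lebesgue
      by (rule SUP_upper2[of "(t, h)"]) (use h in auto)
    also have "\<dots> \<le> ennreal K" by fact
    finally have le: "(?V / ennreal h) * ennpow (?S / ennreal h) (p - 1) \<le> ennreal K" .
    have div: "x = x / ennreal h * ennreal h" for x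
      using h by (simp add: ennreal_divide_times mult_divide_eq_ennreal)
    have "?V * ennpow ?S (p - 1) = (?V / ennreal h * ennreal h) * ennpow (?S / ennreal h * ennreal h) (p - 1)"
      by (simp add: div[symmetric])
    also have "\<dots> = (?V / ennreal h) * ennpow (?S / ennreal h) (p - 1) * (ennreal h * ennreal (h powr (p - 1)))"
      using p h by (simp add: ennpow_mult ennpow_ennreal ac_simps)
    also have "ennreal h * ennreal (h powr (p - 1)) = ennreal (h powr p)"
      using h powr_add[of h 1 "p - 1"] by (simp add: ennreal_mult[symmetric])
    also have "(?V / ennreal h) * ennpow (?S / ennreal h) (p - 1) * ennreal (h powr p) \<le> ennreal K * ennreal (h powr p)"
      by (intro mult_right_mono le) auto
    finally show "?V * ennpow ?S (p - 1) \<le> ennreal (K * h powr p)"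
      using K by (simp add: ennreal_mult)
  next
    fix x show "v x * s x powr (p - 1) = 1"
      unfolding s_def powr_powr ex using pos[of x] by (simp add: powr_minus)
    show "0 < s x" using pos[of x] by (simp add: s_def)
  qed (use p K pos in \<open>auto simp: s_def\<close>)
  have e: "1 + 1 / (p - 1) = p / (p - 1)" using p by (simp add: field_simps)
  have "C2 (1 / 4) = 8 * (8 * (2 powr (p * (p - 1)) * geo_const ((p - 1) * (p - 1)))) powr (1 / (p - 1)) * K powr (1 / (p - 1))"
    unfolding C2_def C1_def by (simp add: powr_mult)
  then have "4 * 2 powr p * C3 * (2 powr (2 * p) * geo_const (p - 1)) = max_const p * (K powr 1 * K powr (1 / (p - 1)))"
    unfolding C3_def max_const_def using K by (simp add: ac_simps)
  also have "K powr 1 * K powr (1 / (p - 1)) = K powr (p / (p - 1))"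
    unfolding powr_add[symmetric] e by simp
  finally show ?thesis using max1_bound[of f] by simp
qed

section \<open>Iteration over the coordinates\<close>

lemma ennreal_times_divide_cancel: "0 < q \<Longrightarrow> ennreal q * (x / ennreal q) = x"
  unfolding ennreal_times_divide mult.commute[of "ennreal q" x] by (simp add: mult_divide_eq_ennreal)

text \<open>Rational lengths make the supremum countable, as measurability demands. An interval of
  length e - x lies in one of any larger rational length q, and q may be arbitrarily close to e -
  x.\<close>

lemma max1_rational:
  "max1 f x = (SUP q\<in>{q\<in>\<rat>. 0 < q}. mass f x (x + q) / ennreal q)" (is "_ = ?R")
proof (rule antisym)
  show "?R \<le> max1 f x" unfolding max1_def
  proof (rule SUP_least)
    fix q :: real assume "q \<in> {q\<in>\<rat>. 0 < q}"
    then show "mass f x (x + q) / ennreal q \<le> (SUP e\<in>{x<..}. mass f x e / ennreal (e - x))"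
      by (intro SUP_upper2[of "x + q"]) auto
  qed
  show "max1 f x \<le> ?R" unfolding max1_def
  proof (rule SUP_least)
    fix e assume "e \<in> {x<..}"
    then have e: "x < e" by simp
    have le: "mass f x e \<le> ennreal q * ?R" if q: "q \<in> \<rat>" "e - x < q" for q
    proof -
      have "mass f x e \<le> mass f x (x + q)" using q by (intro mass_mono) auto
      also have "\<dots> = ennreal q * (mass f x (x + q) / ennreal q)"
        using q e by (simp add: ennreal_times_divide_cancel)
      also have "\<dots> \<le> ennreal q * ?R"
        using q e by (intro mult_left_mono SUP_upper) auto
      finally show ?thesis .
    qed
    show "mass f x e / ennreal (e - x) \<le> ?R"
    proof (cases ?R)
      case (real R)
      obtain q0 where q0: "q0 \<in> \<rat>" "e - x < q0" using Rats_dense_in_real[of "e - x" "e - x + 1"] by (auto simp del: One_nat_def)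
      have "mass f x e < top"
        using le_less_trans[OF le[OF q0], of top] unfolding real(2) by (simp add: ennreal_mult_less_top)
      then obtain m where m: "mass f x e = ennreal m" "0 \<le> m" by (cases "mass f x e") auto
      have mq: "m \<le> q * R" if "q \<in> \<rat>" "e - x < q" for q
        using le[OF that] real m e that by (simp add: ennreal_mult[symmetric])
      have "m \<le> (e - x) * R"
      proof (rule ccontr)
        assume "\<not> m \<le> (e - x) * R"
        then have lt: "(e - x) * R < m" by simp
        then have "R \<noteq> 0" using mq[OF q0] m by auto
        then have R: "0 < R" using real by simp
        then have "e - x < m / R" using lt by (simp add: field_simps)
        then obtain q where "q \<in> \<rat>" "e - x < q" "q < m / R" using Rats_dense_in_real by blast
        with mq[of q] R show False by (simp add: field_simps)
      qed
      then show ?thesis unfolding m(1) real(2) using e real by (simp add: divide_ennreal m field_simps ennreal_leI)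
    next
      case top
      show ?thesis unfolding top by simp
    qed
  qed
qed

section \<open>Product coordinates and directional maximal operators\<close>

abbreviation PM :: "('n::finite \<Rightarrow> real) measure" where
  "PM \<equiv> Pi\<^sub>M UNIV (\<lambda>_. lborel)"

lemma product_sigma_finite_lborel: "product_sigma_finite (\<lambda>_::'n. lborel :: real measure)"
  by (simp add: product_sigma_finite_def sigma_finite_lborel)

lemma measurable_vec_lambda [measurable]: "(\<lambda>z::'n::finite \<Rightarrow> real. \<chi> i. z i) \<in> PM \<rightarrow>\<^sub>M borel"
proof -
  have "(\<lambda>z::'n \<Rightarrow> real. (\<chi> i. z i)) = (\<lambda>z. \<Sum>i\<in>UNIV. z i *\<^sub>R axis i 1)"
    by (auto simp: vec_eq_iff axis_def if_distrib cong: if_cong)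
  then show ?thesis by simp
qed

text \<open>Boxes determine Lebesgue measure, and both sides agree on them. Integrals over vectors
  thereby move to a product of lines, where a single coordinate can be changed by function
  update.\<close>

lemma lborel_vec: "(lborel :: (real ^ 'n) measure) = distr PM borel (\<lambda>z. \<chi> i. z i)"
proof (rule lborel_eqI)
  interpret product_sigma_finite "\<lambda>_::'n. lborel :: real measure" by (rule product_sigma_finite_lborel)
  fix l u :: "real ^ 'n" assume le: "\<And>b. b \<in> Basis \<Longrightarrow> l \<bullet> b \<le> u \<bullet> b"
  have le': "l $ i \<le> u $ i" for i
    using le[of "axis i 1"] by (auto simp: inner_axis Basis_vec_def)
  have "(\<lambda>z::'n \<Rightarrow> real. \<chi> i. z i) -` box l u \<inter> space PM = (\<Pi>\<^sub>E i\<in>UNIV. {l $ i<..<u $ i})"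
    by (auto simp: mem_box_cart space_PiM PiE_iff)
  then have "emeasure (distr PM borel (\<lambda>z. \<chi> i. z i)) (box l u) = emeasure PM (\<Pi>\<^sub>E i\<in>UNIV. {l $ i<..<u $ i})"
    by (subst emeasure_distr) auto
  also have "\<dots> = (\<Prod>i\<in>UNIV. ennreal (u $ i - l $ i))"
    using le' by (subst emeasure_PiM) auto
  also have "\<dots> = ennreal (\<Prod>i\<in>UNIV. u $ i - l $ i)"
    using le' by (intro prod_ennreal) auto
  also have "(\<Prod>i\<in>UNIV. u $ i - l $ i) = (\<Prod>b\<in>Basis. (u - l) \<bullet> b)"
  proof -
    have B: "Basis = (\<lambda>i. axis i (1::real)) ` (UNIV :: 'n set)" by (auto simp: Basis_vec_def)
    have inj: "inj (\<lambda>i::'n. axis i (1::real))" by (auto simp: inj_on_def axis_eq_axis)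
    show ?thesis unfolding B prod.reindex[OF inj] by (simp add: inner_axis)
  qed
  finally show "emeasure (distr PM borel (\<lambda>z. \<chi> i. z i)) (box l u) = ennreal (\<Prod>b\<in>Basis. (u - l) \<bullet> b)" .
qed simp

lemma nn_integral_vec:
  fixes F :: "real ^ 'n \<Rightarrow> ennreal"
  assumes "F \<in> borel_measurable borel"
  shows "(\<integral>\<^sup>+ x. F x \<partial>lborel) = (\<integral>\<^sup>+ z. F (\<chi> i. z i) \<partial>PM)"
  unfolding lborel_vec using assms by (subst nn_integral_distr) auto

lemma nn_integral_PM_slice:
  fixes F :: "('n::finite \<Rightarrow> real) \<Rightarrow> ennreal"
  assumes "F \<in> borel_measurable PM"
  shows "(\<integral>\<^sup>+ z. F z \<partial>PM) = (\<integral>\<^sup>+ z. (\<integral>\<^sup>+ t. F (z(i := t)) \<partial>lborel) \<partial>other_coords i)"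
proof -
  interpret product_sigma_finite "\<lambda>_::'n. lborel :: real measure" by (rule product_sigma_finite_lborel)
  have "insert i (UNIV - {i}) = UNIV" by auto
  then show ?thesis
    using product_nn_integral_insert[of "UNIV - {i}" i F] assms by (simp add: other_coords_def)
qed

lemma measurable_slice [measurable]:
  "(\<lambda>t. z(i := t)) \<in> lborel \<rightarrow>\<^sub>M (PM :: ('n::finite \<Rightarrow> real) measure)"
  by (rule measurable_fun_upd[where J=UNIV]) (auto simp: space_PiM)

definition dmax :: "'n \<Rightarrow> (('n \<Rightarrow> real) \<Rightarrow> ennreal) \<Rightarrow> ('n \<Rightarrow> real) \<Rightarrow> ennreal" where
  "dmax i G z = max1 (\<lambda>t. G (z(i := t))) (z i)"

text \<open>By \<open>max1_rational\<close> the supremum is countable, and for each q the mass is a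
  parametrised integral of a jointly measurable function.\<close>

lemma measurable_dmax [measurable]:
  fixes i :: "'n::finite"
  assumes [measurable]: "G \<in> borel_measurable PM"
  shows "dmax i G \<in> borel_measurable PM"
proof -
  have [measurable]: "(\<lambda>z. mass (\<lambda>t. G (z(i := t))) (z i) (z i + q)) \<in> borel_measurable PM" for q
  proof -
    have [measurable]: "(\<lambda>(z, t). z(i := t)) \<in> PM \<Otimes>\<^sub>M lborel \<rightarrow>\<^sub>M PM"
      unfolding split_beta' by (rule measurable_fun_upd[where J=UNIV]) auto
    have eq: "mass (\<lambda>t. G (z(i := t))) (z i) (z i + q) =
      (\<integral>\<^sup>+ t. (case (z, t) of (z, t) \<Rightarrow> G (case (z, t) of (z, t) \<Rightarrow> z(i := t)) * (if z i < t \<and> t < z i + q then 1 else 0)) \<partial>lborel)" for z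
      unfolding mass_def by (auto intro!: nn_integral_cong simp: indicator_def)
    show ?thesis unfolding eq by measurable
  qed
  have "countable {q \<in> \<rat>. 0 < (q::real)}" by (rule countable_subset[OF _ countable_rat]) auto
  then show ?thesis unfolding dmax_def max1_rational by measurable
qed

text \<open>Tonelli in the variable i reduces the claim to lines parallel to the i-th axis. On
  almost all of them the one-dimensional bound holds with the common constant
  \<open>K\<close>.\<close>

lemma dmax_bound:
  fixes i :: "'n::finite" and W :: "('n \<Rightarrow> real) \<Rightarrow> real"
  assumes p: "1 < p" and [measurable]: "G \<in> borel_measurable PM" "W \<in> borel_measurable PM"
    and pos: "\<And>z. 0 < W z" and K: "0 < K" and Ap: "AE z in other_coords i. Ap1_plus p (\<lambda>t. W (z(i := t))) \<le> ennreal K"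
  shows "(\<integral>\<^sup>+ z. ennpow (dmax i G z) p * ennreal (W z) \<partial>PM) \<le>
    ennreal (max_const p * K powr (p / (p - 1))) * (\<integral>\<^sup>+ z. ennpow (G z) p * ennreal (W z) \<partial>PM)"
proof -
  let ?k = "ennreal (max_const p * K powr (p / (p - 1)))"
  have [measurable]: "(\<lambda>(z, t). z(i := t)) \<in> other_coords i \<Otimes>\<^sub>M lborel \<rightarrow>\<^sub>M PM"
    unfolding split_beta' other_coords_def by (rule measurable_fun_upd[where J="UNIV - {i}"]) auto
  have "(\<integral>\<^sup>+ z. ennpow (dmax i G z) p * ennreal (W z) \<partial>PM) =
    (\<integral>\<^sup>+ z. (\<integral>\<^sup>+ t. ennpow (max1 (\<lambda>t. G (z(i := t))) t) p * ennreal (W (z(i := t))) \<partial>lborel) \<partial>other_coords i)"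
    by (subst nn_integral_PM_slice[of _ i], measurable) (simp add: dmax_def)
  also have "\<dots> \<le> (\<integral>\<^sup>+ z. ?k *
      (\<integral>\<^sup>+ t. ennpow (G (z(i := t))) p * ennreal (W (z(i := t))) \<partial>lborel) \<partial>other_coords i)"
  proof (rule nn_integral_mono_AE)
    show "AE z in other_coords i. (\<integral>\<^sup>+ t. ennpow (max1 (\<lambda>t. G (z(i := t))) t) p * ennreal (W (z(i := t))) \<partial>lborel)
      \<le> ?k *
      (\<integral>\<^sup>+ t. ennpow (G (z(i := t))) p * ennreal (W (z(i := t))) \<partial>lborel)"
      using Ap
    proof eventually_elim
      case (elim z)
      have [measurable]: "(\<lambda>t. W (z(i := t))) \<in> borel_measurable borel" "(\<lambda>t. G (z(i := t))) \<in> borel_measurable borel"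
        using measurable_compose[OF measurable_slice, of W borel z i] measurable_compose[OF measurable_slice, of G borel z i]
        by auto
      show ?case by (rule one_sided_maximal_bound[OF p _ _ pos K elim]) measurable
    qed
  qed
  also have "\<dots> = ?k *
      (\<integral>\<^sup>+ z. (\<integral>\<^sup>+ t. ennpow (G (z(i := t))) p * ennreal (W (z(i := t))) \<partial>lborel) \<partial>other_coords i)"
  proof (rule nn_integral_cmult)
    have "(\<lambda>z. \<integral>\<^sup>+ t. (\<lambda>(z, t). ennpow (G ((\<lambda>(z, t). z(i := t)) (z, t))) p * ennreal (W ((\<lambda>(z, t). z(i := t)) (z, t)))) (z, t) \<partial>lborel)
      \<in> borel_measurable (other_coords i)"
      by measurable
    then show "(\<lambda>z. \<integral>\<^sup>+ t. ennpow (G (z(i := t))) p * ennreal (W (z(i := t))) \<partial>lborel) \<in> borel_measurable (other_coords i)"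
      by simp
  qed
  also have "(\<integral>\<^sup>+ z. (\<integral>\<^sup>+ t. ennpow (G (z(i := t))) p * ennreal (W (z(i := t))) \<partial>lborel) \<partial>other_coords i) =
    (\<integral>\<^sup>+ z. ennpow (G z) p * ennreal (W z) \<partial>PM)"
    by (subst nn_integral_PM_slice[of _ i]) auto
  finally show ?thesis .
qed

lemma measurable_foldr_dmax [measurable]:
  assumes [measurable]: "G \<in> borel_measurable PM"
  shows "foldr dmax is G \<in> borel_measurable (PM :: ('n::finite \<Rightarrow> real) measure)"
  by (induction "is") (auto intro!: measurable_dmax)

text \<open>The operators are peeled off one at a time. The weight stays the same throughout, so
  each direction in the list contributes its own factor.\<close>

lemma foldr_dmax_bound:
  fixes W :: "('n::finite \<Rightarrow> real) \<Rightarrow> real"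
  assumes p: "1 < p" and [measurable]: "G \<in> borel_measurable PM" "W \<in> borel_measurable PM"
    and pos: "\<And>z. 0 < W z" and K: "\<And>i. 0 < K i"
    and Ap: "\<And>i. AE z in other_coords i. Ap1_plus p (\<lambda>t. W (z(i := t))) \<le> ennreal (K i)"
  shows "(\<integral>\<^sup>+ z. ennpow (foldr dmax is G z) p * ennreal (W z) \<partial>PM) \<le>
    (\<Prod>i\<leftarrow>is. ennreal (max_const p * K i powr (p / (p - 1)))) * (\<integral>\<^sup>+ z. ennpow (G z) p * ennreal (W z) \<partial>PM)"
proof (induction "is")
  case (Cons i "is")
  have "(\<integral>\<^sup>+ z. ennpow (foldr dmax (i # is) G z) p * ennreal (W z) \<partial>PM) \<le>
    ennreal (max_const p * K i powr (p / (p - 1))) * (\<integral>\<^sup>+ z. ennpow (foldr dmax is G z) p * ennreal (W z) \<partial>PM)"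
    unfolding foldr.simps comp_def by (rule dmax_bound[OF p _ _ pos K Ap]) measurable
  also have "\<dots> \<le> ennreal (max_const p * K i powr (p / (p - 1))) *
    ((\<Prod>i\<leftarrow>is. ennreal (max_const p * K i powr (p / (p - 1)))) * (\<integral>\<^sup>+ z. ennpow (G z) p * ennreal (W z) \<partial>PM))"
    by (intro mult_left_mono Cons.IH) auto
  finally show ?case by (simp add: mult.assoc)
qed simp

definition line_integral :: "('n \<Rightarrow> real) \<Rightarrow> 'n \<Rightarrow> (('n \<Rightarrow> real) \<Rightarrow> ennreal) \<Rightarrow> ('n \<Rightarrow> real) \<Rightarrow> ennreal" where
  "line_integral h i G z = (\<integral>\<^sup>+ t\<in>{z i..z i + h i}. G (z(i := t)) \<partial>lborel)"

text \<open>Integrating over an interval costs at most its length times the directional maximal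
  function at the starting point; monotonicity carries the inner bounds through the outer
  integrals.\<close>

lemma foldr_line_integral_le:
  assumes [measurable]: "G \<in> borel_measurable PM" and h: "\<And>i. 0 < h i"
  shows "foldr (line_integral h) is G z \<le> (\<Prod>i\<leftarrow>is. ennreal (h i)) * foldr dmax is G z"
proof (induction "is" arbitrary: z)
  case (Cons i "is")
  let ?c = "\<Prod>i\<leftarrow>is. ennreal (h i)"
  let ?F = "\<lambda>t. foldr dmax is G (z(i := t))"
  have "foldr (line_integral h) (i # is) G z \<le> (\<integral>\<^sup>+ t\<in>{z i..z i + h i}. (?c * ?F t) \<partial>lborel)"
    unfolding foldr.simps comp_def line_integral_def[of h i]
    by (intro nn_integral_mono mult_right_mono Cons.IH) auto
  also have "\<dots> = (\<integral>\<^sup>+ t. ?c * (?F t * indicator {z i..z i + h i} t) \<partial>lborel)"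
    by (simp add: mult.assoc)
  also have "\<dots> = ?c * mass ?F (z i) (z i + h i)"
  proof -
    have [measurable]: "?F \<in> borel_measurable borel"
      using measurable_compose[OF measurable_slice measurable_foldr_dmax[OF assms(1)]] by simp
    show ?thesis unfolding mass_closed by (rule nn_integral_cmult) measurable
  qed
  also have "\<dots> \<le> ?c * (ennreal (h i) * dmax i (foldr dmax is G) z)"
  proof (rule mult_left_mono)
    show "mass ?F (z i) (z i + h i) \<le> ennreal (h i) * dmax i (foldr dmax is G) z"
    proof -
    have "mass ?F (z i) (z i + h i) = ennreal (h i) * (mass ?F (z i) (z i + h i) / ennreal (h i))"
      using h[of i] by (simp add: ennreal_times_divide_cancel)
    also have "\<dots> \<le> ennreal (h i) * dmax i (foldr dmax is G) z"
      unfolding dmax_def max1_def using h[of i]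
      by (intro mult_left_mono SUP_upper2[of "z i + h i"]) auto
    finally show ?thesis .
    qed
  qed simp
  finally show ?case by (simp add: ac_simps)
qed simp

text \<open>Tonelli, one variable at a time: coordinates in the list are integrated, the others stay
  frozen at \<open>z\<close>. The induction generalises over \<open>z\<close> because the outer
  variable is written into \<open>z\<close> before the inner integrals are evaluated.\<close>

lemma nn_integral_foldr_line_integral:
  fixes G :: "('n::finite \<Rightarrow> real) \<Rightarrow> ennreal"
  assumes [measurable]: "G \<in> borel_measurable PM" and "distinct is"
  shows "foldr (line_integral h) is G z =
    (\<integral>\<^sup>+ y. G (\<lambda>j. if j \<in> set is then y j else z j) * (\<Prod>j\<in>set is. indicator {z j..z j + h j} (y j)) \<partial>Pi\<^sub>M (set is) (\<lambda>_. lborel))"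
  using \<open>distinct is\<close>
proof (induction "is" arbitrary: z)
  case Nil
  interpret product_sigma_finite "\<lambda>_::'n. lborel :: real measure" by (rule product_sigma_finite_lborel)
  show ?case by (simp add: space_PiM_empty emeasure_PiM_empty)
next
  case (Cons i "is")
  interpret product_sigma_finite "\<lambda>_::'n. lborel :: real measure" by (rule product_sigma_finite_lborel)
  have i: "i \<notin> set is" and fin: "finite (set is)" using Cons.prems by auto
  have [measurable]: "(\<lambda>y j. if j \<in> insert i (set is) then y j else z j) \<in> Pi\<^sub>M (insert i (set is)) (\<lambda>_. lborel) \<rightarrow>\<^sub>M PM"
  proof (rule measurable_PiM_single')
    fix j :: 'n
    show "(\<lambda>y. if j \<in> insert i (set is) then y j else z j) \<in> Pi\<^sub>M (insert i (set is)) (\<lambda>_. lborel) \<rightarrow>\<^sub>M lborel"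
      by (cases "j \<in> insert i (set is)") (simp_all add: measurable_component_singleton)
  qed auto
  let ?J = "\<lambda>t. \<integral>\<^sup>+ y. G (\<lambda>j. if j \<in> set is then y j else (z(i := t)) j) *
     (\<Prod>j\<in>set is. indicator {(z(i := t)) j..(z(i := t)) j + h j} (y j)) \<partial>Pi\<^sub>M (set is) (\<lambda>_. lborel)"
  let ?f = "\<lambda>y. G (\<lambda>j. if j \<in> insert i (set is) then y j else z j) * (\<Prod>j\<in>insert i (set is). indicator {z j..z j + h j} (y j) :: ennreal)"
  have m: "?f \<in> borel_measurable (Pi\<^sub>M (insert i (set is)) (\<lambda>_. lborel))" by measurable
  have "foldr (line_integral h) (i # is) G z = (\<integral>\<^sup>+ t\<in>{z i..z i + h i}. ?J t \<partial>lborel)"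
    unfolding foldr.simps comp_def line_integral_def[of h i]
    using Cons.prems by (intro nn_integral_cong arg_cong2[where f="(*)"] Cons.IH refl) auto
  also have "\<dots> = (\<integral>\<^sup>+ t. (\<integral>\<^sup>+ y. ?f (y(i := t)) \<partial>Pi\<^sub>M (set is) (\<lambda>_. lborel)) \<partial>lborel)"
  proof (rule nn_integral_cong)
    fix t
    have e1: "(\<lambda>j. if j \<in> set is then y j else (z(i := t)) j) = (\<lambda>j. if j \<in> insert i (set is) then (y(i := t)) j else z j)" for y
      using i by (auto simp: fun_eq_iff)
    have e2: "(\<Prod>j\<in>insert i (set is). indicator {z j..z j + h j} ((y(i := t)) j) :: ennreal) =
      indicator {z i..z i + h i} t * (\<Prod>j\<in>set is. indicator {(z(i := t)) j..(z(i := t)) j + h j} (y j))" for y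
      using i by (subst prod.insert) (auto intro!: prod.cong arg_cong2[where f="(*)"])
    show "?J t * indicator {z i..z i + h i} t
      = (\<integral>\<^sup>+ y. ?f (y(i := t)) \<partial>Pi\<^sub>M (set is) (\<lambda>_. lborel))"
      unfolding e1 e2 by (cases "t \<in> {z i..z i + h i}") simp_all
  qed
  also have "\<dots> = (\<integral>\<^sup>+ y. ?f y \<partial>Pi\<^sub>M (insert i (set is)) (\<lambda>_. lborel))"
    by (rule product_nn_integral_insert_rev[OF fin i m, symmetric])
  finally show ?case by simp
qed

text \<open>A box average is an iterated average over the coordinates, and each single average is
  dominated by the corresponding directional maximal operator.\<close>

lemma strong_max_plus_le:
  fixes f :: "real ^ 'n \<Rightarrow> real"
  assumes [measurable]: "f \<in> borel_measurable borel" and "is": "distinct is" "set is = UNIV"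
  shows "strong_max_plus f x \<le> foldr dmax is (\<lambda>z. ennreal \<bar>f (\<chi> i. z i)\<bar>) (\<lambda>i. x $ i)"
  unfolding strong_max_plus_def
proof (rule SUP_least)
  fix h :: "real ^ 'n" assume "h \<in> {h. pos_vec h}"
  then have h: "0 < h $ i" for i by (simp add: pos_vec_def)
  let ?G = "\<lambda>z. ennreal \<bar>f (\<chi> i. z i)\<bar>"
  have c: "(\<Prod>i\<leftarrow>is. ennreal (h $ i)) = vol h"
    using "is" h by (simp add: vol_def prod.distinct_set_conv_list[symmetric] prod_ennreal less_imp_le)
  have "(\<integral>\<^sup>+ y\<in>box_plus x h. ennreal \<bar>f y\<bar> \<partial>lebesgue) = (\<integral>\<^sup>+ z. ?G z * indicator (box_plus x h) (\<chi> i. z i) \<partial>PM)"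
    unfolding nn_integral_lebesgue by (rule nn_integral_vec) (simp add: box_plus_def)
  also have "\<dots> = (\<integral>\<^sup>+ z. ?G z * (\<Prod>j\<in>UNIV. indicator {x $ j..x $ j + h $ j} (z j)) \<partial>PM)"
  proof (rule nn_integral_cong)
    fix z :: "'n \<Rightarrow> real"
    have "(indicator (box_plus x h) (\<chi> i. z i) :: ennreal) = (\<Prod>j\<in>UNIV. indicator {x $ j..x $ j + h $ j} (z j))"
      by (cases "\<forall>j. z j \<in> {x $ j..x $ j + h $ j}")
        (auto simp: box_plus_def mem_box_cart indicator_def prod_zero_iff)
    then show "?G z * indicator (box_plus x h) (\<chi> i. z i) = ?G z * (\<Prod>j\<in>UNIV. indicator {x $ j..x $ j + h $ j} (z j))"
      by simp
  qed
  also have "\<dots> = foldr (line_integral (\<lambda>i. h $ i)) is ?G (\<lambda>i. x $ i)"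
    using nn_integral_foldr_line_integral[OF _ "is"(1), of ?G "\<lambda>i. h $ i" "\<lambda>i. x $ i"] unfolding "is"(2) by simp
  also have "\<dots> \<le> vol h * foldr dmax is ?G (\<lambda>i. x $ i)"
    unfolding c[symmetric] by (rule foldr_line_integral_le) (use h in auto)
  finally have "(\<integral>\<^sup>+ y\<in>box_plus x h. ennreal \<bar>f y\<bar> \<partial>lebesgue) \<le> vol h * foldr dmax is ?G (\<lambda>i. x $ i)" .
  then show "(\<integral>\<^sup>+ y\<in>box_plus x h. ennreal \<bar>f y\<bar> \<partial>lebesgue) / vol h \<le> foldr dmax is ?G (\<lambda>i. x $ i)"
    using h by (intro divide_le_posI_ennreal) (auto simp: vol_def intro!: prod_pos)
qed

section \<open>Essential suprema, slices and Borel representatives\<close>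

lemma ess_sup_AE: "AE x in M. f x \<le> ess_sup M f"
proof (cases "ess_sup M f")
  case (real c)
  \<comment> \<open>A bound strictly above the Limsup holds almost everywhere; countably many such
    bounds decreasing to c hold simultaneously.\<close>
  have "AE x in M. f x < ennreal (c + 1 / real (Suc n))" for n
  proof -
    have "ennreal c < ennreal (c + 1 / real (Suc n))" using real by (simp add: ennreal_less_iff)
    then show ?thesis using real Limsup_lessD[of "ae_filter M" f] unfolding ess_sup_def by auto
  qed
  then have "AE x in M. \<forall>n. f x < ennreal (c + 1 / real (Suc n))" by (simp add: AE_all_countable)
  then show ?thesis
  proof eventually_elim
    case (elim x)
    show ?case unfolding real(2)
    proof (rule ennreal_le_epsilon)
      fix e :: real assume "0 < e"
      then obtain n where n: "1 / real (Suc n) < e" using nat_approx_posE by blast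
      have "f x \<le> ennreal (c + 1 / real (Suc n))" using elim less_imp_le by blast
      also have "\<dots> \<le> ennreal c + ennreal e"
        using n real \<open>0 < e\<close> by (simp add: ennreal_plus[symmetric] del: ennreal_plus)
      finally show "f x \<le> ennreal c + ennreal e" .
    qed
  qed
qed simp

lemma ess_sup_cong: "AE x in M. f x = g x \<Longrightarrow> ess_sup M f = ess_sup M g"
  unfolding ess_sup_def by (rule Limsup_eq)

text \<open>The unit cube has measure 1, also when there are no other coordinates. On a trivial
  filter every essential supremum would be 0.\<close>

lemma other_coords_nontrivial: "ae_filter (other_coords i) \<noteq> bot"
proof -
  interpret product_sigma_finite "\<lambda>_::'n. lborel :: real measure" by (rule product_sigma_finite_lborel)
  have "emeasure (other_coords i) (\<Pi>\<^sub>E j\<in>UNIV - {i}. {0..1}) = 1"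
    unfolding other_coords_def by (subst emeasure_PiM) auto
  moreover have "emeasure (other_coords i) (\<Pi>\<^sub>E j\<in>UNIV - {i}. {0..1}) \<le> emeasure (other_coords i) (space (other_coords i))"
    by (rule emeasure_space)
  ultimately show ?thesis unfolding ae_filter_eq_bot_iff by auto
qed

text \<open>A Borel null set containing the exceptional set has vanishing iterated integral, so
  almost all of its sections are null.\<close>

lemma AE_slices:
  fixes P :: "real ^ 'n \<Rightarrow> bool"
  assumes "AE x in lborel. P x"
  shows "AE z in other_coords i. AE t in lborel. P (\<chi> j. if j = i then t else z j)"
proof -
  obtain N where N: "{x. \<not> P x} \<subseteq> N" "emeasure lborel N = 0" and Nm [measurable]: "N \<in> sets borel"
    using AE_E[OF assms] by auto
  have [measurable]: "(\<lambda>(z, t). z(i := t)) \<in> other_coords i \<Otimes>\<^sub>M lborel \<rightarrow>\<^sub>M PM"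
    unfolding split_beta' other_coords_def by (rule measurable_fun_upd[where J="UNIV - {i}"]) auto
  let ?I = "\<lambda>z. \<integral>\<^sup>+ t. indicator N (\<chi> j. (z(i := t)) j) \<partial>lborel"
  have I [measurable]: "?I \<in> borel_measurable (other_coords i)"
  proof -
    have "(\<lambda>z. \<integral>\<^sup>+ t. (\<lambda>(z, t). indicator N (\<chi> j. ((\<lambda>(z, t). z(i := t)) (z, t)) j)) (z, t) \<partial>lborel) \<in> borel_measurable (other_coords i)"
      by measurable
    then show ?thesis by simp
  qed
  have "0 = (\<integral>\<^sup>+ x. indicator N x \<partial>lborel)" using N by simp
  also have "\<dots> = (\<integral>\<^sup>+ z. indicator N (\<chi> j. z j) \<partial>PM)" by (rule nn_integral_vec) measurable
  also have "\<dots> = (\<integral>\<^sup>+ z. ?I z \<partial>other_coords i)" by (rule nn_integral_PM_slice) measurable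
  finally have "(\<integral>\<^sup>+ z. ?I z \<partial>other_coords i) = 0" by (rule sym)
  then have "AE z in other_coords i. ?I z = 0" by (simp only: nn_integral_0_iff_AE[OF I])
  then show ?thesis
  proof eventually_elim
    case (elim z)
    have [measurable]: "(\<lambda>t. \<chi> j. (z(i := t)) j) \<in> lborel \<rightarrow>\<^sub>M borel"
      using measurable_compose[OF measurable_slice measurable_vec_lambda] .
    from elim have "AE t in lborel. (indicator N (\<chi> j. (z(i := t)) j) :: ennreal) = 0"
      by (subst (asm) nn_integral_0_iff_AE) measurable
    then show ?case
      by eventually_elim (use N in \<open>auto simp: fun_upd_def indicator_def split: if_splits\<close>)
  qed
qed

lemma slice_fun_upd: "slice i z w t = w (\<chi> j. (z(i := t)) j)"
  by (simp add: slice_def fun_upd_def)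

lemma Ap1_plus_cong:
  assumes "AE t in lborel. v t = v' t"
  shows "Ap1_plus p v = Ap1_plus p v'"
proof -
  have "(\<integral>\<^sup>+ s\<in>A. ennreal (v s) \<partial>lborel) = (\<integral>\<^sup>+ s\<in>A. ennreal (v' s) \<partial>lborel)"
    "(\<integral>\<^sup>+ s\<in>A. ennreal (v s powr c) \<partial>lborel) = (\<integral>\<^sup>+ s\<in>A. ennreal (v' s powr c) \<partial>lborel)" for A c
    by (rule nn_integral_cong_AE, use assms in eventually_elim, simp)+
  then show ?thesis by (simp add: Ap1_plus_def nn_integral_lebesgue)
qed

text \<open>The two unit intervals adjacent to 0 already give a positive product. Positivity keeps
  an infinite characteristic in one variable from being cancelled by a zero factor in
  another.\<close>

lemma Ap1_plus_pos:
  assumes [measurable]: "v \<in> borel_measurable borel" and pos: "\<And>x. 0 < v x"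
  shows "0 < Ap1_plus p v"
proof -
  have "0 < ennreal (v x)" "0 < ennreal (v x powr c)" for x c using pos[of x] by simp_all
  then have "0 < mass (\<lambda>x. ennreal (v x)) (-1) 0" "0 < mass (\<lambda>x. ennreal (v x powr (1 - conj_exp p))) 0 1"
    by (rule_tac [!] mass_pos) simp_all
  then have "0 < mass (\<lambda>x. ennreal (v x)) (-1) 0 * ennpow (mass (\<lambda>x. ennreal (v x powr (1 - conj_exp p))) 0 1) (p - 1)"
    by (simp add: zero_less_iff_neq_zero)
  also have "\<dots> \<le> Ap1_plus p v"
    unfolding Ap1_plus_def mass_closed nn_integral_lebesgue
    using mult_divide_eq_ennreal[of 1] by (intro SUP_upper2[of "(0, 1)"]) auto
  finally show ?thesis .
qed

text \<open>A Borel function agreeing with \<open>w\<close> almost everywhere is positive almost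
  everywhere, so its other values can be replaced by 1. The one-dimensional bound is stated for such
  everywhere positive Borel weights.\<close>

lemma weight_borel_representative:
  assumes "weight w"
  obtains w' where "w' \<in> borel_measurable borel" "\<And>x. 0 < w' x" "AE x in lborel. w x = w' x"
proof -
  from assms have "w \<in> borel_measurable (completion lborel)" and pos: "AE x in lborel. 0 < w x"
    unfolding weight_def by (simp_all add: AE_completion_iff)
  then obtain g where [measurable]: "g \<in> borel_measurable lborel" and g: "AE x in lborel. w x = g x"
    using completion_ex_borel_measurable_real by blast
  have "AE x in lborel. w x = (if 0 < g x then g x else 1)"
    using pos g by eventually_elim auto
  then show ?thesis by (intro that[of "\<lambda>x. if 0 < g x then g x else 1"]) auto
qed

lemma Ap_char_plus_cong:
  assumes "AE x in lborel. w x = w' x"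
  shows "Ap_char_plus p i w = Ap_char_plus p i w'"
  unfolding Ap_char_plus_def
proof (rule ess_sup_cong)
  show "AE z in other_coords i. Ap1_plus p (slice i z w) = Ap1_plus p (slice i z w')"
    using AE_slices[OF assms, of i] by eventually_elim (auto intro!: Ap1_plus_cong simp: slice_def)
qed

lemma measurable_slice_borel:
  fixes w :: "real ^ 'n \<Rightarrow> real"
  assumes [measurable]: "w \<in> borel_measurable borel" shows "slice i z w \<in> borel_measurable borel"
proof -
  have "(\<lambda>t. w (\<chi> j. (z(i := t)) j)) \<in> borel_measurable lborel"
    using measurable_compose[OF measurable_compose[OF measurable_slice measurable_vec_lambda] assms] .
  then show ?thesis by (simp add: slice_fun_upd[abs_def])
qed

lemma Ap_char_plus_pos:
  fixes w :: "real ^ 'n \<Rightarrow> real"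
  assumes "w \<in> borel_measurable borel" and pos: "\<And>x. 0 < w x"
  shows "0 < Ap_char_plus p i w"
proof (rule ccontr)
  assume "\<not> 0 < Ap_char_plus p i w"
  then have 0: "Ap_char_plus p i w = 0" by simp
  have "AE z in other_coords i. Ap1_plus p (slice i z w) \<le> 0"
    using ess_sup_AE[where M="other_coords i" and f="\<lambda>z. Ap1_plus p (slice i z w)"] unfolding 0[unfolded Ap_char_plus_def] .
  then have "AE z in other_coords i. False"
  proof eventually_elim
    case (elim z)
    have "0 < Ap1_plus p (slice i z w)"
      using measurable_slice_borel[OF assms(1)] pos by (intro Ap1_plus_pos) (auto simp: slice_def)
    with elim show False by simp
  qed
  then show False using other_coords_nontrivial[of i] by (simp add: eventually_False)
qed

section \<open>The upper bound for the strong maximal operator\<close>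

lemma strong_max_plus_cong:
  assumes "AE x in lborel. f x = f' x"
  shows "strong_max_plus f = strong_max_plus f'"
proof -
  have "(\<integral>\<^sup>+ y\<in>A. ennreal \<bar>f y\<bar> \<partial>lborel) = (\<integral>\<^sup>+ y\<in>A. ennreal \<bar>f' y\<bar> \<partial>lborel)" for A
    by (rule nn_integral_cong_AE) (use assms in eventually_elim, simp)
  then show ?thesis by (simp add: fun_eq_iff strong_max_plus_def nn_integral_lebesgue)
qed

lemma strong_max_plus_AE_0:
  assumes "AE x in lborel. f x = 0"
  shows "strong_max_plus f x = 0"
proof -
  have "strong_max_plus f = strong_max_plus (\<lambda>_. 0)" by (rule strong_max_plus_cong) fact
  then show ?thesis by (simp add: strong_max_plus_def SUP_constant bot_ennreal)
qed

lemma Lp_norm_cong: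
  assumes "AE x in lborel. w x = w' x" "AE x in lborel. g x = g' x"
  shows "Lp_norm p w g = Lp_norm p w' g'"
proof -
  have "(\<integral>\<^sup>+ x. ennpow (g x) p * ennreal (w x) \<partial>lborel) = (\<integral>\<^sup>+ x. ennpow (g' x) p * ennreal (w' x) \<partial>lborel)"
    by (rule nn_integral_cong_AE) (use assms in eventually_elim, simp)
  then show ?thesis by (simp add: Lp_norm_def nn_integral_lebesgue)
qed

text \<open>Pointwise domination by the iterated directional operators bounds the p-th power of the
  norm; the p-th root turns each exponent p/(p-1) into 1/(p-1). The degenerate cases, where 0 or
  \<infinity> occurs as a factor, are separated first.\<close>

lemma strong_maximal_bound_borel:
  fixes w f :: "real ^ 'n \<Rightarrow> real"
  assumes p: "1 < p" and [measurable]: "w \<in> borel_measurable borel" "f \<in> borel_measurable borel" and pos: "\<And>x. 0 < w x"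
  shows "Lp_norm p w (strong_max_plus f) \<le> ennreal (max_const p powr (real CARD('n) / p)) *
    ennpow (\<Prod>i\<in>UNIV. Ap_char_plus p i w) (1 / (p - 1)) * Lp_norm p w (\<lambda>x. ennreal \<bar>f x\<bar>)"
proof -
  let ?c = "max_const p powr (real CARD('n) / p)"
  let ?F = "\<integral>\<^sup>+ x. ennpow (ennreal \<bar>f x\<bar>) p * ennreal (w x) \<partial>lborel"
  let ?P = "\<Prod>i\<in>UNIV. Ap_char_plus p i w"
  let ?N = "Lp_norm p w (\<lambda>x. ennreal \<bar>f x\<bar>)"
  have c: "0 < ?c" using max_const_pos[OF p] by simp
  have K0: "Ap_char_plus p i w \<noteq> 0" for i using Ap_char_plus_pos[OF assms(2) pos, of p i] by simp
  show ?thesis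
  proof (cases "?N = 0")
    case True
    then have "AE x in lborel. ennpow (ennreal \<bar>f x\<bar>) p * ennreal (w x) = 0"
      by (simp add: Lp_norm_def nn_integral_lebesgue nn_integral_0_iff_AE)
    then have "AE x in lborel. f x = 0"
      by eventually_elim (use pos in \<open>auto simp: ennreal_eq_0_iff not_le[symmetric]\<close>)
    from strong_max_plus_AE_0[OF this] have "Lp_norm p w (strong_max_plus f) = 0"
      by (simp add: Lp_norm_def nn_integral_lebesgue)
    then show ?thesis by simp
  next
    case N0: False
    show ?thesis
    proof (cases "\<exists>i. Ap_char_plus p i w = top")
      case True
      \<comment> \<open>All characteristics are nonzero, so one infinite factor makes the product
        infinite. The norm of f is nonzero in this branch, hence the right-hand side is infinite
        despite the convention that 0 times \<infinity> is 0.\<close>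
      then have "?P = top" using K0 by (auto simp: ennreal_prod_eq_top)
      then show ?thesis using c N0 by (simp add: ennreal_mult_top ennreal_top_mult)
    next
      case False
      define K where "K i = enn2real (Ap_char_plus p i w)" for i
      let ?k = "\<lambda>i. ennreal (max_const p * K i powr (p / (p - 1)))"
      have K: "Ap_char_plus p i w = ennreal (K i)" for i using False by (simp add: K_def less_top)
      have Kpos: "0 < K i" for i using K0[of i] K[of i] ennreal_neg[of "K i"] by (metis not_le less_imp_le order_refl)
      obtain "is" :: "'n list" where "is": "distinct is" "set is = UNIV"
        using finite_distinct_list[of "UNIV :: 'n set"] by auto
      let ?W = "\<lambda>z. w (\<chi> i. z i)" and ?G = "\<lambda>z. ennreal \<bar>f (\<chi> i. z i)\<bar>"
      have Ap: "AE z in other_coords i. Ap1_plus p (\<lambda>t. ?W (z(i := t))) \<le> ennreal (K i)" for i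
        using ess_sup_AE[where M="other_coords i" and f="\<lambda>z. Ap1_plus p (slice i z w)"]
        unfolding Ap_char_plus_def[symmetric] K unfolding slice_fun_upd[abs_def] .
      have proj [measurable]: "(\<lambda>x::real^'n. (\<lambda>i. x $ i)) \<in> borel \<rightarrow>\<^sub>M PM"
        by (rule measurable_PiM_single') auto
      have [measurable]: "(\<lambda>x. foldr dmax is ?G (\<lambda>i. x $ i)) \<in> borel_measurable borel"
        using measurable_compose[OF proj measurable_foldr_dmax[of ?G "is"]] by simp
      have "(\<integral>\<^sup>+ x. ennpow (strong_max_plus f x) p * ennreal (w x) \<partial>lborel) \<le>
        (\<integral>\<^sup>+ x. ennpow (foldr dmax is ?G (\<lambda>i. x $ i)) p * ennreal (w x) \<partial>lborel)"
        using p "is" by (intro nn_integral_mono mult_right_mono ennpow_mono strong_max_plus_le) auto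
      also have "\<dots> = (\<integral>\<^sup>+ z. ennpow (foldr dmax is ?G z) p * ennreal (?W z) \<partial>PM)"
      proof -
        have "($) (vec_lambda z) = z" for z :: "'n \<Rightarrow> real" by (simp add: fun_eq_iff)
        then show ?thesis by (subst nn_integral_vec) simp_all
      qed
      also have "\<dots> \<le> (\<Prod>i\<leftarrow>is. ?k i) * (\<integral>\<^sup>+ z. ennpow (?G z) p * ennreal (?W z) \<partial>PM)"
        by (rule foldr_dmax_bound[OF p _ _ pos Kpos Ap]) measurable
      also have "(\<Prod>i\<leftarrow>is. ?k i) = (\<Prod>i\<in>UNIV. ?k i)"
        using "is" by (simp add: prod.distinct_set_conv_list[symmetric])
      also have "\<dots> = ennreal (max_const p ^ CARD('n)) * ennpow ?P (p / (p - 1))"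
        using p max_const_pos[OF p] Kpos
        by (simp add: ennpow_prod K ennpow_ennreal less_imp_le ennreal_mult prod.distrib ennreal_power)
      also have "(\<integral>\<^sup>+ z. ennpow (?G z) p * ennreal (?W z) \<partial>PM) = ?F"
        by (subst nn_integral_vec) simp_all
      finally have "ennpow (\<integral>\<^sup>+ x. ennpow (strong_max_plus f x) p * ennreal (w x) \<partial>lborel) (1 / p) \<le>
        ennpow (ennreal (max_const p ^ CARD('n)) * ennpow ?P (p / (p - 1)) * ?F) (1 / p)"
        using p by (intro ennpow_mono) auto
      also have "\<dots> = ennpow (ennreal (max_const p ^ CARD('n))) (1 / p) * ennpow ?P (p / (p - 1) * (1 / p)) *
        ennpow ?F (1 / p)"
        using p by (simp add: ennpow_mult ennpow_ennpow)
      also have "ennpow (ennreal (max_const p ^ CARD('n))) (1 / p) = ennreal ?c"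
        using max_const_pos[OF p] by (simp add: ennpow_ennreal powr_realpow[symmetric] powr_powr)
      also have "p / (p - 1) * (1 / p) = 1 / (p - 1)" using p by simp
      finally show ?thesis by (simp add: Lp_norm_def nn_integral_lebesgue)
    qed
  qed
qed

text \<open>Borel representatives of \<open>w\<close> and \<open>f\<close> leave the norms and the
  characteristics unchanged, and also the maximal function, which sees \<open>f\<close> only through
  integrals.\<close>

lemma strong_maximal_bound:
  fixes w f :: "real ^ 'n \<Rightarrow> real"
  assumes p: "1 < p" and w: "weight w" and f: "f \<in> borel_measurable lebesgue"
  shows "Lp_norm p w (strong_max_plus f) \<le> ennreal (max_const p powr (real CARD('n) / p)) *
    ennpow (\<Prod>i\<in>UNIV. Ap_char_plus p i w) (1 / (p - 1)) * Lp_norm p w (\<lambda>x. ennreal \<bar>f x\<bar>)"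
proof -
  obtain w' where w': "w' \<in> borel_measurable borel" "\<And>x. 0 < w' x" "AE x in lborel. w x = w' x"
    using weight_borel_representative[OF w] by metis
  obtain f' where f': "f' \<in> borel_measurable lborel" "AE x in lborel. f x = f' x"
    using completion_ex_borel_measurable_real[OF f] by blast
  have "Lp_norm p w (strong_max_plus f) = Lp_norm p w' (strong_max_plus f')"
    using strong_max_plus_cong[OF f'(2)] w'(3) by (intro Lp_norm_cong) auto
  moreover have "Lp_norm p w (\<lambda>x. ennreal \<bar>f x\<bar>) = Lp_norm p w' (\<lambda>x. ennreal \<bar>f' x\<bar>)"
    by (intro Lp_norm_cong w'(3)) (use f'(2) in eventually_elim, simp)
  ultimately show ?thesis
    using strong_maximal_bound_borel[OF p w'(1) _ w'(2), of f'] f'(1) by (simp add: Ap_char_plus_cong[OF w'(3)])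
qed

section \<open>Power weights\<close>

lemma nn_integral_prod_vec:
  fixes \<phi> :: "'n::finite \<Rightarrow> real \<Rightarrow> ennreal"
  assumes [measurable]: "\<And>i. \<phi> i \<in> borel_measurable borel"
  shows "(\<integral>\<^sup>+ x. (\<Prod>i\<in>UNIV. \<phi> i (x $ i)) \<partial>lborel) = (\<Prod>i\<in>UNIV. \<integral>\<^sup>+ t. \<phi> i t \<partial>lborel)"
proof -
  interpret product_sigma_finite "\<lambda>_::'n. lborel :: real measure" by (rule product_sigma_finite_lborel)
  have "(\<integral>\<^sup>+ x. (\<Prod>i\<in>UNIV. \<phi> i (x $ i)) \<partial>lborel) = (\<integral>\<^sup>+ z. (\<Prod>i\<in>UNIV. \<phi> i (z i)) \<partial>PM)"
    by (subst nn_integral_vec) simp_all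
  also have "\<dots> = (\<Prod>i\<in>UNIV. \<integral>\<^sup>+ t. \<phi> i t \<partial>lborel)"
    by (rule product_nn_integral_prod) auto
  finally show ?thesis .
qed

lemma nn_integral_prod_cbox:
  fixes a b :: "real ^ 'n" and \<phi> :: "real \<Rightarrow> ennreal"
  assumes [measurable]: "\<phi> \<in> borel_measurable borel"
  shows "(\<integral>\<^sup>+ x\<in>cbox a b. (\<Prod>i\<in>UNIV. \<phi> (x $ i)) \<partial>lborel) = (\<Prod>i\<in>UNIV. mass \<phi> (a $ i) (b $ i))"
proof -
  have "(\<integral>\<^sup>+ x\<in>cbox a b. (\<Prod>i\<in>UNIV. \<phi> (x $ i)) \<partial>lborel) =
    (\<integral>\<^sup>+ x. (\<Prod>i\<in>UNIV. \<phi> (x $ i) * indicator {a $ i..b $ i} (x $ i)) \<partial>lborel)"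
  proof (rule nn_integral_cong)
    fix x :: "real ^ 'n"
    have "(indicator (cbox a b) x :: ennreal) = (\<Prod>j\<in>UNIV. indicator {a $ j..b $ j} (x $ j))"
      by (cases "\<forall>j. x $ j \<in> {a $ j..b $ j}")
        (auto simp: mem_box_cart indicator_def prod_zero_iff)
    then show "(\<Prod>i\<in>UNIV. \<phi> (x $ i)) * indicator (cbox a b) x = (\<Prod>i\<in>UNIV. \<phi> (x $ i) * indicator {a $ i..b $ i} (x $ i))"
      by (simp add: prod.distrib)
  qed
  also have "\<dots> = (\<Prod>i\<in>UNIV. mass \<phi> (a $ i) (b $ i))"
    unfolding mass_closed by (rule nn_integral_prod_vec) measurable
  finally show ?thesis .
qed

lemma prod_divide_vol:
  assumes "pos_vec h"
  shows "(\<Prod>i\<in>UNIV. A i) / vol h = (\<Prod>i\<in>UNIV. A i / ennreal (h $ i))"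
proof -
  have h: "0 < h $ i" for i using assms by (simp add: pos_vec_def)
  have "(\<Prod>i\<in>UNIV. A i) = (\<Prod>i\<in>UNIV. ennreal (h $ i) * (A i / ennreal (h $ i)))"
    using h by (simp add: ennreal_times_divide_cancel)
  also have "\<dots> = (\<Prod>i\<in>UNIV. A i / ennreal (h $ i)) * vol h"
    using h by (simp add: prod.distrib vol_def prod_ennreal less_imp_le mult.commute)
  finally show ?thesis
    using h by (simp add: vol_def mult_divide_eq_ennreal prod_pos less_imp_le order.strict_implies_not_eq[symmetric] prod_zero_iff)
qed

lemma mass_le_const:
  assumes "\<And>x. a < x \<Longrightarrow> x < b \<Longrightarrow> \<phi> x \<le> c" "a \<le> b"
  shows "mass \<phi> a b \<le> c * ennreal (b - a)"
proof -
  have "mass \<phi> a b \<le> (\<integral>\<^sup>+ x\<in>{a<..<b}. c \<partial>lborel)"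
    unfolding mass_def using assms by (intro nn_integral_mono) (auto simp: indicator_def)
  then show ?thesis using assms by (simp add: nn_integral_cmult)
qed

lemma mass_ge_const:
  assumes "\<And>x. a < x \<Longrightarrow> x < b \<Longrightarrow> c \<le> \<phi> x" "a \<le> b"
  shows "c * ennreal (b - a) \<le> mass \<phi> a b"
proof -
  have "(\<integral>\<^sup>+ x\<in>{a<..<b}. c \<partial>lborel) \<le> mass \<phi> a b"
    unfolding mass_def using assms by (intro nn_integral_mono) (auto simp: indicator_def)
  then show ?thesis using assms by (simp add: nn_integral_cmult)
qed

lemma mass_reflect:
  assumes [measurable]: "\<phi> \<in> borel_measurable borel"
  shows "mass (\<lambda>x. \<phi> (- x)) a b = mass \<phi> (- b) (- a)"
proof -
  have "mass \<phi> (- b) (- a) = (\<integral>\<^sup>+ x. \<phi> (0 + (-1) * x) * indicator {- b<..<- a} (0 + (-1) * x) \<partial>lborel)"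
    unfolding mass_def by (subst nn_integral_real_affine[of _ "-1" 0]) auto
  also have "\<dots> = mass (\<lambda>x. \<phi> (- x)) a b"
    unfolding mass_def by (intro nn_integral_cong) (auto simp: indicator_def)
  finally show ?thesis by simp
qed

lemma mass_power_right:
  fixes \<delta> b :: real
  assumes "0 < \<delta>" "0 \<le> b"
  shows "mass (\<lambda>x. ennreal (\<bar>x\<bar> powr (\<delta> - 1))) 0 b = ennreal (b powr \<delta> / \<delta>)"
proof -
  have "mass (\<lambda>x. ennreal (\<bar>x\<bar> powr (\<delta> - 1))) 0 b = (\<integral>\<^sup>+ x\<in>{0..b}. ennreal (x powr (\<delta> - 1)) \<partial>lborel)"
    unfolding mass_closed by (intro nn_integral_cong) (auto simp: indicator_def)
  also have "\<dots> = ennreal (b powr \<delta> / \<delta>)"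
    using has_integral_powr_from_0[of "\<delta> - 1" b] assms by (intro nn_integral_has_integral_lebesgue') auto
  finally show ?thesis .
qed

lemma mass_power_left:
  fixes \<delta> b :: real
  assumes "0 < \<delta>" "0 \<le> b"
  shows "mass (\<lambda>x. ennreal (\<bar>x\<bar> powr (\<delta> - 1))) (- b) 0 = ennreal (b powr \<delta> / \<delta>)"
  using mass_power_right[OF assms] mass_reflect[of "\<lambda>x. ennreal (\<bar>x\<bar> powr (\<delta> - 1))" 0 b] by simp

lemma AE_coordinates_nonzero: "AE x in lborel. \<forall>i. (x :: real ^ 'n) $ i \<noteq> 0"
proof -
  have "AE x in lborel. (x :: real ^ 'n) $ i \<noteq> 0" for i
  proof -
    have "axis i 1 \<in> (Basis :: (real ^ 'n) set)" by (auto simp: Basis_vec_def)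
    then have "negligible {x :: real ^ 'n. x \<bullet> axis i 1 = 0}" by (rule negligible_standard_hyperplane)
    then have "{x :: real ^ 'n. x $ i = 0} \<in> null_sets lebesgue"
      unfolding negligible_iff_null_sets inner_axis by simp
    then have "AE x in lebesgue. (x :: real ^ 'n) $ i \<noteq> 0"
      by (auto dest: AE_not_in)
    then show ?thesis by (simp add: AE_completion_iff)
  qed
  then show ?thesis by (simp add: AE_all_countable)
qed

text \<open>A constant factor enters once with power 1 and once with total power (1-p')(p-1) = -1,
  and so cancels. Slices of a product weight are constant multiples of one factor.\<close>

lemma Ap1_plus_scale:
  assumes [measurable]: "v \<in> borel_measurable borel" and v: "\<And>t. 0 \<le> v t" and c: "0 < c" and p: "1 < p"
  shows "Ap1_plus p (\<lambda>t. c * v t) = Ap1_plus p v"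
proof -
  have 1: "mass (\<lambda>t. ennreal (c * v t)) a b = ennreal c * mass (\<lambda>t. ennreal (v t)) a b" for a b
    unfolding mass_def using c v by (simp add: ennreal_mult mult.assoc nn_integral_cmult)
  have 2: "mass (\<lambda>t. ennreal ((c * v t) powr e)) a b = ennreal (c powr e) * mass (\<lambda>t. ennreal (v t powr e)) a b" for a b e
    unfolding mass_def using c v by (simp add: powr_mult ennreal_mult mult.assoc nn_integral_cmult)
  have e: "(1 - conj_exp p) * (p - 1) = - 1" using p by (simp add: conj_exp_def field_simps)
  have c1: "ennreal c * ennreal (c powr ((1 - conj_exp p) * (p - 1))) = 1"
    unfolding e using c by (simp add: ennreal_mult[symmetric] powr_minus)
  have "(ennreal c * X / Y) * ennpow (ennreal (c powr (1 - conj_exp p)) * Z / Y) (p - 1) = X / Y * ennpow (Z / Y) (p - 1)" for X Y Z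
  proof -
    have "(ennreal c * X / Y) * ennpow (ennreal (c powr (1 - conj_exp p)) * Z / Y) (p - 1) =
      (ennreal c * ennreal (c powr ((1 - conj_exp p) * (p - 1)))) * (X / Y * ennpow (Z / Y) (p - 1))"
      unfolding ennreal_times_divide[symmetric] using p by (simp add: ennpow_mult ennpow_ennreal powr_powr ac_simps)
    then show ?thesis unfolding c1 by simp
  qed
  then show ?thesis
    unfolding Ap1_plus_def nn_integral_lebesgue mass_closed[symmetric] 1 2 by simp
qed

section \<open>The extremal power weight and test function\<close>

locale power_weight =
  fixes p \<delta> :: real
  assumes p: "1 < p" and \<delta>: "0 < \<delta>" "\<delta> < 1"
begin

text \<open>The exponent for which u^(1-p') is |t|^(\<delta>-1), whose mass b^\<delta>/\<delta> on
  (0, b) blows up as \<delta> tends to 0.\<close>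

definition \<alpha> :: real where "\<alpha> = (1 - \<delta>) * (p - 1)"

definition u :: "real \<Rightarrow> real" where "u t = \<bar>t\<bar> powr \<alpha>"

lemma \<alpha>_pos: "0 < \<alpha>" using p \<delta> by (simp add: \<alpha>_def)

lemma u_nonneg: "0 \<le> u t" by (simp add: u_def)

lemma u_pos: "t \<noteq> 0 \<Longrightarrow> 0 < u t" by (simp add: u_def)

lemma measurable_u [measurable]: "u \<in> borel_measurable borel"
  unfolding u_def by measurable

lemma u_dual: "u t powr (1 - conj_exp p) = \<bar>t\<bar> powr (\<delta> - 1)"
proof -
  have "\<alpha> * (1 - conj_exp p) = \<delta> - 1" using p by (simp add: \<alpha>_def conj_exp_def field_simps)
  then show ?thesis by (simp add: u_def powr_powr)
qed

abbreviation U :: "real \<Rightarrow> real \<Rightarrow> ennreal" where "U \<equiv> mass (\<lambda>t. ennreal (u t))"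
abbreviation D :: "real \<Rightarrow> real \<Rightarrow> ennreal" where "D \<equiv> mass (\<lambda>t. ennreal (\<bar>t\<bar> powr (\<delta> - 1)))"

lemma Ap1_plus_u: "Ap1_plus p u = (SUP (t, h)\<in>UNIV \<times> {0<..}. (U (t - h) t / ennreal h) * ennpow (D t (t + h) / ennreal h) (p - 1))"
  unfolding Ap1_plus_def nn_integral_lebesgue mass_closed u_dual ..

lemma Ap1_plus_u_le: "Ap1_plus p u \<le> ennreal ((6 / \<delta>) powr (p - 1))"
  unfolding Ap1_plus_u
proof (rule SUP_least, clarify)
  fix t h :: real assume h: "0 < h"
  let ?X = "(U (t - h) t / ennreal h) * ennpow (D t (t + h) / ennreal h) (p - 1)"
  \<comment> \<open>\<open>M\<close> bounds |x| on the left interval and \<open>Q\<close> the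
    average of u^(1-p') on the right one; the product is then at most (M^(1-\<delta>) Q)^(p-1). If
    |t| \<le> 2h, both intervals lie in [-3h, 3h]. Otherwise |x| stays between |t|/2 and
    3|t|/2.\<close>
  obtain M Q where MQ: "0 < M" "0 \<le> Q" "M powr (1 - \<delta>) * Q \<le> 6 / \<delta>"
    "\<And>x. t - h < x \<Longrightarrow> x < t \<Longrightarrow> \<bar>x\<bar> \<le> M" "D t (t + h) \<le> ennreal (Q * h)"
  proof (cases "\<bar>t\<bar> \<le> 2 * h")
    case True
    let ?Q = "2 * ((3 * h) powr \<delta> / \<delta>) / h"
    have "D t (t + h) \<le> D (- (3 * h)) (3 * h)" using True h by (intro mass_mono) auto
    also have "\<dots> = D (- (3 * h)) 0 + D 0 (3 * h)" using h by (intro mass_add) auto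
    also have "\<dots> = ennreal (?Q * h)"
      using h \<delta> by (simp add: mass_power_left mass_power_right ennreal_plus[symmetric] del: ennreal_plus)
    finally have D: "D t (t + h) \<le> ennreal (?Q * h)" .
    have "(3 * h) powr (1 - \<delta>) * (3 * h) powr \<delta> = 3 * h" using h by (simp add: powr_add[symmetric])
    then have "(3 * h) powr (1 - \<delta>) * ?Q = 6 / \<delta>" using h \<delta> by (simp add: field_simps)
    then show ?thesis using D True h \<delta> by (intro that[of "3 * h" ?Q]) auto
  next
    case False
    let ?Q = "(\<bar>t\<bar> / 2) powr (\<delta> - 1)"
    have "D t (t + h) \<le> ennreal ?Q * ennreal (t + h - t)"
      using False h \<delta> by (intro mass_le_const ennreal_leI powr_mono2') auto
    then have D: "D t (t + h) \<le> ennreal (?Q * h)" using h by (simp add: ennreal_mult)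
    have "(3 * \<bar>t\<bar> / 2) powr (1 - \<delta>) * ?Q = (3 * (\<bar>t\<bar> / 2)) powr (1 - \<delta>) * (\<bar>t\<bar> / 2) powr (- (1 - \<delta>))" by simp
    also have "\<dots> = 3 powr (1 - \<delta>) * ((\<bar>t\<bar> / 2) powr (1 - \<delta>) * (\<bar>t\<bar> / 2) powr (- (1 - \<delta>)))"
      unfolding powr_mult by simp
    also have "(\<bar>t\<bar> / 2) powr (1 - \<delta>) * (\<bar>t\<bar> / 2) powr (- (1 - \<delta>)) = 1"
      using False h unfolding powr_add[symmetric] by simp
    also have "3 powr (1 - \<delta>) * 1 \<le> (3 powr 1 :: real)"
      using \<delta> powr_mono[of "1 - \<delta>" 1 3] by linarith
    also have "\<dots> \<le> 6 / \<delta>" using \<delta> by (simp add: field_simps)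
    finally have "(3 * \<bar>t\<bar> / 2) powr (1 - \<delta>) * ?Q \<le> 6 / \<delta>" .
    then show ?thesis using D False h by (intro that[of "3 * \<bar>t\<bar> / 2" ?Q]) auto
  qed
  have "U (t - h) t \<le> ennreal (M powr \<alpha>) * ennreal (t - (t - h))"
    using MQ(4) h \<alpha>_pos unfolding u_def by (intro mass_le_const ennreal_leI powr_mono2) auto
  then have "U (t - h) t / ennreal h \<le> ennreal (M powr \<alpha>)"
    using h by (intro divide_le_posI_ennreal) (auto simp: mult.commute)
  moreover have "D t (t + h) / ennreal h \<le> ennreal Q"
    using h MQ by (intro divide_le_posI_ennreal) (auto simp: ennreal_mult mult.commute)
  then have "ennpow (D t (t + h) / ennreal h) (p - 1) \<le> ennreal (Q powr (p - 1))"
    using p MQ ennpow_mono[of _ "ennreal Q" "p - 1"] by (simp add: ennpow_ennreal)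
  ultimately have "?X \<le> ennreal (M powr \<alpha>) * ennreal (Q powr (p - 1))"
    by (intro mult_mono) auto
  also have "\<dots> = ennreal ((M powr (1 - \<delta>) * Q) powr (p - 1))"
    by (simp add: ennreal_mult[symmetric] powr_mult powr_powr \<alpha>_def)
  also have "\<dots> \<le> ennreal ((6 / \<delta>) powr (p - 1))"
    using MQ p by (intro ennreal_leI powr_mono2) auto
  finally show "?X \<le> ennreal ((6 / \<delta>) powr (p - 1))" .
qed

text \<open>Far from the origin \<open>u\<close> is nearly constant on adjacent unit intervals: at t
  = 2n+1 the product is at least (n/(n+1))^\<alpha>, which tends to 1. The bound places the product
  of the characteristics in the range [1, \<infinity>) where \<psi> is controlled.\<close>

lemma Ap1_plus_u_ge: "1 \<le> Ap1_plus p u"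
proof -
  have le: "ennreal ((real n / real (Suc n)) powr \<alpha>) \<le> Ap1_plus p u" if n: "1 \<le> n" for n
  proof -
    let ?t = "2 * real n + 1"
    have "ennreal ((2 * real n) powr \<alpha>) * ennreal (?t - (?t - 1)) \<le> U (?t - 1) ?t"
      unfolding u_def using \<alpha>_pos by (intro mass_ge_const ennreal_leI powr_mono2) auto
    moreover have "ennreal ((?t + 1) powr (\<delta> - 1)) * ennreal (?t + 1 - ?t) \<le> D ?t (?t + 1)"
      using \<delta> n by (intro mass_ge_const ennreal_leI powr_mono2') auto
    then have "ennpow (ennreal ((?t + 1) powr (\<delta> - 1))) (p - 1) \<le> ennpow (D ?t (?t + 1)) (p - 1)"
      using p by (intro ennpow_mono) auto
    ultimately have "ennreal ((2 * real n) powr \<alpha>) * ennreal (((?t + 1) powr (\<delta> - 1)) powr (p - 1)) \<le>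
      U (?t - 1) ?t * ennpow (D ?t (?t + 1)) (p - 1)"
      by (intro mult_mono) (auto simp: ennpow_ennreal)
    also have "\<dots> \<le> Ap1_plus p u"
      unfolding Ap1_plus_u using mult_divide_eq_ennreal[of 1] by (intro SUP_upper2[of "(?t, 1)"]) auto
    also have "ennreal ((2 * real n) powr \<alpha>) * ennreal (((?t + 1) powr (\<delta> - 1)) powr (p - 1)) = ennreal ((real n / real (Suc n)) powr \<alpha>)"
    proof -
      have e: "(\<delta> - 1) * (p - 1) = - \<alpha>" by (simp add: \<alpha>_def algebra_simps)
      have 1: "((?t + 1) powr (\<delta> - 1)) powr (p - 1) = 1 / (?t + 1) powr \<alpha>"
        unfolding powr_powr e by (rule powr_minus_divide)
      have 2: "real n / real (Suc n) = (2 * real n) / (?t + 1)" by (simp add: field_simps)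
      show ?thesis unfolding 1 2 powr_divide by (simp add: ennreal_mult[symmetric])
    qed
    finally show ?thesis .
  qed
  have "(\<lambda>n. (real n / real (Suc n)) powr \<alpha>) \<longlonglongrightarrow> 1 powr \<alpha>"
    by (intro tendsto_powr LIMSEQ_n_over_Suc_n tendsto_const) simp
  then have "(\<lambda>n. ennreal ((real n / real (Suc n)) powr \<alpha>)) \<longlonglongrightarrow> ennreal 1"
    by (intro tendsto_ennrealI) simp
  then have "ennreal 1 \<le> Ap1_plus p u"
    by (rule LIMSEQ_le_const2) (use le in blast)
  then show ?thesis by simp
qed

definition w :: "real ^ 'n \<Rightarrow> real" where "w x = (\<Prod>i\<in>UNIV. u (x $ i))"

lemma w_pos: "(\<And>i. x $ i \<noteq> 0) \<Longrightarrow> 0 < w x"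
  unfolding w_def by (intro prod_pos) (auto intro: u_pos)

lemma continuous_w: "continuous_on S w"
  unfolding w_def u_def using \<alpha>_pos by (intro continuous_intros continuous_on_powr') auto

lemma measurable_w [measurable]: "w \<in> borel_measurable borel"
  using continuous_w by (rule borel_measurable_continuous_onI)

lemma ennreal_w: "ennreal (w x) = (\<Prod>i\<in>UNIV. ennreal (u (x $ i)))"
  by (simp add: w_def prod_ennreal u_nonneg)

lemma ennreal_w_dual: "ennreal (w x powr (1 - conj_exp p)) = (\<Prod>i\<in>UNIV. ennreal (\<bar>x $ i\<bar> powr (\<delta> - 1)))"
  by (simp add: w_def prod_powr_distrib u_nonneg u_dual prod_ennreal)

lemma weight_w: "weight (w :: real ^ 'n \<Rightarrow> real)"
  unfolding weight_def
proof (intro conjI allI impI)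
  show "w \<in> borel_measurable lebesgue" by (simp add: measurable_completion)
  show "AE x in lebesgue. 0 < w (x :: real ^ 'n)"
    unfolding AE_completion_iff using AE_coordinates_nonzero by eventually_elim (rule w_pos, simp)
  fix K :: "(real ^ 'n) set" assume K: "compact K"
  have "integrable lborel (\<lambda>x. indicator K x *\<^sub>R w x)"
    by (rule borel_integrable_compact[OF K continuous_w])
  then show "set_integrable lebesgue K w"
    unfolding set_integrable_def using K by (subst integrable_completion) (auto dest: borel_compact)
qed

lemma Ap_char_plus_w: "Ap_char_plus p i (w :: real ^ 'n \<Rightarrow> real) = Ap1_plus p u"
proof -
  have "AE z in other_coords i. Ap1_plus p (slice i z (w :: real ^ 'n \<Rightarrow> real)) = Ap1_plus p u"
    using AE_slices[OF AE_coordinates_nonzero, of i]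
  proof eventually_elim
    case (elim z)
    \<comment> \<open>If z j were 0, then almost no t could have all coordinates nonzero, but almost
      every t does.\<close>
    have nz: "z j \<noteq> 0" if "j \<noteq> i" for j
    proof
      assume "z j = 0"
      from elim have "AE t::real in lborel. False"
        by eventually_elim (use that \<open>z j = 0\<close> in \<open>auto dest!: spec[of _ j]\<close>)
      then show False using ae_filter_eq_bot_iff[of "lborel :: real measure"] by (simp add: eventually_False)
    qed
    have c: "0 < (\<Prod>j\<in>UNIV - {i}. u (z j))" by (intro prod_pos) (use nz u_pos in auto)
    have s: "slice i z (w :: real ^ 'n \<Rightarrow> real) = (\<lambda>t. (\<Prod>j\<in>UNIV - {i}. u (z j)) * u t)"
      by (auto simp: slice_def w_def fun_eq_iff prod.remove[of UNIV i] intro!: arg_cong2[where f="(*)"] prod.cong)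
    show ?case unfolding s by (rule Ap1_plus_scale[OF measurable_u u_nonneg c p])
  qed
  then have "Ap_char_plus p i (w :: real ^ 'n \<Rightarrow> real) = ess_sup (other_coords i) (\<lambda>_. Ap1_plus p u)"
    unfolding Ap_char_plus_def by (rule ess_sup_cong)
  then show ?thesis by (simp add: ess_sup_def Limsup_const other_coords_nontrivial)
qed

text \<open>Weight and boxes are products, so the averages factor over the coordinates and each
  factor is bounded by the one-dimensional characteristic.\<close>

lemma w_Ap_strong_plus: "(w :: real ^ 'n \<Rightarrow> real) \<in> Ap_strong_plus p"
proof -
  let ?F = "\<lambda>(x :: real ^ 'n, h). ((\<integral>\<^sup>+ y\<in>box_minus x h. ennreal (w y) \<partial>lborel) / vol h) *
      ennpow ((\<integral>\<^sup>+ y\<in>box_plus x h. ennreal (w y powr (1 - conj_exp p)) \<partial>lborel) / vol h) (p - 1)"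
  have "?F (x, h) \<le> Ap1_plus p u ^ CARD('n)" if h: "pos_vec h" for x h
  proof -
    from h have h': "0 < h $ i" for i by (simp add: pos_vec_def)
    let ?A = "\<lambda>i. (U (x $ i - h $ i) (x $ i) / ennreal (h $ i)) * ennpow (D (x $ i) (x $ i + h $ i) / ennreal (h $ i)) (p - 1)"
    have "?F (x, h) = (\<Prod>i\<in>UNIV. ?A i)"
      unfolding ennreal_w ennreal_w_dual box_minus_def box_plus_def
      using p by (simp add: nn_integral_prod_cbox[of "\<lambda>t. ennreal (u t)"]
        nn_integral_prod_cbox[of "\<lambda>t. ennreal (\<bar>t\<bar> powr (\<delta> - 1))"] prod_divide_vol[OF h] ennpow_prod prod.distrib)
    also have "\<dots> \<le> (\<Prod>i\<in>(UNIV::'n set). Ap1_plus p u)"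
      unfolding Ap1_plus_u using h' by (intro prod_mono_ennreal SUP_upper2[of "(x $ _, h $ _)"]) auto
    finally show ?thesis by simp
  qed
  then have "(SUP z\<in>{(x, h). pos_vec h}. ?F z) \<le> Ap1_plus p u ^ CARD('n)" by (intro SUP_least) blast
  also have "\<dots> < \<infinity>"
    using le_less_trans[OF Ap1_plus_u_le, of top] by (simp add: power_less_top_ennreal)
  finally show ?thesis by (simp add: Ap_strong_plus_def nn_integral_lebesgue weight_w)
qed

text \<open>On (-1, 0) this is u^(1-p'), and g^p u = g there. Norm and averages of the test function
  thus reduce to masses of |t|^(\<delta>-1).\<close>

definition g :: "real \<Rightarrow> real" where "g t = (if - 1 < t \<and> t < 0 then \<bar>t\<bar> powr (\<delta> - 1) else 0)"

lemma g_nonneg: "0 \<le> g t" by (simp add: g_def)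

lemma measurable_g [measurable]: "g \<in> borel_measurable borel"
  unfolding g_def by measurable

definition f :: "real ^ 'n \<Rightarrow> real" where "f x = (\<Prod>i\<in>UNIV. g (x $ i))"

lemma f_nonneg: "0 \<le> f x" unfolding f_def by (intro prod_nonneg) (auto simp: g_nonneg)

lemma ennreal_f: "ennreal \<bar>f x\<bar> = (\<Prod>i\<in>UNIV. ennreal (g (x $ i)))"
  using f_nonneg[of x] by (simp add: f_def prod_ennreal g_nonneg)

lemma measurable_f [measurable]: "f \<in> borel_measurable borel"
  unfolding f_def by measurable

lemma Lp_norm_f: "Lp_norm p w (\<lambda>x :: real ^ 'n. ennreal \<bar>f x\<bar>) = ennreal (((1 / \<delta>) ^ CARD('n)) powr (1 / p))"
proof -
  have gu: "ennpow (ennreal (g t)) p * ennreal (u t) = ennreal (\<bar>t\<bar> powr (\<delta> - 1)) * indicator {-1<..<0} t" for t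
  proof (cases "- 1 < t \<and> t < 0")
    case True
    have "(\<delta> - 1) * p + \<alpha> = \<delta> - 1" by (simp add: \<alpha>_def algebra_simps)
    then show ?thesis
      using True by (simp add: g_def u_def ennpow_ennreal ennreal_mult[symmetric] powr_powr powr_add[symmetric])
  qed (auto simp: g_def)
  have "(\<integral>\<^sup>+ (x :: real ^ 'n). ennpow (ennreal \<bar>f x\<bar>) p * ennreal (w x) \<partial>lborel) =
    (\<integral>\<^sup>+ (x :: real ^ 'n). (\<Prod>i\<in>UNIV. ennpow (ennreal (g (x $ i))) p * ennreal (u (x $ i))) \<partial>lborel)"
    using p by (simp add: ennreal_f ennreal_w ennpow_prod prod.distrib)
  also have "\<dots> = (\<Prod>i\<in>(UNIV::'n set). D (-1) 0)"
    unfolding gu mass_def by (rule nn_integral_prod_vec) measurable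
  also have "\<dots> = ennreal ((1 / \<delta>) ^ CARD('n))"
    using mass_power_left[of \<delta> 1] \<delta> by (simp add: ennreal_power)
  finally show ?thesis
    using \<delta> by (simp add: Lp_norm_def nn_integral_lebesgue ennpow_ennreal)
qed

text \<open>The box from x to the origin, with side vector -x, is tested: in each coordinate the
  average of \<open>g\<close> is |x_i|^\<delta>/(\<delta> |x_i|), which is g(x_i)/\<delta>.\<close>

lemma strong_max_plus_f_ge:
  fixes x :: "real ^ 'n"
  shows "ennreal ((1 / \<delta>) ^ CARD('n)) * ennreal \<bar>f x\<bar> \<le> strong_max_plus f x"
proof (cases "\<forall>i. - 1 < x $ i \<and> x $ i < 0")
  case True
  then have x: "- 1 < x $ i" "x $ i < 0" for i by auto
  let ?h = "- x"
  have h: "pos_vec ?h" using x by (simp add: pos_vec_def)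
  have mg: "mass (\<lambda>t. ennreal (g t)) (x $ i) 0 / ennreal (- x $ i) = ennreal (1 / \<delta>) * ennreal (g (x $ i))" for i
  proof -
    have "mass (\<lambda>t. ennreal (g t)) (x $ i) 0 = D (- (- x $ i)) 0"
      unfolding mass_def using x[of i] by (intro nn_integral_cong) (auto simp: g_def indicator_def)
    also have "\<dots> = ennreal ((- x $ i) powr \<delta> / \<delta>)" using x[of i] \<delta> by (intro mass_power_left) auto
    finally have "mass (\<lambda>t. ennreal (g t)) (x $ i) 0 / ennreal (- x $ i) = ennreal ((- x $ i) powr \<delta> / \<delta> / (- x $ i))"
      using x[of i] \<delta> by (simp add: divide_ennreal)
    also have "(- x $ i) powr \<delta> / \<delta> / (- x $ i) = 1 / \<delta> * g (x $ i)"
      using x[of i] by (simp add: g_def powr_diff)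
    finally show ?thesis using \<delta> by (simp add: ennreal_mult[symmetric] g_nonneg)
  qed
  have "ennreal ((1 / \<delta>) ^ CARD('n)) * ennreal \<bar>f x\<bar> = (\<Prod>i\<in>UNIV. ennreal (1 / \<delta>) * ennreal (g (x $ i)))"
    using \<delta> by (simp add: ennreal_f prod.distrib ennreal_power)
  also have "\<dots> = (\<Prod>i\<in>UNIV. mass (\<lambda>t. ennreal (g t)) (x $ i) 0 / ennreal (?h $ i))"
    using mg by simp
  also have "\<dots> = (\<Prod>i\<in>UNIV. mass (\<lambda>t. ennreal (g t)) (x $ i) ((x + ?h) $ i)) / vol ?h"
    unfolding prod_divide_vol[OF h] by simp
  also have "\<dots> = (\<integral>\<^sup>+ y\<in>box_plus x ?h. ennreal \<bar>f y\<bar> \<partial>lebesgue) / vol ?h"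
    unfolding box_plus_def nn_integral_lebesgue ennreal_f by (subst nn_integral_prod_cbox) auto
  also have "\<dots> \<le> strong_max_plus f x"
    unfolding strong_max_plus_def using h by (intro SUP_upper) auto
  finally show ?thesis .
next
  case False
  then have "f x = 0" by (auto simp: f_def g_def prod_zero_iff)
  then show ?thesis by simp
qed

lemma Lp_norm_strong_max_f_ge:
  "ennreal ((1 / \<delta>) ^ CARD('n)) * Lp_norm p w (\<lambda>x :: real ^ 'n. ennreal \<bar>f x\<bar>) \<le> Lp_norm p w (strong_max_plus (f :: real ^ 'n \<Rightarrow> real))"
proof -
  let ?I = "\<integral>\<^sup>+ (x :: real ^ 'n). ennpow (ennreal \<bar>f x\<bar>) p * ennreal (w x) \<partial>lborel"
  let ?c = "ennreal ((1 / \<delta>) ^ CARD('n))"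
  have "?c * Lp_norm p w (\<lambda>x :: real ^ 'n. ennreal \<bar>f x\<bar>) =
    ennpow (ennpow ?c p * ?I) (1 / p)"
    using p by (simp add: Lp_norm_def nn_integral_lebesgue ennpow_mult ennpow_ennpow)
  also have "ennpow ?c p * ?I =
    (\<integral>\<^sup>+ (x :: real ^ 'n). ennpow (?c * ennreal \<bar>f x\<bar>) p * ennreal (w x) \<partial>lborel)"
    using p by (simp add: nn_integral_cmult[symmetric] ennpow_mult mult.assoc)
  also have "ennpow \<dots> (1 / p) \<le> Lp_norm p w (strong_max_plus (f :: real ^ 'n \<Rightarrow> real))"
    unfolding Lp_norm_def nn_integral_lebesgue using p
    by (intro ennpow_mono nn_integral_mono mult_right_mono strong_max_plus_f_ge) auto
  finally show ?thesis .
qed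

end

section \<open>From the extremal example to the growth of \<psi>\<close>

lemma sharp_example_plus:
  fixes p \<delta> :: real
  assumes "1 < p" "0 < \<delta>" "\<delta> < 1"
  obtains w f :: "real ^ 'n \<Rightarrow> real" where
    "w \<in> Ap_strong_plus p" "f \<in> Lp_space p w"
    "1 \<le> enn2real (\<Prod>i\<in>UNIV. Ap_char_plus p i w)"
    "enn2real (\<Prod>i\<in>UNIV. Ap_char_plus p i w) \<le> (6 / \<delta>) powr (real CARD('n) * (p - 1))"
    "0 < Lp_norm p w (\<lambda>x. ennreal \<bar>f x\<bar>)"
    "ennreal ((1 / \<delta>) ^ CARD('n)) * Lp_norm p w (\<lambda>x. ennreal \<bar>f x\<bar>) \<le> Lp_norm p w (strong_max_plus f)"
proof -
  interpret power_weight p \<delta> by unfold_locales fact+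
  let ?w = "w :: real ^ 'n \<Rightarrow> real" and ?f = "f :: real ^ 'n \<Rightarrow> real"
  obtain a where a: "Ap1_plus p u = ennreal a" "0 \<le> a"
    using le_less_trans[OF Ap1_plus_u_le, of top] by (cases "Ap1_plus p u") auto
  have a1: "1 \<le> a" using Ap1_plus_u_ge a by (simp add: ennreal_1[symmetric] del: ennreal_1)
  have a2: "a \<le> (6 / \<delta>) powr (p - 1)" using Ap1_plus_u_le a by simp
  have P: "enn2real (\<Prod>i\<in>UNIV. Ap_char_plus p i ?w) = a ^ CARD('n)"
    using a by (simp add: Ap_char_plus_w ennreal_power)
  have "a ^ CARD('n) \<le> ((6 / \<delta>) powr (p - 1)) ^ CARD('n)" using a a2 by (intro power_mono)
  also have "\<dots> = (6 / \<delta>) powr (real CARD('n) * (p - 1))"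
    using \<delta> by (simp add: powr_realpow[symmetric] powr_powr mult.commute)
  finally have "a ^ CARD('n) \<le> (6 / \<delta>) powr (real CARD('n) * (p - 1))" .
  moreover have "?f \<in> Lp_space p ?w"
    by (simp add: Lp_space_def Lp_norm_f measurable_completion)
  ultimately show ?thesis
    using a1 \<delta> by (intro that[of ?w ?f]) (simp_all add: w_Ap_strong_plus P Lp_norm_f Lp_norm_strong_max_f_ge[unfolded Lp_norm_f])
qed

text \<open>If \<delta> is tuned so that (6/\<delta>)^(n(p-1)) = T, then T^(1/(p-1)) =
  (6/\<delta>)^n. Monotonicity yields \<psi>(T) \<ge> \<delta>^(-n) = 6^(-n) T^(1/(p-1)), against
  the limit.\<close>

lemma no_better_power:
  fixes p :: real and \<psi> :: "real \<Rightarrow> real" and n :: nat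
  assumes p: "1 < p" and n: "0 < n" and mono: "mono_on {1..} \<psi>"
    and lim: "((\<lambda>t. \<psi> t / t powr (1 / (p - 1))) \<longlongrightarrow> 0) at_top"
    and ex: "\<And>\<delta>. 0 < \<delta> \<Longrightarrow> \<delta> < 1 \<Longrightarrow> \<exists>A. 1 \<le> A \<and> A \<le> (6 / \<delta>) powr (real n * (p - 1)) \<and> (1 / \<delta>) ^ n \<le> \<psi> A"
  shows False
proof -
  have "eventually (\<lambda>t. \<psi> t / t powr (1 / (p - 1)) < (1 / 6) ^ n) at_top"
    using lim by (rule order_tendstoD) simp
  then obtain T0 where T0: "\<And>t. T0 \<le> t \<Longrightarrow> \<psi> t / t powr (1 / (p - 1)) < (1 / 6) ^ n"
    by (auto simp: eventually_at_top_linorder)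
  let ?e = "real n * (p - 1)"
  have e: "0 < ?e" using p n by simp
  \<comment> \<open>T lies beyond the threshold \<open>T0\<close> and in [1, \<infinity>); the third
    entry forces 6/\<delta> \<ge> 7, hence \<delta> < 1.\<close>
  define T where "T = max (max T0 1) (7 powr ?e)"
  define \<delta> where "\<delta> = 6 / T powr (1 / ?e)"
  have T: "T0 \<le> T" "1 \<le> T" "7 powr ?e \<le> T" by (auto simp: T_def)
  have "(7 powr ?e) powr (1 / ?e) \<le> T powr (1 / ?e)" using T e by (intro powr_mono2) auto
  then have T7: "7 \<le> T powr (1 / ?e)" using p n by (simp add: powr_powr)
  then have \<delta>: "0 < \<delta>" "\<delta> < 1" using T by (auto simp: \<delta>_def)
  have "6 / \<delta> = T powr (1 / ?e)" using T by (simp add: \<delta>_def)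
  moreover have "1 / ?e * ?e = 1" using p n by simp
  ultimately have T\<delta>: "(6 / \<delta>) powr ?e = T" using T by (simp only: powr_powr) simp
  obtain A where A: "1 \<le> A" "A \<le> T" "(1 / \<delta>) ^ n \<le> \<psi> A" using ex[OF \<delta>] unfolding T\<delta> by blast
  have "(1 / 6) ^ n * T powr (1 / (p - 1)) = (1 / 6) ^ n * (6 / \<delta>) ^ n"
    unfolding T\<delta>[symmetric] using p \<delta> by (simp add: powr_powr powr_realpow)
  also have "\<dots> = (1 / \<delta>) ^ n" by (simp add: power_mult_distrib[symmetric])
  also have "\<dots> \<le> \<psi> T" using A mono_onD[OF mono, of A T] by simp
  finally have "(1 / 6) ^ n \<le> \<psi> T / T powr (1 / (p - 1))" using T by (simp add: field_simps)
  with T0[OF T(1)] show False by simp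
qed

section \<open>Reflection\<close>

lemma reflect_vec_lborel: "distr lborel borel uminus = (lborel :: (real ^ 'n) measure)"
proof (rule lborel_eqI[symmetric])
  fix l u :: "real ^ 'n" assume le: "\<And>b. b \<in> Basis \<Longrightarrow> l \<bullet> b \<le> u \<bullet> b"
  have "l $ i < - x $ i \<and> - x $ i < u $ i \<longleftrightarrow> - u $ i < x $ i \<and> x $ i < - l $ i" for x :: "real ^ 'n" and i by auto
  then have "uminus -` box l u = box (- u) (- l)" by (simp add: vimage_def mem_box_cart set_eq_iff)
  then have "emeasure (distr lborel borel uminus) (box l u) = emeasure lborel (box (- u) (- l))"
    by (subst emeasure_distr) auto
  also have "\<dots> = ennreal (\<Prod>b\<in>Basis. (u - l) \<bullet> b)"
    using le by (subst emeasure_lborel_box) (auto simp: inner_diff_left)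
  finally show "emeasure (distr lborel borel uminus) (box l u) = ennreal (\<Prod>b\<in>Basis. (u - l) \<bullet> b)" .
qed simp

text \<open>The integral is a supremum over simple functions below g. Reflecting these gives one
  inequality, and the same inequality for the reflected g gives the other.\<close>

lemma nn_integral_reflect:
  fixes g :: "'a :: {euclidean_space} \<Rightarrow> ennreal"
  assumes inv: "distr lborel borel uminus = (lborel :: 'a measure)"
  shows "(\<integral>\<^sup>+ x. g (- x) \<partial>lborel) = (\<integral>\<^sup>+ x. g x \<partial>lborel)"
proof -
  have le: "integral\<^sup>N lborel g \<le> (\<integral>\<^sup>+ x. g (- x) \<partial>lborel)" for g :: "'a \<Rightarrow> ennreal"
    unfolding nn_integral_def[of lborel g]
  proof (rule SUP_least, clarify)
    fix h :: "'a \<Rightarrow> ennreal" assume h: "simple_function lborel h" "h \<le> g"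
    then have [measurable]: "h \<in> borel_measurable borel" using borel_measurable_simple_function by fastforce
    have "integral\<^sup>S lborel h = (\<integral>\<^sup>+ x. h x \<partial>lborel)" using h by (simp add: nn_integral_eq_simple_integral)
    also have "\<dots> = (\<integral>\<^sup>+ x. h (- x) \<partial>lborel)" by (subst inv[symmetric], subst nn_integral_distr) auto
    also have "\<dots> \<le> (\<integral>\<^sup>+ x. g (- x) \<partial>lborel)" using h by (intro nn_integral_mono) (auto simp: le_fun_def)
    finally show "integral\<^sup>S lborel h \<le> (\<integral>\<^sup>+ x. g (- x) \<partial>lborel)" .
  qed
  from le[of g] le[of "\<lambda>x. g (- x)"] show ?thesis by simp
qed

lemmas nn_integral_reflect_vec = nn_integral_reflect[OF reflect_vec_lborel]
lemmas nn_integral_reflect_real = nn_integral_reflect[OF lborel_distr_uminus]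

lemma AE_reflect:
  fixes P :: "'a :: {euclidean_space} \<Rightarrow> bool"
  assumes inv: "distr lborel borel uminus = (lborel :: 'a measure)" and "AE x in lborel. P x"
  shows "AE x in lborel. P (- x)"
proof -
  from AE_E[OF assms(2)] obtain N where N: "{x. \<not> P x} \<subseteq> N" "emeasure lborel N = 0" "N \<in> sets lborel" by auto
  then have "N \<in> null_sets (distr lborel borel uminus)" unfolding inv by (auto simp: null_sets_def)
  then have "AE x in distr lborel borel uminus. x \<notin> N" by (rule AE_not_in)
  then have "AE x in lborel. - x \<notin> N" using N by (subst (asm) AE_distr_iff) auto
  then show ?thesis by eventually_elim (use N in auto)
qed

abbreviation reflect :: "('a::uminus \<Rightarrow> 'b) \<Rightarrow> 'a \<Rightarrow> 'b" where "reflect f \<equiv> \<lambda>x. f (- x)"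

lemma set_nn_integral_reflect:
  fixes g :: "real ^ 'n \<Rightarrow> ennreal"
  shows "(\<integral>\<^sup>+ y\<in>box_plus x h. g y \<partial>lborel) = (\<integral>\<^sup>+ y\<in>box_minus (- x) h. g (- y) \<partial>lborel)"
    "(\<integral>\<^sup>+ y\<in>box_minus x h. g y \<partial>lborel) = (\<integral>\<^sup>+ y\<in>box_plus (- x) h. g (- y) \<partial>lborel)"
proof -
  have b: "- y \<in> box_plus x h \<longleftrightarrow> y \<in> box_minus (- x) h" "- y \<in> box_minus x h \<longleftrightarrow> y \<in> box_plus (- x) h" for y :: "real ^ 'n"
  proof -
    have "x $ i \<le> - y $ i \<and> - y $ i \<le> x $ i + h $ i \<longleftrightarrow> - x $ i - h $ i \<le> y $ i \<and> y $ i \<le> - x $ i" for i by auto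
    then show "- y \<in> box_plus x h \<longleftrightarrow> y \<in> box_minus (- x) h" by (simp add: box_plus_def box_minus_def mem_box_cart)
    have "x $ i - h $ i \<le> - y $ i \<and> - y $ i \<le> x $ i \<longleftrightarrow> - x $ i \<le> y $ i \<and> y $ i \<le> - x $ i + h $ i" for i by auto
    then show "- y \<in> box_minus x h \<longleftrightarrow> y \<in> box_plus (- x) h" by (simp add: box_plus_def box_minus_def mem_box_cart)
  qed
  show "(\<integral>\<^sup>+ y\<in>box_plus x h. g y \<partial>lborel) = (\<integral>\<^sup>+ y\<in>box_minus (- x) h. g (- y) \<partial>lborel)"
    by (subst nn_integral_reflect_vec[symmetric]) (auto intro!: nn_integral_cong simp: indicator_def b)
  show "(\<integral>\<^sup>+ y\<in>box_minus x h. g y \<partial>lborel) = (\<integral>\<^sup>+ y\<in>box_plus (- x) h. g (- y) \<partial>lborel)"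
    by (subst nn_integral_reflect_vec[symmetric]) (auto intro!: nn_integral_cong simp: indicator_def b)
qed

lemma strong_max_minus_reflect: "strong_max_minus f x = strong_max_plus (reflect f) (- x)"
  unfolding strong_max_minus_def strong_max_plus_def nn_integral_lebesgue
  by (simp add: set_nn_integral_reflect(2))

lemma measurable_lebesgue_reflect:
  fixes f :: "real ^ 'n \<Rightarrow> 'b::topological_space"
  assumes "f \<in> borel_measurable lebesgue"
  shows "reflect f \<in> borel_measurable lebesgue"
  using measurable_compose[OF lebesgue_measurable_scaling[of "-1"] assms] by simp

lemma integrable_lebesgue_reflect:
  fixes g :: "real ^ 'n \<Rightarrow> real"
  assumes "integrable lebesgue g" shows "integrable lebesgue (reflect g)"
  using assms measurable_lebesgue_reflect[of g] nn_integral_reflect_vec[of "\<lambda>x. ennreal (norm (g x))"]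
  by (simp add: integrable_iff_bounded nn_integral_lebesgue)

lemma weight_reflect:
  fixes w :: "real ^ 'n \<Rightarrow> real"
  assumes "weight w" shows "weight (reflect w)"
  unfolding weight_def
proof (intro conjI allI impI)
  show "reflect w \<in> borel_measurable lebesgue"
    using assms by (intro measurable_lebesgue_reflect) (simp add: weight_def)
  have "AE x in lborel. 0 < w x" using assms by (simp add: weight_def AE_completion_iff)
  then show "AE x in lebesgue. 0 < w (- x)"
    unfolding AE_completion_iff by (rule AE_reflect[OF reflect_vec_lborel])
  fix K :: "(real ^ 'n) set" assume "compact K"
  then have "compact (uminus ` K)" by (rule compact_negations)
  then have "integrable lebesgue (\<lambda>x. indicator (uminus ` K) x *\<^sub>R w x)"
    using assms by (simp add: weight_def set_integrable_def)
  from integrable_lebesgue_reflect[OF this]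
  have "integrable lebesgue (\<lambda>x. indicator (uminus ` K) (- x) *\<^sub>R w (- x))" .
  moreover have "indicator (uminus ` K) (- x) = (indicator K x :: real)" for x
    by (auto simp: indicator_def)
  ultimately show "set_integrable lebesgue K (reflect w)"
    by (simp add: set_integrable_def)
qed

lemma reflect_Ap_strong_plus:
  fixes w :: "real ^ 'n \<Rightarrow> real"
  assumes "w \<in> Ap_strong_minus p" shows "reflect w \<in> Ap_strong_plus p"
proof -
  let ?S = "{(x :: real ^ 'n, h). pos_vec h}"
  let ?F = "\<lambda>(x, h). ((\<integral>\<^sup>+ y\<in>box_minus x h. ennreal (w (- y)) \<partial>lborel) / vol h) *
      ennpow ((\<integral>\<^sup>+ y\<in>box_plus x h. ennreal (w (- y) powr (1 - conj_exp p)) \<partial>lborel) / vol h) (p - 1)"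
  let ?G = "\<lambda>(x, h). ((\<integral>\<^sup>+ y\<in>box_plus x h. ennreal (w y) \<partial>lborel) / vol h) *
      ennpow ((\<integral>\<^sup>+ y\<in>box_minus x h. ennreal (w y powr (1 - conj_exp p)) \<partial>lborel) / vol h) (p - 1)"
  have "?F (x, h) \<le> (SUP z\<in>?S. ?G z)" if "pos_vec h" for x h
    using that by (intro SUP_upper2[of "(- x, h)"]) (simp_all add: set_nn_integral_reflect[where x="- x"])
  then have "(SUP z\<in>?S. ?F z) \<le> (SUP z\<in>?S. ?G z)" by (intro SUP_least) blast
  moreover have "(SUP z\<in>?S. ?G z) < \<infinity>"
    using assms by (simp add: Ap_strong_minus_def nn_integral_lebesgue)
  ultimately show ?thesis
    using assms weight_reflect[of w] by (auto simp: Ap_strong_plus_def Ap_strong_minus_def nn_integral_lebesgue intro: le_less_trans)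
qed

lemma reflect_Ap_strong_minus:
  fixes w :: "real ^ 'n \<Rightarrow> real"
  assumes "w \<in> Ap_strong_plus p" shows "reflect w \<in> Ap_strong_minus p"
proof -
  let ?S = "{(x :: real ^ 'n, h). pos_vec h}"
  let ?F = "\<lambda>(x, h). ((\<integral>\<^sup>+ y\<in>box_plus x h. ennreal (w (- y)) \<partial>lborel) / vol h) *
      ennpow ((\<integral>\<^sup>+ y\<in>box_minus x h. ennreal (w (- y) powr (1 - conj_exp p)) \<partial>lborel) / vol h) (p - 1)"
  let ?G = "\<lambda>(x, h). ((\<integral>\<^sup>+ y\<in>box_minus x h. ennreal (w y) \<partial>lborel) / vol h) *
      ennpow ((\<integral>\<^sup>+ y\<in>box_plus x h. ennreal (w y powr (1 - conj_exp p)) \<partial>lborel) / vol h) (p - 1)"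
  have "?F (x, h) \<le> (SUP z\<in>?S. ?G z)" if "pos_vec h" for x h
    using that by (intro SUP_upper2[of "(- x, h)"]) (simp_all add: set_nn_integral_reflect[where x="- x"])
  then have "(SUP z\<in>?S. ?F z) \<le> (SUP z\<in>?S. ?G z)" by (intro SUP_least) blast
  moreover have "(SUP z\<in>?S. ?G z) < \<infinity>"
    using assms by (simp add: Ap_strong_plus_def nn_integral_lebesgue)
  ultimately show ?thesis
    using assms weight_reflect[of w] by (auto simp: Ap_strong_plus_def Ap_strong_minus_def nn_integral_lebesgue intro: le_less_trans)
qed

text \<open>The substitution s -> -s exchanges left and right intervals, so the pair (t, h)
  corresponds to (-t, h).\<close>

lemma Ap1_plus_reflect: "Ap1_plus p (reflect v) = Ap1_minus p v"
proof -
  have r: "(\<integral>\<^sup>+ s\<in>{a..b}. g (- s) \<partial>lborel) = (\<integral>\<^sup>+ s\<in>{- b..- a}. g s \<partial>lborel)" for a b :: real and g :: "real \<Rightarrow> ennreal"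
  proof -
    have "(\<integral>\<^sup>+ s\<in>{a..b}. g (- s) \<partial>lborel) = (\<integral>\<^sup>+ s. g (- s) * indicator {- b..- a} (- s) \<partial>lborel)"
      by (intro nn_integral_cong) (auto simp: indicator_def)
    then show ?thesis using nn_integral_reflect_real[of "\<lambda>s. g s * indicator {- b..- a} s"] by simp
  qed
  note r1 = r[where g="\<lambda>s. ennreal (v s)"] and r2 = r[where g="\<lambda>s. ennreal (v s powr (1 - conj_exp p))"]
  let ?G = "\<lambda>(t, h). ((\<integral>\<^sup>+ s\<in>{t..t + h}. ennreal (v s) \<partial>lborel) / ennreal h) *
    ennpow ((\<integral>\<^sup>+ s\<in>{t - h..t}. ennreal (v s powr (1 - conj_exp p)) \<partial>lborel) / ennreal h) (p - 1)"
  let ?\<rho> = "\<lambda>(t :: real, h :: real). (- t, h)"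
  have eq: "- (t - h) = - t + h" "- (t + h) = - t - h" for t h :: real by simp_all
  have "Ap1_plus p (reflect v) = (SUP z\<in>UNIV \<times> {0<..}. ?G (?\<rho> z))"
    unfolding Ap1_plus_def nn_integral_lebesgue r1 r2 eq by (simp add: case_prod_unfold)
  also have "\<dots> = (SUP z\<in>?\<rho> ` (UNIV \<times> {0<..}). ?G z)" by (simp only: image_image)
  also have "?\<rho> ` (UNIV \<times> {0<..}) = UNIV \<times> {0<..}"
    by (auto simp: image_iff split: prod.splits intro: exI[of _ "- _"]) (metis minus_minus)
  finally show ?thesis by (simp add: Ap1_minus_def nn_integral_lebesgue)
qed

text \<open>Restricting the reflected point to the coordinates other than i keeps it in the
  extensional space of the product measure. Invariance is checked on product sets.\<close>

lemma other_coords_reflect: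
  "distr (other_coords i) (other_coords i) (\<lambda>z. \<lambda>j\<in>UNIV - {i}. - z j) = other_coords (i :: 'n::finite)"
proof -
  interpret product_sigma_finite "\<lambda>_::'n. lborel :: real measure" by (rule product_sigma_finite_lborel)
  let ?I = "UNIV - {i}" and ?\<rho> = "\<lambda>z::'n \<Rightarrow> real. \<lambda>j\<in>UNIV - {i}. - z j"
  have rm: "?\<rho> \<in> Pi\<^sub>M ?I (\<lambda>_. lborel) \<rightarrow>\<^sub>M Pi\<^sub>M ?I (\<lambda>_. lborel)"
    by (intro measurable_restrict) measurable
  show ?thesis unfolding other_coords_def
  proof (rule PiM_eqI)
    fix A :: "'n \<Rightarrow> real set" assume A: "\<And>j. j \<in> ?I \<Longrightarrow> A j \<in> sets lborel"
    have vim: "?\<rho> -` Pi\<^sub>E ?I A \<inter> space (Pi\<^sub>M ?I (\<lambda>_. lborel)) = Pi\<^sub>E ?I (\<lambda>j. uminus -` A j)"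
      by (auto simp: space_PiM PiE_iff)
    have m: "uminus -` A j \<in> sets lborel" if "j \<in> ?I" for j
      using measurable_sets[of uminus lborel lborel "A j"] A[OF that] by simp
    have e: "emeasure lborel (uminus -` A j) = emeasure lborel (A j)" if "j \<in> ?I" for j
      using A[OF that] by (subst (2) lborel_distr_uminus[symmetric], subst emeasure_distr) auto
    have "emeasure (distr (Pi\<^sub>M ?I (\<lambda>_. lborel)) (Pi\<^sub>M ?I (\<lambda>_. lborel)) ?\<rho>) (Pi\<^sub>E ?I A) =
      emeasure (Pi\<^sub>M ?I (\<lambda>_. lborel)) (Pi\<^sub>E ?I (\<lambda>j. uminus -` A j))"
      using A by (subst emeasure_distr[OF rm]) (simp_all only: vim sets_PiM_I_finite finite)
    also have "\<dots> = (\<Prod>j\<in>?I. emeasure lborel (uminus -` A j))"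
      by (rule emeasure_PiM) (simp, rule m)
    also have "\<dots> = (\<Prod>j\<in>?I. emeasure lborel (A j))" by (intro prod.cong refl e)
    finally show "emeasure (distr (Pi\<^sub>M ?I (\<lambda>_. lborel)) (Pi\<^sub>M ?I (\<lambda>_. lborel)) ?\<rho>) (Pi\<^sub>E ?I A) = (\<Prod>j\<in>?I. emeasure lborel (A j))" .
  qed auto
qed

text \<open>The reflection preserves null sets, so composing with it cannot raise an essential
  supremum; applying this twice gives equality. The reflection overwrites the i-th coordinate, but
  slices ignore it, so on them it acts as an involution.\<close>

lemma Ap_char_plus_reflect:
  fixes w :: "real ^ 'n \<Rightarrow> real"
  shows "Ap_char_plus p i (reflect w) = Ap_char_minus p i w"
proof -
  let ?M = "other_coords i" and ?\<rho> = "\<lambda>z::'n \<Rightarrow> real. \<lambda>j\<in>UNIV - {i}. - z j"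
  have rm: "?\<rho> \<in> ?M \<rightarrow>\<^sub>M ?M"
    unfolding other_coords_def by (intro measurable_restrict) measurable
  have ae: "AE z in ?M. P (?\<rho> z)" if "AE z in ?M. P z" for P
  proof -
    from AE_E[OF that] obtain N where N: "{x \<in> space ?M. \<not> P x} \<subseteq> N" "emeasure ?M N = 0" "N \<in> sets ?M" by auto
    then have "N \<in> null_sets (distr ?M ?M ?\<rho>)" unfolding other_coords_reflect by (auto simp: null_sets_def)
    then have "AE x in distr ?M ?M ?\<rho>. x \<notin> N" by (rule AE_not_in)
    then have "AE x in ?M. ?\<rho> x \<notin> N" using N by (subst (asm) AE_distr_iff[OF rm]) auto
    then show ?thesis
      using AE_space by eventually_elim (use N measurable_space[OF rm] in blast)
  qed
  have le: "ess_sup ?M (\<lambda>z. F (?\<rho> z)) \<le> ess_sup ?M F" for F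
    unfolding ess_sup_def[of ?M "\<lambda>z. F (?\<rho> z)"] by (rule Limsup_bounded) (rule ae[OF ess_sup_AE])
  define F where "F z = Ap1_minus p (slice i z w)" for z
  have F\<rho>: "Ap1_plus p (slice i z (reflect w)) = F (?\<rho> z)" for z
  proof -
    have "slice i z (reflect w) = reflect (slice i (?\<rho> z) w)"
      by (auto simp: slice_def fun_eq_iff vec_eq_iff intro!: arg_cong[where f=w])
    then show ?thesis by (simp add: Ap1_plus_reflect F_def)
  qed
  have "F (?\<rho> (?\<rho> z)) = F z" for z
    unfolding F_def by (rule arg_cong[where f="Ap1_minus p"]) (auto simp: slice_def fun_eq_iff vec_eq_iff intro!: arg_cong[where f=w])
  then have "ess_sup ?M F = ess_sup ?M (\<lambda>z. F (?\<rho> z))"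
    using le[of F] le[of "\<lambda>z. F (?\<rho> z)"] by simp
  then show ?thesis by (simp add: Ap_char_plus_def Ap_char_minus_def F\<rho> F_def[symmetric])
qed

lemma Lp_norm_reflect:
  fixes w :: "real ^ 'n \<Rightarrow> real"
  shows "Lp_norm p (reflect w) (reflect g) = Lp_norm p w g"
  using nn_integral_reflect_vec[of "\<lambda>x. ennpow (g x) p * ennreal (w x)"]
  by (simp add: Lp_norm_def nn_integral_lebesgue)

lemma Lp_norm_strong_max_reflect:
  fixes w f :: "real ^ 'n \<Rightarrow> real"
  shows "Lp_norm p (reflect w) (strong_max_plus (reflect f)) = Lp_norm p w (strong_max_minus f)"
  using Lp_norm_reflect[of p w "strong_max_minus f"] by (simp add: strong_max_minus_reflect)

lemma reflect_Lp_space: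
  fixes w f :: "real ^ 'n \<Rightarrow> real"
  assumes "f \<in> Lp_space p w" shows "reflect f \<in> Lp_space p (reflect w)"
  using assms measurable_lebesgue_reflect[of f] Lp_norm_reflect[of p w "\<lambda>x. ennreal \<bar>f x\<bar>"]
  by (simp add: Lp_space_def)

section \<open>Sharpness of the exponent and the full statement\<close>

lemma sharp_power_plus:
  fixes p :: real and \<psi> :: "real \<Rightarrow> real"
  assumes p: "1 < p" and \<psi>: "\<forall>t\<ge>1. 0 < \<psi> t" "mono_on {1..} \<psi>"
    and lim: "((\<lambda>t. \<psi> t / t powr (1 / (p - 1))) \<longlongrightarrow> 0) at_top"
    and bound: "\<And>w f. w \<in> (Ap_strong_plus p :: (real ^ 'n \<Rightarrow> real) set) \<Longrightarrow> f \<in> Lp_space p w \<Longrightarrow>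
      Lp_norm p w (strong_max_plus f) \<le> ennreal (\<psi> (enn2real (\<Prod>i\<in>UNIV. Ap_char_plus p i w))) * Lp_norm p w (\<lambda>x. ennreal \<bar>f x\<bar>)"
  shows False
proof (rule no_better_power[OF p _ \<psi>(2) lim])
  show "0 < CARD('n)" by simp
  fix \<delta> :: real assume \<delta>: "0 < \<delta>" "\<delta> < 1"
  obtain w f :: "real ^ 'n \<Rightarrow> real" where wf: "w \<in> Ap_strong_plus p" "f \<in> Lp_space p w"
    "1 \<le> enn2real (\<Prod>i\<in>UNIV. Ap_char_plus p i w)"
    "enn2real (\<Prod>i\<in>UNIV. Ap_char_plus p i w) \<le> (6 / \<delta>) powr (real CARD('n) * (p - 1))"
    "0 < Lp_norm p w (\<lambda>x. ennreal \<bar>f x\<bar>)"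
    "ennreal ((1 / \<delta>) ^ CARD('n)) * Lp_norm p w (\<lambda>x. ennreal \<bar>f x\<bar>) \<le> Lp_norm p w (strong_max_plus f)"
    by (rule sharp_example_plus[OF p \<delta>]) blast
  let ?A = "enn2real (\<Prod>i\<in>UNIV. Ap_char_plus p i w)" and ?N = "Lp_norm p w (\<lambda>x. ennreal \<bar>f x\<bar>)"
  have "ennreal ((1 / \<delta>) ^ CARD('n)) * ?N \<le> ennreal (\<psi> ?A) * ?N"
    using wf(6) bound[OF wf(1,2)] by (rule order_trans)
  moreover have "?N < \<infinity>" using wf(2) by (simp add: Lp_space_def)
  \<comment> \<open>The norm of the test function is positive and finite, so it cancels.\<close>
  ultimately have "ennreal ((1 / \<delta>) ^ CARD('n)) \<le> ennreal (\<psi> ?A)"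
    using wf(5) ennreal_mult_le_mult_iff[of ?N] by (simp add: mult.commute[of _ ?N] less_top)
  then have "(1 / \<delta>) ^ CARD('n) \<le> \<psi> ?A"
    using \<psi>(1) wf(3) by (simp add: less_imp_le)
  then show "\<exists>A. 1 \<le> A \<and> A \<le> (6 / \<delta>) powr (real CARD('n) * (p - 1)) \<and> (1 / \<delta>) ^ CARD('n) \<le> \<psi> A"
    using wf(3,4) by blast
qed

theorem theorem4p16:
  fixes p :: real
  assumes "1 < p"
  shows
    "(\<exists>c>0. \<forall>w\<in>(Ap_strong_plus p :: (real ^ 'n \<Rightarrow> real) set). \<forall>f\<in>Lp_space p w.
        Lp_norm p w (strong_max_plus f) \<le>
          ennreal c * ennpow (\<Prod>i\<in>UNIV. Ap_char_plus p i w) (1 / (p - 1)) *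
          Lp_norm p w (\<lambda>x. ennreal \<bar>f x\<bar>))
     \<and> \<not> (\<exists>\<psi> :: real \<Rightarrow> real.
          (\<forall>t\<ge>1. 0 < \<psi> t) \<and> mono_on {1..} \<psi> \<and>
          ((\<lambda>t. \<psi> t / t powr (1 / (p - 1))) \<longlongrightarrow> 0) at_top \<and>
          (\<forall>w\<in>(Ap_strong_plus p :: (real ^ 'n \<Rightarrow> real) set). \<forall>f\<in>Lp_space p w.
             Lp_norm p w (strong_max_plus f) \<le>
               ennreal (\<psi> (enn2real (\<Prod>i\<in>UNIV. Ap_char_plus p i w))) *
               Lp_norm p w (\<lambda>x. ennreal \<bar>f x\<bar>)))
     \<and> (\<exists>c>0. \<forall>w\<in>(Ap_strong_minus p :: (real ^ 'n \<Rightarrow> real) set). \<forall>f\<in>Lp_space p w.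
        Lp_norm p w (strong_max_minus f) \<le>
          ennreal c * ennpow (\<Prod>i\<in>UNIV. Ap_char_minus p i w) (1 / (p - 1)) *
          Lp_norm p w (\<lambda>x. ennreal \<bar>f x\<bar>))
     \<and> \<not> (\<exists>\<psi> :: real \<Rightarrow> real.
          (\<forall>t\<ge>1. 0 < \<psi> t) \<and> mono_on {1..} \<psi> \<and>
          ((\<lambda>t. \<psi> t / t powr (1 / (p - 1))) \<longlongrightarrow> 0) at_top \<and>
          (\<forall>w\<in>(Ap_strong_minus p :: (real ^ 'n \<Rightarrow> real) set). \<forall>f\<in>Lp_space p w.
             Lp_norm p w (strong_max_minus f) \<le>
               ennreal (\<psi> (enn2real (\<Prod>i\<in>UNIV. Ap_char_minus p i w))) *
               Lp_norm p w (\<lambda>x. ennreal \<bar>f x\<bar>)))"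
proof -
  let ?c = "max_const p powr (real CARD('n) / p)"
  have c: "0 < ?c" using max_const_pos[OF assms] by simp
  have upper: "Lp_norm p w (strong_max_plus f) \<le>
      ennreal ?c * ennpow (\<Prod>i\<in>UNIV. Ap_char_plus p i w) (1 / (p - 1)) * Lp_norm p w (\<lambda>x. ennreal \<bar>f x\<bar>)"
    if "w \<in> (Ap_strong_plus p :: (real ^ 'n \<Rightarrow> real) set)" "f \<in> Lp_space p w" for w f
    using that by (intro strong_maximal_bound assms) (simp_all add: Ap_strong_plus_def Lp_space_def)
  show ?thesis
  proof (intro conjI, goal_cases)
    case 1
    show ?case using c upper by blast
  next
    case 2
    show ?case using sharp_power_plus[OF assms, where ?'n = 'n] by blast
  next
    case 3
    show ?case
    proof (intro exI[of _ ?c] conjI ballI c)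
      fix w f :: "real ^ 'n \<Rightarrow> real" assume wf: "w \<in> Ap_strong_minus p" "f \<in> Lp_space p w"
      show "Lp_norm p w (strong_max_minus f) \<le>
          ennreal ?c * ennpow (\<Prod>i\<in>UNIV. Ap_char_minus p i w) (1 / (p - 1)) * Lp_norm p w (\<lambda>x. ennreal \<bar>f x\<bar>)"
        using upper[OF reflect_Ap_strong_plus[OF wf(1)] reflect_Lp_space[OF wf(2)]]
          Lp_norm_reflect[of p w "\<lambda>x. ennreal \<bar>f x\<bar>"]
        by (simp add: Lp_norm_strong_max_reflect Ap_char_plus_reflect)
    qed
  next
    case 4
    show ?case
    proof (rule notI, elim exE conjE)
      fix \<psi> :: "real \<Rightarrow> real"
      assume \<psi>: "\<forall>t\<ge>1. 0 < \<psi> t" "mono_on {1..} \<psi>" "((\<lambda>t. \<psi> t / t powr (1 / (p - 1))) \<longlongrightarrow> 0) at_top"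
        and bound: "\<forall>w\<in>(Ap_strong_minus p :: (real ^ 'n \<Rightarrow> real) set). \<forall>f\<in>Lp_space p w.
          Lp_norm p w (strong_max_minus f) \<le>
            ennreal (\<psi> (enn2real (\<Prod>i\<in>UNIV. Ap_char_minus p i w))) * Lp_norm p w (\<lambda>x. ennreal \<bar>f x\<bar>)"
      \<comment> \<open>A function \<psi> admissible for the minus operators is also admissible for
        the plus operators, as one sees by reflecting both weight and function.\<close>
      show False
      proof (rule sharp_power_plus[OF assms \<psi>])
        fix w f :: "real ^ 'n \<Rightarrow> real" assume wf: "w \<in> Ap_strong_plus p" "f \<in> Lp_space p w"
        have "Lp_norm p (reflect w) (strong_max_minus (reflect f)) \<le>
          ennreal (\<psi> (enn2real (\<Prod>i\<in>UNIV. Ap_char_minus p i (reflect w)))) * Lp_norm p (reflect w) (\<lambda>x. ennreal \<bar>f (- x)\<bar>)"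
          using bound reflect_Ap_strong_minus[OF wf(1)] reflect_Lp_space[OF wf(2)] by blast
        then show "Lp_norm p w (strong_max_plus f) \<le>
          ennreal (\<psi> (enn2real (\<Prod>i\<in>UNIV. Ap_char_plus p i w))) * Lp_norm p w (\<lambda>x. ennreal \<bar>f x\<bar>)"
          using Lp_norm_reflect[of p w "\<lambda>x. ennreal \<bar>f x\<bar>"]
          by (simp add: Lp_norm_strong_max_reflect[symmetric] Ap_char_plus_reflect[symmetric])
      qed
    qed
  qed
qed

end
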